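(* Let $k$ be any real number with $0<k\le 1$ and let $\rho_{AB_1\cdots B_{N-1}}$ be an $N$-qubit mixed state. If $k\,\mathcal{N}_{cAB_i}^2\ge \mathcal{N}_{cA|B_{i+1}\cdots B_{N-1}}^2$ for all $i=1,2,\ldots,N-2$, then for $\beta\ge 4$, $$ \mathcal{N}^{\beta}_{cA|B_1\cdots B_{N-1}} \ \ge\ \sum_{i=1}^{N-2}\Big(\prod_{j=1}^{i}\mathcal{P}_j\Big)\mathcal{N}^{\beta}_{cAB_{i+1}}, $$ where $M=\frac{(1+k)^{\beta/2}-1}{k^{\beta/2}}+k^{\beta/2}$ and $\mathcal{P}_j=M-\frac{\mathcal{N}^{\beta}_{cA|B_{j+1}\cdots B_{N-1}}}{\mathcal{N}^{\beta}_{cAB_j}}$ for $j=1,\ldots,N-2$.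
   Context: An $N$-qubit mixed state is a density matrix (positive semidefinite, trace one) on $H_A\otimes H_{B_1}\otimes\cdots\otimes H_{B_{N-1}}$, where every factor is $\mathbb{C}^2$. The negativity of a bipartite state $\rho_{XY}$ is normalized here as $\mathcal{N}(\rho_{XY})=\|\rho_{XY}^{T_X}\|-1$, where $T_X$ is the partial transpose on $X$ and $\|Z\|=\mathrm{tr}\sqrt{ZZ^\dagger}$ is the trace norm; for a pure state $|\psi\rangle_{XY}$ this equals $(\mathrm{tr}\sqrt{\rho_X})^2-1$ with $\rho_X=\mathrm{tr}_Y|\psi\rangle\langle\psi|$. The convex-roof extended negativity (CREN) of a bipartite mixed state is $\mathcal{N}_c(\rho_{XY})=\min\sum_i p_i\,\mathcal{N}(|\psi_i\rangle)$, the minimum being over all pure state decompositions $\rho_{XY}=\sum_i p_i|\psi_i\rangle\langle\psi_i|$ with $p_i\ge0$, $\sum_i p_i=1$. $\mathcal{N}_{cAB_i}$ is the CREN of the two-qubit reduced density matrix $\rho_{AB_i}$ of the given state (partial trace over all other subsystems). $\mathcal{N}_{cA|B_i\cdots B_{N-1}}$ is the CREN of the reduced density matrix on $A,B_i,\ldots,B_{N-1}$, viewed as a bipartite state under the bipartition $A$ versus $B_i\cdots B_{N-1}$; in particular $\mathcal{N}_{cA|B_{N-1}}=\mathcal{N}_{cAB_{N-1}}$. $\mathcal{N}^\beta_{c\,\cdot}$ means $(\mathcal{N}_{c\,\cdot})^\beta$. *)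

theory Defs
  imports
    Complex_Main
    "Jordan_Normal_Form.Schur_Decomposition"
begin

definition mat_trace :: "complex mat \<Rightarrow> complex" where
  "mat_trace A = (\<Sum>x<dim_row A. A $$ (x, x))"

text \<open>
  The order on \<^typ>\<open>complex\<close> is the one of \<^theory>\<open>HOL-Library.Complex_Order\<close>:
  \<^prop>\<open>0 \<le> (z::complex)\<close> says that \<^term>\<open>z\<close> is real and nonnegative, so the quadratic form being
  nonnegative includes hermiticity.
\<close>

definition psd :: "nat \<Rightarrow> complex mat \<Rightarrow> bool" where
  "psd d A \<longleftrightarrow> A \<in> carrier_mat d d \<and> (\<forall>v\<in>carrier_vec d. 0 \<le> (A *\<^sub>v v) \<bullet>c v)"

definition density_matrix :: "nat \<Rightarrow> complex mat \<Rightarrow> bool" where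
  "density_matrix d \<rho> \<longleftrightarrow> psd d \<rho> \<and> mat_trace \<rho> = 1"

text \<open>The square root of a positive semidefinite matrix is its unique positive semidefinite root.\<close>

definition psd_sqrt :: "complex mat \<Rightarrow> complex mat" where
  "psd_sqrt A = (THE R. psd (dim_row A) R \<and> R * R = A)"

definition trace_norm :: "complex mat \<Rightarrow> real" where
  "trace_norm Z = Re (mat_trace (psd_sqrt (Z * mat_adjoint Z)))"

definition pure_state :: "nat \<Rightarrow> complex vec \<Rightarrow> bool" where
  "pure_state d \<psi> \<longleftrightarrow> \<psi> \<in> carrier_vec d \<and> \<psi> \<bullet>c \<psi> = 1"

definition ket_bra :: "complex vec \<Rightarrow> complex mat" where
  "ket_bra \<psi> = mat (dim_vec \<psi>) (dim_vec \<psi>) (\<lambda>(x, y). \<psi> $ x * cnj (\<psi> $ y))"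

text \<open>
  Tensor products use the Kronecker convention: on \<open>\<complex>\<^sup>a \<otimes> \<complex>\<^sup>b\<close> the basis vector
  \<open>|s\<rangle> \<otimes> |t\<rangle>\<close> has index \<open>s * b + t\<close>, so an index \<open>x\<close> has the components
  \<open>x div b\<close> and \<open>x mod b\<close>. The partial transpose acts on the first factor.
\<close>

definition partial_transpose :: "nat \<Rightarrow> nat \<Rightarrow> complex mat \<Rightarrow> complex mat" where
  "partial_transpose a b \<rho> =
     mat (a * b) (a * b)
       (\<lambda>(x, y). \<rho> $$ ((y div b) * b + x mod b, (x div b) * b + y mod b))"

definition negativity :: "nat \<Rightarrow> nat \<Rightarrow> complex mat \<Rightarrow> real" where
  "negativity a b \<rho> = trace_norm (partial_transpose a b \<rho>) - 1"

text \<open>Ensembles of pure states of arbitrary finite size representing \<open>\<rho>\<close>; the equation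
  \<open>\<rho> = \<Sum>\<^sub>i p\<^sub>i |\<psi>\<^sub>i\<rangle>\<langle>\<psi>\<^sub>i|\<close> is stated entrywise.\<close>

definition pure_decomposition ::
  "nat \<Rightarrow> complex mat \<Rightarrow> nat \<Rightarrow> (nat \<Rightarrow> real) \<Rightarrow> (nat \<Rightarrow> complex vec) \<Rightarrow> bool" where
  "pure_decomposition d \<rho> n p \<psi> \<longleftrightarrow>
     (\<forall>i<n. 0 \<le> p i \<and> pure_state d (\<psi> i)) \<and> (\<Sum>i<n. p i) = 1 \<and>
     \<rho> = mat d d (\<lambda>xy. \<Sum>i<n. complex_of_real (p i) * ket_bra (\<psi> i) $$ xy)"

text \<open>The convex-roof minimum, written as an infimum; every term of the set is nonnegative, and
  the set is nonempty when \<open>\<rho>\<close> is a density matrix.\<close>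

definition cren :: "nat \<Rightarrow> nat \<Rightarrow> complex mat \<Rightarrow> real" where
  "cren a b \<rho> =
     Inf {\<Sum>i<n. p i * negativity a b (ket_bra (\<psi> i)) | n p \<psi>.
            pure_decomposition (a * b) \<rho> n p \<psi>}"

text \<open>
  For a matrix on \<open>\<complex>\<^sup>2 \<otimes> \<complex>\<^sup>p \<otimes> \<complex>\<^sup>q \<otimes> \<complex>\<^sup>r\<close>, the partial trace over the second and the
  fourth factor, a matrix on \<open>\<complex>\<^sup>2 \<otimes> \<complex>\<^sup>q\<close>.
\<close>

definition partial_trace_2_4 :: "nat \<Rightarrow> nat \<Rightarrow> nat \<Rightarrow> complex mat \<Rightarrow> complex mat" where
  "partial_trace_2_4 p q r \<rho> =
     mat (2 * q) (2 * q)
       (\<lambda>(x, y). \<Sum>u<p. \<Sum>v<r.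
          \<rho> $$ ((((x div q) * p + u) * q + x mod q) * r + v,
                (((y div q) * p + u) * q + y mod q) * r + v))"

text \<open>
  An \<open>N\<close>-qubit state is a matrix of dimension \<open>2 ^ N\<close>, with tensor factors in the order
  \<open>A, B\<^sub>1, \<dots>, B\<^bsub>N-1\<^esub>\<close>. For \<open>1 \<le> i \<le> l \<le> N - 1\<close>, \<open>reduced_A_B N i l \<rho>\<close> is the reduced
  density matrix on \<open>A, B\<^sub>i, \<dots>, B\<^sub>l\<close>, and \<open>cren_A_B N i l \<rho>\<close> is its convex-roof extended
  negativity for \<open>A\<close> versus \<open>B\<^sub>i \<dots> B\<^sub>l\<close>.
\<close>

definition reduced_A_B :: "nat \<Rightarrow> nat \<Rightarrow> nat \<Rightarrow> complex mat \<Rightarrow> complex mat" where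
  "reduced_A_B N i l \<rho> =
     partial_trace_2_4 (2 ^ (i - 1)) (2 ^ (l + 1 - i)) (2 ^ (N - 1 - l)) \<rho>"

definition cren_A_B :: "nat \<Rightarrow> nat \<Rightarrow> nat \<Rightarrow> complex mat \<Rightarrow> real" where
  "cren_A_B N i l \<rho> = cren 2 (2 ^ (l + 1 - i)) (reduced_A_B N i l \<rho>)"

end

theory Submission
  imports
    Defs
    "HOL-Analysis.Convex"
    "HOL-Analysis.Elementary_Metric_Spaces"
begin

text \<open>
  The negativity of a pure state with rows \<open>u\<close>, \<open>v\<close> on \<open>\<complex>\<^sup>2 \<otimes> \<complex>\<^sup>q\<close> is
  \<open>2 sqrt (\<parallel>u\<parallel>\<^sup>2 \<parallel>v\<parallel>\<^sup>2 - |\<langle>u, v\<rangle>|\<^sup>2)\<close>, so the claim follows from the monogamy inequality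
  \<open>N\<^sub>c(A|BC)\<^sup>2 \<ge> N\<^sub>c(AB)\<^sup>2 + N\<^sub>c(A|C)\<^sup>2\<close> for a qubit \<open>B\<close> and an arbitrary system \<open>C\<close>. By
  Minkowski's inequality it suffices to treat pure states, and since \<open>N\<^sub>c\<close> is an infimum it
  suffices to exhibit good ensembles. Write the state as four vectors \<open>a, b, c, d\<close> of \<open>C\<close>
  (for the basis states \<open>00, 01, 10, 11\<close> of \<open>AB\<close>). For \<open>AC\<close> we measure \<open>B\<close> in the basis that
  minimises the sum of the areas spanned by \<open>a, c\<close> and by \<open>b, d\<close>. Stationarity of this minimum
  implies that, after a local unitary on \<open>A\<close> and a scaling, the Gram matrix of \<open>a, b, c, d\<close> is
  invariant under the antilinear flip \<open>a \<leftrightarrow> d\<close>, \<open>b \<leftrightarrow> c\<close>. Hence \<open>\<rho>\<^sub>A\<^sub>B\<close> has an ensemble of flip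
  invariant vectors; their determinants \<open>a d - b c\<close> are real with known sum, and rotating
  pairs of them makes all determinants have the same sign, so that the sum of the absolute values is
  exactly what the inequality allows.
\<close>

section \<open>Gram determinants and local unitaries\<close>

text \<open>\<open>C\<close> enters only through inner products, so its dimension is arbitrary, and
  an ensemble of \<open>A B\<close> is any list of vectors whose rank-one matrices add up to the
  Gram matrix. The minimal measurement of \<open>B\<close>, unlike a fixed one, supplies an
  equation: rescale the two post-measurement Gram matrices to determinant 1 and choose a basis of
  \<open>A\<close> in which their off-diagonal entries agree; then the cross terms of the
  first-order condition cancel, and what remains is one linear relation between \<open><a,b>\<close>
  and \<open><c,d>\<close>, the missing part of the flip symmetry. Two situations escape this. If an
  area vanishes, the square root is not differentiable, but a direct estimate is sharp. If the
  rescaled matrices coincide, the condition is empty, and the minimum is compared with a basis at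
  finite distance. The powers rest on one function of \<open>x\<close>, the squared ratio of tail to
  pair: \<open>M\<close> is its value at \<open>k\<close>, and it decreases on \<open>(0, 1]\<close>
  once \<open>\<beta> / 2\<close> is at least 2. This is where \<open>k \<le> 1\<close> and
  \<open>4 \<le> \<beta>\<close> enter.\<close>

definition ip :: "nat \<Rightarrow> (nat \<Rightarrow> complex) \<Rightarrow> (nat \<Rightarrow> complex) \<Rightarrow> complex" where
  "ip q f g = (\<Sum>w<q. f w * cnj (g w))"

definition nsq :: "nat \<Rightarrow> (nat \<Rightarrow> complex) \<Rightarrow> real" where
  "nsq q f = (\<Sum>w<q. (cmod (f w))\<^sup>2)"

definition mix :: "complex \<Rightarrow> complex \<Rightarrow> (nat \<Rightarrow> complex) \<Rightarrow> (nat \<Rightarrow> complex) \<Rightarrow> nat \<Rightarrow> complex" where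
  "mix s t f g = (\<lambda>w. s * f w + t * g w)"

definition gram_det :: "real \<Rightarrow> real \<Rightarrow> complex \<Rightarrow> real" where
  "gram_det m n z = m * n - (cmod z)\<^sup>2"

definition area :: "nat \<Rightarrow> (nat \<Rightarrow> complex) \<Rightarrow> (nat \<Rightarrow> complex) \<Rightarrow> real" where
  "area q f g = sqrt (gram_det (nsq q f) (nsq q g) (ip q f g))"

lemma ip_cong: "\<lbrakk>\<And>w. w < q \<Longrightarrow> f w = f' w; \<And>w. w < q \<Longrightarrow> g w = g' w\<rbrakk> \<Longrightarrow> ip q f g = ip q f' g'"
  by (simp add: ip_def)

lemma nsq_cong: "(\<And>w. w < q \<Longrightarrow> f w = f' w) \<Longrightarrow> nsq q f = nsq q f'"
  by (simp add: nsq_def)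

lemma area_cong:
  "\<lbrakk>\<And>w. w < q \<Longrightarrow> f w = f' w; \<And>w. w < q \<Longrightarrow> g w = g' w\<rbrakk> \<Longrightarrow> area q f g = area q f' g'"
  unfolding area_def using ip_cong[of q f f' g g'] nsq_cong[of q f f'] nsq_cong[of q g g'] by simp

lemma ip_cnj: "cnj (ip q f g) = ip q g f"
  by (simp add: ip_def mult.commute)

lemma ip_self: "ip q f f = of_real (nsq q f)"
  unfolding ip_def nsq_def of_real_sum complex_norm_square ..

lemma nsq_nonneg [simp]: "0 \<le> nsq q f"
  by (simp add: nsq_def sum_nonneg)

lemma nsq_eq_0D: "nsq q f = 0 \<Longrightarrow> w < q \<Longrightarrow> f w = 0"
  by (simp add: nsq_def sum_nonneg_eq_0_iff)

lemma ip_mix_left: "ip q (mix s t f g) k = s * ip q f k + t * ip q g k"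
  by (simp add: ip_def mix_def algebra_simps sum.distrib sum_distrib_left)

lemma ip_mix_right: "ip q k (mix s t f g) = cnj s * ip q k f + cnj t * ip q k g"
  by (simp add: ip_def mix_def algebra_simps sum.distrib sum_distrib_left)

lemma nsq_mix:
  "nsq q (mix s t f g) = (cmod s)\<^sup>2 * nsq q f + (cmod t)\<^sup>2 * nsq q g + 2 * Re (s * cnj t * ip q f g)"
proof -
  have "complex_of_real (nsq q (mix s t f g)) = ip q (mix s t f g) (mix s t f g)"
    by (simp add: ip_self)
  also have "\<dots> = s * cnj s * of_real (nsq q f) + t * cnj t * of_real (nsq q g)
      + (s * cnj t * ip q f g + cnj (s * cnj t * ip q f g))"
    unfolding ip_mix_left ip_mix_right by (simp add: ip_self ip_cnj algebra_simps)
  also have "\<dots> = of_real ((cmod s)\<^sup>2 * nsq q f + (cmod t)\<^sup>2 * nsq q g + 2 * Re (s * cnj t * ip q f g))"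
    unfolding complex_norm_square[symmetric] complex_add_cnj by simp
  finally show ?thesis by (simp only: of_real_eq_iff)
qed

lemma ip_cauchy_schwarz: "(cmod (ip q f g))\<^sup>2 \<le> nsq q f * nsq q g"
proof -
  have "cmod (ip q f g) \<le> (\<Sum>w<q. cmod (f w) * cmod (g w))"
    unfolding ip_def by (rule order_trans[OF norm_sum]) (simp add: norm_mult)
  then have "(cmod (ip q f g))\<^sup>2 \<le> (\<Sum>w<q. cmod (f w) * cmod (g w))\<^sup>2"
    by (simp add: power_mono)
  also have "\<dots> \<le> nsq q f * nsq q g"
    unfolding nsq_def by (rule Cauchy_Schwarz_ineq_sum)
  finally show ?thesis .
qed

lemma gram_det_nonneg: "0 \<le> gram_det (nsq q f) (nsq q g) (ip q f g)"
  using ip_cauchy_schwarz by (simp add: gram_det_def)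

lemma area_nonneg [simp]: "0 \<le> area q f g"
  by (simp add: area_def gram_det_nonneg)

lemma area_sq: "(area q f g)\<^sup>2 = gram_det (nsq q f) (nsq q g) (ip q f g)"
  by (simp add: area_def gram_det_nonneg)

section \<open>Unitaries on a qubit and Gram determinants\<close>

definition unit_pair :: "complex \<Rightarrow> complex \<Rightarrow> bool" where
  "unit_pair s t \<longleftrightarrow> (cmod s)\<^sup>2 + (cmod t)\<^sup>2 = 1"

text \<open>The arguments are the entries of the hermitian matrix conjugated by the unitary with
  rows \<open>s, t\<close> and \<open>- cnj t, cnj s\<close>. With \<open>m\<close>,
  \<open>n\<close>, \<open>z\<close> arbitrary it serves single Gram matrices as well as the reduced
  state of \<open>A\<close>, a sum of two.\<close>

lemma gram_det_unitary:
  assumes "unit_pair s t"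
  shows "gram_det ((cmod s)\<^sup>2 * m + (cmod t)\<^sup>2 * n + 2 * Re (s * cnj t * z))
     ((cmod t)\<^sup>2 * m + (cmod s)\<^sup>2 * n - 2 * Re (s * cnj t * z))
     (s\<^sup>2 * z - t\<^sup>2 * cnj z + s * t * of_real (n - m)) = gram_det m n z"
proof -
  have "gram_det ((cmod s)\<^sup>2 * m + (cmod t)\<^sup>2 * n + 2 * Re (s * cnj t * z))
     ((cmod t)\<^sup>2 * m + (cmod s)\<^sup>2 * n - 2 * Re (s * cnj t * z))
     (s\<^sup>2 * z - t\<^sup>2 * cnj z + s * t * of_real (n - m))
     = ((cmod s)\<^sup>2 + (cmod t)\<^sup>2)\<^sup>2 * gram_det m n z"
    unfolding gram_det_def cmod_power2 by (simp add: power2_eq_square algebra_simps)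
  then show ?thesis using assms by (simp add: unit_pair_def)
qed

lemma ip_mix_unitary:
  "ip q (mix s t f g) (mix (- cnj t) (cnj s) f g)
   = s\<^sup>2 * ip q f g - t\<^sup>2 * cnj (ip q f g) + s * t * of_real (nsq q g - nsq q f)"
  by (simp add: ip_mix_left ip_mix_right ip_self ip_cnj algebra_simps power2_eq_square)

lemma nsq_mix_snd:
  "nsq q (mix (- cnj t) (cnj s) f g)
   = (cmod t)\<^sup>2 * nsq q f + (cmod s)\<^sup>2 * nsq q g - 2 * Re (s * cnj t * ip q f g)"
  by (simp add: nsq_mix algebra_simps)

lemma area_unitary:
  "unit_pair s t \<Longrightarrow> area q (mix s t f g) (mix (- cnj t) (cnj s) f g) = area q f g"
  unfolding area_def ip_mix_unitary nsq_mix_snd unfolding nsq_mix by (simp only: gram_det_unitary)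

text \<open>With \<open>s = cos \<theta>\<close> and \<open>t = sin \<theta>\<close> times the phase of \<open>z\<close>, the expression is a phase
  times a real function of \<open>\<theta>\<close> that changes sign on \<open>[0, \<pi>/2]\<close>.\<close>

lemma exists_diagonalizing_unit_pair:
  fixes z :: complex and d :: real
  shows "\<exists>s t. unit_pair s t \<and> s\<^sup>2 * z - t\<^sup>2 * cnj z + s * t * of_real d = 0"
proof -
  define F where "F = (\<lambda>\<theta>::real. cmod z * ((cos \<theta>)\<^sup>2 - (sin \<theta>)\<^sup>2) + cos \<theta> * sin \<theta> * d)"
  have "\<exists>\<theta>\<ge>0. \<theta> \<le> pi / 2 \<and> F \<theta> = 0"
    by (rule IVT2') (auto simp: F_def intro!: continuous_intros)
  then obtain \<theta> where F: "F \<theta> = 0" by blast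
  define u where "u = cis (Arg z)"
  have z: "z = of_real (cmod z) * u" 
    unfolding u_def by (metis rcis_cmod_Arg rcis_def)
  have uu: "u * cnj u = 1" by (simp add: u_def cis_cnj cis_mult)
  have "(of_real (cos \<theta>))\<^sup>2 * z - (of_real (sin \<theta>) * u)\<^sup>2 * cnj z + of_real (cos \<theta>) * (of_real (sin \<theta>) * u) * of_real d
     = u * (of_real (cmod z) * ((of_real (cos \<theta>))\<^sup>2 - (of_real (sin \<theta>))\<^sup>2 * (u * cnj u)) + of_real (cos \<theta>) * of_real (sin \<theta>) * of_real d)"
    by (subst (1 2) z) (simp add: algebra_simps power2_eq_square)
  also have "\<dots> = u * of_real (F \<theta>)"
    unfolding uu F_def by simp
  finally have "(of_real (cos \<theta>))\<^sup>2 * z - (of_real (sin \<theta>) * u)\<^sup>2 * cnj z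
      + of_real (cos \<theta>) * (of_real (sin \<theta>) * u) * of_real d = 0" using F by simp
  moreover have "unit_pair (of_real (cos \<theta>)) (of_real (sin \<theta>) * u)"
    by (simp add: unit_pair_def norm_mult u_def)
  ultimately show ?thesis by blast
qed

text \<open>\<open>V x\<close> is the vector of \<open>C\<close> belonging to the basis state of \<open>A B\<close> with index
  \<open>x = 2 s + t\<close>; its Gram matrix is the reduced state of \<open>A B\<close>, of which \<open>xs\<close> is an
  unnormalised ensemble.\<close>

definition pair_bound :: "nat \<Rightarrow> (nat \<Rightarrow> nat \<Rightarrow> complex) \<Rightarrow> real \<Rightarrow> bool" where
  "pair_bound q V r \<longleftrightarrow> (\<exists>xs.
     (\<forall>x<4. \<forall>y<4. ip q (V x) (V y) = (\<Sum>k\<leftarrow>xs. k x * cnj (k y))) \<and>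
     (\<Sum>k\<leftarrow>xs. cmod (k 0 * k 3 - k 1 * k (2::nat))) \<le> r)"

lemma sum_list_sum_swap:
  "(\<Sum>k\<leftarrow>xs. \<Sum>i\<in>I. F k i) = (\<Sum>i\<in>I. \<Sum>k\<leftarrow>xs. (F k i :: 'a::comm_monoid_add))"
  by (induction xs) (auto simp: sum.distrib)

text \<open>Applying \<open>L\<close> to every vector of an ensemble for \<open>V'\<close> gives one
  for \<open>V\<close>. It is used for maps under which the determinant only changes by a factor:
  unitaries on \<open>A\<close> or \<open>B\<close> and product scalings.\<close>

lemma pair_bound_linear:
  assumes V: "\<And>x w. x < 4 \<Longrightarrow> w < q \<Longrightarrow> V x w = (\<Sum>i<4. L x i * V' i w)"
    and det: "\<And>k. cmod ((\<Sum>i<4. L 0 i * k i) * (\<Sum>i<4. L 3 i * k i) -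
        (\<Sum>i<4. L 1 i * k i) * (\<Sum>i<4. L 2 i * k i)) = s * cmod (k 0 * k 3 - k 1 * k (2::nat))"
    and s: "0 \<le> s" and V': "pair_bound q V' r"
  shows "pair_bound q V (s * r)"
proof -
  obtain xs where gram: "\<And>x y. x < 4 \<Longrightarrow> y < 4 \<Longrightarrow> ip q (V' x) (V' y) = (\<Sum>k\<leftarrow>xs. k x * cnj (k y))"
    and le: "(\<Sum>k\<leftarrow>xs. cmod (k 0 * k 3 - k 1 * k (2::nat))) \<le> r"
    using V' unfolding pair_bound_def by blast
  define T where "T = (\<lambda>(k :: nat \<Rightarrow> complex) x. \<Sum>i<4. L x i * k i)"
  have "ip q (V x) (V y) = (\<Sum>k\<leftarrow>map T xs. k x * cnj (k y))" if "x < 4" "y < 4" for x y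
  proof -
    have "ip q (V x) (V y) = (\<Sum>w<q. \<Sum>i<4. \<Sum>j<4. L x i * cnj (L y j) * (V' i w * cnj (V' j w)))"
      unfolding ip_def using that
      by (intro sum.cong refl) (simp add: V sum_product algebra_simps)
    also have "\<dots> = (\<Sum>i<4. \<Sum>j<4. L x i * cnj (L y j) * ip q (V' i) (V' j))"
      unfolding ip_def sum_distrib_left
      by (subst sum.swap) (intro sum.cong refl sum.swap)
    also have "\<dots> = (\<Sum>i<4. \<Sum>j<4. \<Sum>k\<leftarrow>xs. L x i * cnj (L y j) * (k i * cnj (k j)))"
      by (intro sum.cong refl) (simp add: gram sum_list_const_mult)
    also have "\<dots> = (\<Sum>k\<leftarrow>xs. \<Sum>i<4. \<Sum>j<4. L x i * cnj (L y j) * (k i * cnj (k j)))"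
      by (simp add: sum_list_sum_swap)
    also have "\<dots> = (\<Sum>k\<leftarrow>map T xs. k x * cnj (k y))"
      by (simp add: T_def comp_def sum_product algebra_simps)
    finally show ?thesis .
  qed
  moreover have "(\<Sum>k\<leftarrow>map T xs. cmod (k 0 * k 3 - k 1 * k (2::nat))) \<le> s * r"
    using mult_left_mono[OF le s] by (simp add: T_def comp_def det sum_list_const_mult del: One_nat_def)
  ultimately show ?thesis unfolding pair_bound_def by blast
qed

lemma sum_lessThan_4: "(\<Sum>i<4. f i) = f 0 + f 1 + f 2 + f (3::nat)"
  by (simp add: eval_nat_numeral)

lemma all_lessThan_4: "(\<forall>x<4. P x) \<longleftrightarrow> P 0 \<and> P 1 \<and> P 2 \<and> P (3::nat)"
  by (auto simp: less_Suc_eq eval_nat_numeral)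

section \<open>Ensembles of the pair with small total determinant\<close>

definition flip_fixed :: "(nat \<Rightarrow> complex) \<Rightarrow> bool" where
  "flip_fixed k \<longleftrightarrow> k 3 = cnj (k 0) \<and> k 2 = cnj (k 1)"

text \<open>For a flip-fixed \<open>k\<close> the determinant \<open>k 0 * k 3 - k 1 * k 2\<close>
  is real and equals this value at \<open>e = 1\<close>; \<open>e\<close> will be the sign of the
  total.\<close>

definition signed_det :: "real \<Rightarrow> (nat \<Rightarrow> complex) \<Rightarrow> real" where
  "signed_det e k = e * ((cmod (k 0))\<^sup>2 - (cmod (k 1))\<^sup>2)"

lemma signed_det_alt: "signed_det e k = e * Re (k 0 * cnj (k 0) - k 1 * cnj (k 1))"
  by (simp add: signed_det_def complex_norm_square[symmetric] del: of_real_power One_nat_def)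

text \<open>The signed determinant is linear in the rank-one matrix of \<open>k\<close>, so the
  total depends on the Gram matrix alone and survives every change of ensemble.\<close>

lemma sum_list_signed_det:
  "(\<Sum>k\<leftarrow>xs. signed_det e k) = e * Re ((\<Sum>k\<leftarrow>xs. k 0 * cnj (k 0)) - (\<Sum>k\<leftarrow>xs. k 1 * cnj (k 1)))"
  by (induction xs) (simp_all add: signed_det_alt algebra_simps del: One_nat_def)

text \<open>A real rotation of the pair keeps the sum of the rank-one matrices and, its coefficients
  being real, the flip symmetry. Between the angles 0 and \<open>pi / 2\<close> the first vector
  runs from \<open>a\<close> to \<open>b\<close>, so its determinant vanishes on the way.\<close>

lemma rotate_to_null:
  assumes a: "flip_fixed a" "0 \<le> signed_det e a" and b: "flip_fixed b" "signed_det e b \<le> 0"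
  shows "\<exists>c d. flip_fixed c \<and> flip_fixed d \<and> signed_det e c = 0 \<and>
    (\<forall>x y. c x * cnj (c y) + d x * cnj (d y) = a x * cnj (a y) + b x * cnj (b y))"
proof -
  define R where "R = (\<lambda>\<theta>::real. (\<lambda>x. of_real (cos \<theta>) * a x + of_real (sin \<theta>) * b x))"
  have "\<exists>\<theta>\<ge>0. \<theta> \<le> pi / 2 \<and> signed_det e (R \<theta>) = 0"
    by (rule IVT2') (use a b in \<open>auto simp: R_def signed_det_def intro!: continuous_intros\<close>)
  then obtain \<theta> where null: "signed_det e (R \<theta>) = 0" by blast
  define d where "d = (\<lambda>x. - of_real (sin \<theta>) * a x + of_real (cos \<theta>) * b x)"
  have cs: "(of_real (cos \<theta>) :: complex) * of_real (cos \<theta>) + of_real (sin \<theta>) * of_real (sin \<theta>) = 1"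
    unfolding of_real_mult[symmetric] of_real_add[symmetric]
    by (metis of_real_1 power2_eq_square sin_cos_squared_add2)
  have "R \<theta> x * cnj (R \<theta> y) + d x * cnj (d y) = a x * cnj (a y) + b x * cnj (b y)" for x y
  proof -
    have "R \<theta> x * cnj (R \<theta> y) + d x * cnj (d y)
      = (of_real (cos \<theta>) * of_real (cos \<theta>) + of_real (sin \<theta>) * of_real (sin \<theta>))
        * (a x * cnj (a y) + b x * cnj (b y))"
      by (simp add: R_def d_def algebra_simps)
    then show ?thesis by (simp only: cs mult_1)
  qed
  moreover have "flip_fixed (R \<theta>)" "flip_fixed d"
    using a b by (auto simp: flip_fixed_def R_def d_def)
  ultimately show ?thesis using null by blast
qed

text \<open>Each round rotates a vector of nonnegative and one of negative determinant until one of
  them is null. The null vector is set aside, the list shrinks by one and the total is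
  unchanged.\<close>

lemma exists_nonneg_signed_det:
  assumes "\<forall>k\<in>set xs. flip_fixed k" "0 \<le> (\<Sum>k\<leftarrow>xs. signed_det e k)"
  shows "\<exists>ys. (\<forall>k\<in>set ys. flip_fixed k \<and> 0 \<le> signed_det e k) \<and>
    (\<forall>x y. (\<Sum>k\<leftarrow>ys. k x * cnj (k y)) = (\<Sum>k\<leftarrow>xs. k x * cnj (k y)))"
  using assms
proof (induction "length xs" arbitrary: xs rule: less_induct)
  case less
  show ?case
  proof (cases "\<forall>k\<in>set xs. 0 \<le> signed_det e k")
    case True
    then show ?thesis using less.prems by blast
  next
    case False
    then obtain b where b: "b \<in> set xs" "signed_det e b < 0" by force
    have "\<exists>a\<in>set xs. 0 \<le> signed_det e a"
    proof (rule ccontr)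
      assume *: "\<not> ?thesis"
      have "(\<Sum>k\<leftarrow>xs. signed_det e k) < (\<Sum>k\<leftarrow>xs. 0)"
        by (rule sum_list_strict_mono) (use * b in \<open>auto simp: not_le\<close>)
      then show False using less.prems(2) by simp
    qed
    then obtain a where a: "a \<in> set xs" "0 \<le> signed_det e a" by blast
    \<comment> \<open>\<open>a\<close> and \<open>b\<close> differ because their signed determinants
      do.\<close>
    have ab: "b \<in> set (remove1 a xs)" using a b by (metis in_set_remove1 leD)
    define rest where "rest = remove1 b (remove1 a xs)"
    have split: "(\<Sum>k\<leftarrow>xs. f k) = f a + f b + (\<Sum>k\<leftarrow>rest. f k)" for f :: "(nat \<Rightarrow> complex) \<Rightarrow> complex"
      using sum_list_map_remove1[OF a(1), of f] sum_list_map_remove1[OF ab, of f]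
      by (simp add: rest_def add.assoc)
    obtain c d where cd: "flip_fixed c" "flip_fixed d" "signed_det e c = 0"
      "\<And>x y. c x * cnj (c y) + d x * cnj (d y) = a x * cnj (a y) + b x * cnj (b y)"
      using rotate_to_null[of a e b] a b less.prems(1) by (metis less_imp_le)
    have gram: "(\<Sum>k\<leftarrow>c # d # rest. k x * cnj (k y)) = (\<Sum>k\<leftarrow>xs. k x * cnj (k y))" for x y
      unfolding split using cd(4)[of x y] by (simp add: add.assoc[symmetric])
    have "(\<Sum>k\<leftarrow>d # rest. signed_det e k) = (\<Sum>k\<leftarrow>c # d # rest. signed_det e k)"
      using cd(3) by simp
    also have "\<dots> = (\<Sum>k\<leftarrow>xs. signed_det e k)"
      unfolding sum_list_signed_det gram ..
    finally have nn: "0 \<le> (\<Sum>k\<leftarrow>d # rest. signed_det e k)" using less.prems(2) by simp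
    have len: "length (d # rest) < length xs"
      using a(1) ab length_pos_if_in_set[OF a(1)] length_pos_if_in_set[OF ab]
      by (simp add: rest_def length_remove1)
    have "\<forall>k\<in>set (d # rest). flip_fixed k"
      using cd(2) less.prems(1) set_remove1_subset[of b "remove1 a xs"] set_remove1_subset[of a xs]
      by (auto simp: rest_def)
    from less.hyps[OF len this nn] obtain ys where
      ys: "\<forall>k\<in>set ys. flip_fixed k \<and> 0 \<le> signed_det e k"
        "\<And>x y. (\<Sum>k\<leftarrow>ys. k x * cnj (k y)) = (\<Sum>k\<leftarrow>d # rest. k x * cnj (k y))" by blast
    have "(\<Sum>k\<leftarrow>c # ys. k x * cnj (k y)) = (\<Sum>k\<leftarrow>xs. k x * cnj (k y))" for x y
      unfolding gram[symmetric] by (simp add: ys(2))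
    moreover have "\<forall>k\<in>set (c # ys). flip_fixed k \<and> 0 \<le> signed_det e k"
      using ys(1) cd by simp
    ultimately show ?thesis by blast
  qed
qed

lemma sum_list_upt: "(\<Sum>w\<leftarrow>[0..<q]. f w) = (\<Sum>w<q. (f w :: 'a::comm_monoid_add))"
  by (induction q) (simp_all add: add.commute)

text \<open>Once all determinants have the same sign, the sum of their absolute values is the
  absolute value of their total, which the Gram matrix fixes.\<close>

lemma pair_bound_flip_invariant:
  assumes n03: "nsq q (V 0) = nsq q (V 3)" and n12: "nsq q (V 1) = nsq q (V 2)"
    and i01: "ip q (V 0) (V 1) = ip q (V 2) (V 3)" and i02: "ip q (V 0) (V 2) = ip q (V 1) (V 3)"
  shows "pair_bound q V \<bar>nsq q (V 0) - nsq q (V 1)\<bar>"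
proof -
  define e :: real where "e = (if nsq q (V 0) \<ge> nsq q (V 1) then 1 else -1)"
  \<comment> \<open>Each column of \<open>V\<close> is split into two flip-fixed vectors, as a
    complex number into real and imaginary part. Their rank-one matrices add up to the average of
    the Gram matrix and its flipped copy, hence to the Gram matrix itself.\<close>
  define xs where "xs = map (\<lambda>w x. (V x w + cnj (V (3 - x) w)) / 2) [0..<q] @
      map (\<lambda>w x. (V x w - cnj (V (3 - x) w)) / (2 * \<i>)) [0..<q]"
  have fixed: "\<forall>k\<in>set xs. flip_fixed k"
    by (auto simp: xs_def flip_fixed_def field_simps)
  have half: "(\<Sum>k\<leftarrow>xs. k x * cnj (k y)) = (ip q (V x) (V y) + ip q (V (3 - y)) (V (3 - x))) / 2" for x y
  proof -
    have "(\<Sum>k\<leftarrow>xs. k x * cnj (k y)) = (\<Sum>w<q. (V x w + cnj (V (3 - x) w)) / 2 * cnj ((V y w + cnj (V (3 - y) w)) / 2)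
       + (V x w - cnj (V (3 - x) w)) / (2 * \<i>) * cnj ((V y w - cnj (V (3 - y) w)) / (2 * \<i>)))"
      by (simp add: xs_def comp_def sum_list_upt sum.distrib sum_subtractf sum_negf)
    also have "\<dots> = (\<Sum>w<q. (V x w * cnj (V y w) + V (3 - y) w * cnj (V (3 - x) w)) / 2)"
      by (intro sum.cong refl) (simp add: field_simps)
    finally show ?thesis by (simp only: ip_def sum.distrib sum_divide_distrib[symmetric])
  qed
  have i10: "ip q (V 1) (V 0) = ip q (V 3) (V 2)" and i20: "ip q (V 2) (V 0) = ip q (V 3) (V 1)"
    using i01 i02 by (metis ip_cnj)+
  have sym: "\<forall>x<4. \<forall>y<4. ip q (V (3 - y)) (V (3 - x)) = ip q (V x) (V y)"
    unfolding all_lessThan_4 using i01 i02 i10 i20 n03 n12 by (simp add: ip_self)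
  have gram: "(\<Sum>k\<leftarrow>xs. k x * cnj (k y)) = ip q (V x) (V y)" if "x < 4" "y < 4" for x y
    using that sym by (simp add: half)
  have total: "(\<Sum>k\<leftarrow>xs. signed_det e k) = \<bar>nsq q (V 0) - nsq q (V 1)\<bar>"
    unfolding sum_list_signed_det by (simp add: gram ip_self e_def del: One_nat_def)
  obtain ys where ys: "\<forall>k\<in>set ys. flip_fixed k \<and> 0 \<le> signed_det e k"
    "\<And>x y. (\<Sum>k\<leftarrow>ys. k x * cnj (k y)) = (\<Sum>k\<leftarrow>xs. k x * cnj (k y))"
    using exists_nonneg_signed_det[OF fixed, of e] total by auto
  have abs: "cmod (k 0 * k 3 - k 1 * k 2) = signed_det e k" if "k \<in> set ys" for k
  proof -
    have k: "flip_fixed k" "0 \<le> signed_det e k" using ys(1) that by auto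
    have "k 0 * k 3 - k 1 * k 2 = of_real ((cmod (k 0))\<^sup>2 - (cmod (k 1))\<^sup>2)"
      using k(1) unfolding flip_fixed_def of_real_diff complex_norm_square by simp
    then have "cmod (k 0 * k 3 - k 1 * k 2) = \<bar>(cmod (k 0))\<^sup>2 - (cmod (k 1))\<^sup>2\<bar>"
      by (metis norm_of_real)
    also have "\<dots> = signed_det e k" using k(2)
      by (auto simp: signed_det_def e_def split: if_splits)
    finally show ?thesis .
  qed
  have "(\<Sum>k\<leftarrow>ys. cmod (k 0 * k 3 - k 1 * k 2)) = (\<Sum>k\<leftarrow>ys. signed_det e k)"
    using abs by (intro arg_cong[of _ _ sum_list] map_cong) auto
  also have "\<dots> = (\<Sum>k\<leftarrow>xs. signed_det e k)"
    unfolding sum_list_signed_det ys(2) ..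
  finally have "(\<Sum>k\<leftarrow>ys. cmod (k 0 * k 3 - k 1 * k 2)) \<le> \<bar>nsq q (V 0) - nsq q (V 1)\<bar>"
    using total by simp
  moreover have "\<forall>x<4. \<forall>y<4. ip q (V x) (V y) = (\<Sum>k\<leftarrow>ys. k x * cnj (k y))"
    by (simp add: ys(2) gram)
  ultimately show ?thesis unfolding pair_bound_def by blast
qed

lemma ip_scale: "ip q (\<lambda>w. of_real c * f w) (\<lambda>w. of_real d * g w) = of_real (c * d) * ip q f g"
  by (simp add: ip_def sum_distrib_left algebra_simps)

lemma nsq_scale: "nsq q (\<lambda>w. of_real c * f w) = c\<^sup>2 * nsq q f"
  by (simp add: nsq_def sum_distrib_left norm_mult power_mult_distrib)

text \<open>The scaling of the four vectors makes their Gram matrix invariant under the antilinear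
  flip \<open>V 0 \<leftrightarrow> V 3\<close>, \<open>V 1 \<leftrightarrow> V 2\<close> and changes the determinant by a constant factor.\<close>

lemma pair_bound_balanced:
  assumes pos: "0 < x" "0 < y" "0 < y1" "0 < y2"
    and i02: "of_real x * ip q (V 0) (V 2) = of_real y * ip q (V 1) (V 3)"
    and i01: "of_real y2 * ip q (V 0) (V 1) = of_real y1 * ip q (V 2) (V 3)"
    and n03: "y2 * x * nsq q (V 0) = y1 * y * nsq q (V 3)"
    and n12: "x * y1 * nsq q (V 2) = y * y2 * nsq q (V 1)"
  shows "pair_bound q V (y2 * \<bar>x * nsq q (V 0) - y * nsq q (V 1)\<bar> / sqrt (x * y * y1 * y2))"
proof -
  define a where "a = sqrt x" define b where "b = sqrt y"
  define c where "c = sqrt y1" define d where "d = sqrt y2"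
  have p: "a > 0" "b > 0" "c > 0" "d > 0" using pos by (auto simp: a_def b_def c_def d_def)
  have sq: "x = a\<^sup>2" "y = b\<^sup>2" "y1 = c\<^sup>2" "y2 = d\<^sup>2" using pos by (auto simp: a_def b_def c_def d_def)
  \<comment> \<open>A product of diagonal maps, \<open>d, c\<close> on \<open>A\<close> and
    \<open>a, b\<close> on \<open>B\<close>. Hence
    \<open>S ! 0 * S ! 3 = S ! 1 * S ! 2 = a * b * c * d\<close>, the factor of the
    determinant.\<close>
  define S where "S = [d * a, b * d, a * c, c * b]"
  define W where "W = (\<lambda>i w. of_real (S ! i) * V i w)"
  define L where "L = (\<lambda>i j. if i = j then of_real (1 / S ! i) else (0::complex))"
  have S: "S ! 0 = d * a" "S ! 1 = b * d" "S ! 2 = a * c" "S ! 3 = c * b"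
    by (simp_all add: S_def eval_nat_numeral)
  have "pair_bound q W \<bar>nsq q (W 0) - nsq q (W 1)\<bar>"
  proof (rule pair_bound_flip_invariant)
    show "nsq q (W 0) = nsq q (W 3)" "nsq q (W 1) = nsq q (W 2)"
      using n03 n12 unfolding W_def nsq_scale S sq power_mult_distrib by (simp_all add: mult_ac)
    have "of_real d * of_real d * ip q (V 0) (V 1) = of_real c * of_real c * ip q (V 2) (V 3)"
      using i01 by (simp add: sq power2_eq_square)
    moreover have "ip q (W 0) (W 1) = of_real (a * b) * (of_real d * of_real d * ip q (V 0) (V 1))"
      "ip q (W 2) (W 3) = of_real (a * b) * (of_real c * of_real c * ip q (V 2) (V 3))"
      by (simp_all only: W_def ip_scale S) (simp_all add: algebra_simps)
    ultimately show "ip q (W 0) (W 1) = ip q (W 2) (W 3)" by simp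
    have "of_real a * of_real a * ip q (V 0) (V 2) = of_real b * of_real b * ip q (V 1) (V 3)"
      using i02 by (simp add: sq power2_eq_square)
    moreover have "ip q (W 0) (W 2) = of_real (d * c) * (of_real a * of_real a * ip q (V 0) (V 2))"
      "ip q (W 1) (W 3) = of_real (d * c) * (of_real b * of_real b * ip q (V 1) (V 3))"
      by (simp_all only: W_def ip_scale S) (simp_all add: algebra_simps)
    ultimately show "ip q (W 0) (W 2) = ip q (W 1) (W 3)" by simp
  qed
  moreover have "nsq q (W 0) - nsq q (W 1) = y2 * (x * nsq q (V 0) - y * nsq q (V 1))"
    by (simp only: W_def nsq_scale S sq) (simp add: algebra_simps power_mult_distrib)
  ultimately have W: "pair_bound q W (y2 * \<bar>x * nsq q (V 0) - y * nsq q (V 1)\<bar>)"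
    using pos by (simp add: abs_mult)
  have "pair_bound q V (1 / (a * b * c * d) * (y2 * \<bar>x * nsq q (V 0) - y * nsq q (V 1)\<bar>))"
  proof (rule pair_bound_linear[OF _ _ _ W, where L = L])
    have "S ! i \<noteq> 0" if "i < 4" for i
      using that S p by (auto simp: eval_nat_numeral less_Suc_eq)
    then show "V i w = (\<Sum>j<4. L i j * W j w)" if "i < 4" "w < q" for i w
      using that by (simp add: L_def W_def if_distrib[of "\<lambda>z. z * _"] cong: if_cong)
    fix k :: "nat \<Rightarrow> complex"
    have "(\<Sum>i<4. L 0 i * k i) * (\<Sum>i<4. L 3 i * k i) - (\<Sum>i<4. L 1 i * k i) * (\<Sum>i<4. L 2 i * k i)
      = of_real (1 / (a * b * c * d)) * (k 0 * k 3 - k 1 * k 2)"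
      by (simp add: sum_lessThan_4 L_def S diff_divide_distrib del: One_nat_def) (simp add: mult_ac diff_divide_distrib)
    then show "cmod ((\<Sum>i<4. L 0 i * k i) * (\<Sum>i<4. L 3 i * k i) - (\<Sum>i<4. L 1 i * k i) * (\<Sum>i<4. L 2 i * k i))
      = 1 / (a * b * c * d) * cmod (k 0 * k 3 - k 1 * k 2)"
      using p by (simp only: norm_mult norm_of_real) simp
  qed (use p in simp)
  moreover have "sqrt (x * y * y1 * y2) = a * b * c * d"
    by (simp add: real_sqrt_mult a_def b_def c_def d_def)
  ultimately show ?thesis by (simp add: mult.commute)
qed

section \<open>Local unitaries on the two qubits\<close>

definition mix_A :: "complex \<Rightarrow> complex \<Rightarrow> (nat \<Rightarrow> nat \<Rightarrow> complex) \<Rightarrow> nat \<Rightarrow> nat \<Rightarrow> complex" where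
  "mix_A s t V = (\<lambda>x. [mix s t (V 0) (V 2), mix s t (V 1) (V 3),
     mix (- cnj t) (cnj s) (V 0) (V 2), mix (- cnj t) (cnj s) (V 1) (V 3)] ! x)"

definition mix_B :: "complex \<Rightarrow> complex \<Rightarrow> (nat \<Rightarrow> nat \<Rightarrow> complex) \<Rightarrow> nat \<Rightarrow> nat \<Rightarrow> complex" where
  "mix_B s t V = (\<lambda>x. [mix s t (V 0) (V 1), mix (- cnj t) (cnj s) (V 0) (V 1),
     mix s t (V 2) (V 3), mix (- cnj t) (cnj s) (V 2) (V 3)] ! x)"

lemma mix_A_simps:
  "mix_A s t V 0 = mix s t (V 0) (V 2)" "mix_A s t V 1 = mix s t (V 1) (V 3)"
  "mix_A s t V 2 = mix (- cnj t) (cnj s) (V 0) (V 2)" "mix_A s t V 3 = mix (- cnj t) (cnj s) (V 1) (V 3)"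
  by (simp_all add: mix_A_def eval_nat_numeral)

lemma mix_B_simps:
  "mix_B s t V 0 = mix s t (V 0) (V 1)" "mix_B s t V 1 = mix (- cnj t) (cnj s) (V 0) (V 1)"
  "mix_B s t V 2 = mix s t (V 2) (V 3)" "mix_B s t V 3 = mix (- cnj t) (cnj s) (V 2) (V 3)"
  by (simp_all add: mix_B_def eval_nat_numeral)

lemma unit_pair_cnj: "unit_pair s t \<Longrightarrow> s * cnj s + t * cnj t = 1"
  unfolding unit_pair_def complex_norm_square[symmetric] of_real_add[symmetric] by simp

lemma mix_inverse:
  assumes "unit_pair s t"
  shows "f w = cnj s * mix s t f g w - t * mix (- cnj t) (cnj s) f g w"
    "g w = cnj t * mix s t f g w + s * mix (- cnj t) (cnj s) f g w"
proof -
  have "f w = (s * cnj s + t * cnj t) * f w" "g w = (s * cnj s + t * cnj t) * g w"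
    using unit_pair_cnj[OF assms] by simp_all
  then show "f w = cnj s * mix s t f g w - t * mix (- cnj t) (cnj s) f g w"
    "g w = cnj t * mix s t f g w + s * mix (- cnj t) (cnj s) f g w"
    by (simp_all add: mix_def algebra_simps)
qed

text \<open>\<open>k 0 * k 3 - k 1 * k 2\<close> is the determinant of \<open>k\<close> as a 2 by 2
  matrix with rows indexed by \<open>A\<close>. A unitary on \<open>A\<close> acts on this matrix
  from the left, one on \<open>B\<close> from the right, both with determinant 1; \<open>L\<close>
  is the inverse unitary.\<close>

lemma pair_bound_mix_A:
  assumes st: "unit_pair s t" and W: "pair_bound q (mix_A s t V) r"
  shows "pair_bound q V r"
proof -
  define L where "L = (\<lambda>x y. [[cnj s, 0, - t, 0], [0, cnj s, 0, - t], [cnj t, 0, s, 0], [0, cnj t, 0, s]] ! x ! y)"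
  have "pair_bound q V (1 * r)"
  proof (rule pair_bound_linear[where L = L and V' = "mix_A s t V"])
    have "\<forall>x<4. V x w = (\<Sum>i<4. L x i * mix_A s t V i w)" for w
      unfolding all_lessThan_4 sum_lessThan_4 mix_A_simps
      using mix_inverse[OF st, where f = "V 0" and g = "V 2" and w = w]
        mix_inverse[OF st, where f = "V 1" and g = "V 3" and w = w]
      by (simp add: L_def eval_nat_numeral)
    then show "V x w = (\<Sum>i<4. L x i * mix_A s t V i w)" if "x < 4" for x w using that by blast
    fix k :: "nat \<Rightarrow> complex"
    have "(\<Sum>i<4. L 0 i * k i) * (\<Sum>i<4. L 3 i * k i) - (\<Sum>i<4. L 1 i * k i) * (\<Sum>i<4. L 2 i * k i)
      = (s * cnj s + t * cnj t) * (k 0 * k 3 - k 1 * k 2)"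
      unfolding sum_lessThan_4 by (simp add: L_def eval_nat_numeral) (simp add: algebra_simps)
    then show "cmod ((\<Sum>i<4. L 0 i * k i) * (\<Sum>i<4. L 3 i * k i) - (\<Sum>i<4. L 1 i * k i) * (\<Sum>i<4. L 2 i * k i))
      = 1 * cmod (k 0 * k 3 - k 1 * k 2)" by (simp only: unit_pair_cnj[OF st] mult_1)
  qed (use W in auto)
  then show ?thesis by simp
qed

lemma pair_bound_mix_B:
  assumes st: "unit_pair s t" and W: "pair_bound q (mix_B s t V) r"
  shows "pair_bound q V r"
proof -
  define L where "L = (\<lambda>x y. [[cnj s, - t, 0, 0], [cnj t, s, 0, 0], [0, 0, cnj s, - t], [0, 0, cnj t, s]] ! x ! y)"
  have "pair_bound q V (1 * r)"
  proof (rule pair_bound_linear[where L = L and V' = "mix_B s t V"])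
    have "\<forall>x<4. V x w = (\<Sum>i<4. L x i * mix_B s t V i w)" for w
      unfolding all_lessThan_4 sum_lessThan_4 mix_B_simps
      using mix_inverse[OF st, where f = "V 0" and g = "V 1" and w = w]
        mix_inverse[OF st, where f = "V 2" and g = "V 3" and w = w]
      by (simp add: L_def eval_nat_numeral)
    then show "V x w = (\<Sum>i<4. L x i * mix_B s t V i w)" if "x < 4" for x w using that by blast
    fix k :: "nat \<Rightarrow> complex"
    have "(\<Sum>i<4. L 0 i * k i) * (\<Sum>i<4. L 3 i * k i) - (\<Sum>i<4. L 1 i * k i) * (\<Sum>i<4. L 2 i * k i)
      = (s * cnj s + t * cnj t) * (k 0 * k 3 - k 1 * k 2)"
      unfolding sum_lessThan_4 by (simp add: L_def eval_nat_numeral) (simp add: algebra_simps)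
    then show "cmod ((\<Sum>i<4. L 0 i * k i) * (\<Sum>i<4. L 3 i * k i) - (\<Sum>i<4. L 1 i * k i) * (\<Sum>i<4. L 2 i * k i))
      = 1 * cmod (k 0 * k 3 - k 1 * k 2)" by (simp only: unit_pair_cnj[OF st] mult_1)
  qed (use W in auto)
  then show ?thesis by simp
qed

section \<open>Measurement of B and the reduced state of A\<close>

definition area_B :: "nat \<Rightarrow> (nat \<Rightarrow> nat \<Rightarrow> complex) \<Rightarrow> real" where
  "area_B q V = area q (V 0) (V 2) + area q (V 1) (V 3)"

text \<open>The determinant of the reduced state of \<open>A\<close>, for a unit vector a quarter of
  the squared negativity of \<open>A\<close> against \<open>B C\<close>. Likewise
  \<open>area_B\<close> is half the mean negativity of \<open>A C\<close> after measuring
  \<open>B\<close> in the standard basis.\<close>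

definition det_A :: "nat \<Rightarrow> (nat \<Rightarrow> nat \<Rightarrow> complex) \<Rightarrow> real" where
  "det_A q V = gram_det (nsq q (V 0) + nsq q (V 1)) (nsq q (V 2) + nsq q (V 3)) (ip q (V 0) (V 2) + ip q (V 1) (V 3))"

text \<open>Areas scale with the squared length of \<open>s, t\<close>, so minimality can be stated
  for pairs of any length, and the variations \<open>1, t * e\<close> need no normalisation.\<close>

definition B_minimal :: "nat \<Rightarrow> (nat \<Rightarrow> nat \<Rightarrow> complex) \<Rightarrow> bool" where
  "B_minimal q V \<longleftrightarrow> (\<forall>s t. ((cmod s)\<^sup>2 + (cmod t)\<^sup>2) * area_B q V \<le> area_B q (mix_B s t V))"

lemma area_B_nonneg [simp]: "0 \<le> area_B q V"
  by (simp add: area_B_def)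

lemma area_B_mix_A:
  assumes "unit_pair s t"
  shows "area q (mix_A s t V 0) (mix_A s t V 2) = area q (V 0) (V 2)"
    "area q (mix_A s t V 1) (mix_A s t V 3) = area q (V 1) (V 3)"
  unfolding mix_A_simps by (simp_all only: area_unitary[OF assms])

lemma mix_comm: "mix a b (mix s t f g) (mix s t h k) = mix s t (mix a b f h) (mix a b g k)"
  by (simp add: mix_def fun_eq_iff algebra_simps)

text \<open>Unitaries on \<open>A\<close> and on \<open>B\<close> commute, and the former preserve
  areas. A minimal basis of \<open>B\<close> thus stays minimal when a basis of \<open>A\<close> is
  chosen afterwards.\<close>

lemma area_B_mix_B_mix_A:
  assumes "unit_pair s t"
  shows "area_B q (mix_B a b (mix_A s t V)) = area_B q (mix_B a b V)"
  unfolding area_B_def mix_B_simps mix_A_simps mix_comm[of a b s t] mix_comm[of a b "- cnj t" "cnj s"]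
    mix_comm[of "- cnj b" "cnj a" s t] mix_comm[of "- cnj b" "cnj a" "- cnj t" "cnj s"]
  by (simp only: area_unitary[OF assms])

lemma B_minimal_mix_A:
  assumes "unit_pair s t" "B_minimal q V"
  shows "B_minimal q (mix_A s t V)"
  using assms(2) area_B_mix_A[OF assms(1), of q V]
  by (simp add: B_minimal_def area_B_mix_B_mix_A[OF assms(1)] area_B_def[of q "mix_A s t V"] area_B_def[of q V])

lemma det_A_mix_A:
  assumes st: "unit_pair s t"
  shows "det_A q (mix_A s t V) = det_A q V"
proof -
  have "det_A q (mix_A s t V) = gram_det
     ((cmod s)\<^sup>2 * (nsq q (V 0) + nsq q (V 1)) + (cmod t)\<^sup>2 * (nsq q (V 2) + nsq q (V 3))
        + 2 * Re (s * cnj t * (ip q (V 0) (V 2) + ip q (V 1) (V 3))))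
     ((cmod t)\<^sup>2 * (nsq q (V 0) + nsq q (V 1)) + (cmod s)\<^sup>2 * (nsq q (V 2) + nsq q (V 3))
        - 2 * Re (s * cnj t * (ip q (V 0) (V 2) + ip q (V 1) (V 3))))
     (s\<^sup>2 * (ip q (V 0) (V 2) + ip q (V 1) (V 3)) - t\<^sup>2 * cnj (ip q (V 0) (V 2) + ip q (V 1) (V 3))
        + s * t * of_real (nsq q (V 2) + nsq q (V 3) - (nsq q (V 0) + nsq q (V 1))))"
    unfolding det_A_def mix_A_simps ip_mix_unitary nsq_mix_snd unfolding nsq_mix
    by (rule arg_cong3[of _ _ _ _ _ _ gram_det]) (simp_all add: algebra_simps)
  then show ?thesis unfolding gram_det_unitary[OF st] det_A_def .
qed

lemma det_A_mix_B:
  assumes st: "unit_pair s t"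
  shows "det_A q (mix_B s t V) = det_A q V"
proof -
  have "nsq q (mix s t f g) + nsq q (mix (- cnj t) (cnj s) f g) = nsq q f + nsq q g" for f g
  proof -
    have "nsq q (mix s t f g) + nsq q (mix (- cnj t) (cnj s) f g) = ((cmod s)\<^sup>2 + (cmod t)\<^sup>2) * (nsq q f + nsq q g)"
      unfolding nsq_mix_snd unfolding nsq_mix by (simp add: algebra_simps)
    then show ?thesis using st by (simp add: unit_pair_def)
  qed
  moreover have "ip q (mix s t f g) (mix s t h k) + ip q (mix (- cnj t) (cnj s) f g) (mix (- cnj t) (cnj s) h k)
     = ip q f h + ip q g k" for f g h k
  proof -
    have "ip q (mix s t f g) (mix s t h k) + ip q (mix (- cnj t) (cnj s) f g) (mix (- cnj t) (cnj s) h k)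
     = (s * cnj s + t * cnj t) * (ip q f h + ip q g k)"
      by (simp add: ip_mix_left ip_mix_right algebra_simps)
    then show ?thesis by (simp add: unit_pair_cnj[OF st])
  qed
  ultimately show ?thesis unfolding det_A_def mix_B_simps by simp
qed

text \<open>This is what measuring \<open>B\<close> leaves over for \<open>A B\<close>. The terms
  belonging to a single outcome cancel and only those mixing the two outcomes remain.\<close>

lemma det_A_area_B:
  "det_A q V - (area_B q V)\<^sup>2 = nsq q (V 0) * nsq q (V 3) + nsq q (V 1) * nsq q (V 2)
     - 2 * Re (ip q (V 0) (V 2) * cnj (ip q (V 1) (V 3))) - 2 * area q (V 0) (V 2) * area q (V 1) (V 3)"
proof -
  have "(area_B q V)\<^sup>2 = (area q (V 0) (V 2))\<^sup>2 + (area q (V 1) (V 3))\<^sup>2 + 2 * area q (V 0) (V 2) * area q (V 1) (V 3)"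
    by (simp add: area_B_def power2_sum)
  then show ?thesis
    unfolding det_A_def area_sq gram_det_def cmod_power2 by (simp add: power2_eq_square algebra_simps)
qed

section \<open>The case of a vanishing area\<close>

lemma pair_bound_degenerate:
  assumes z: "nsq q (V 0) * nsq q (V 3) * (nsq q (V 1) * nsq q (V 2)) = 0"
  shows "pair_bound q V (sqrt (nsq q (V 0) * nsq q (V 3) + nsq q (V 1) * nsq q (V 2)))"
proof -
  \<comment> \<open>The ensemble from measuring \<open>C\<close> in the standard basis. The triangle
    and Cauchy-Schwarz inequalities bound its total by a sum of two roots, which is the root of the
    sum because one radicand is 0.\<close>
  define xs where "xs = map (\<lambda>w x. V x w) [0..<q]"
  have cs: "(\<Sum>w<q. cmod (f w) * cmod (g w)) \<le> sqrt (nsq q f * nsq q g)" for f g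
  proof -
    have "(\<Sum>w<q. cmod (f w) * cmod (g w))\<^sup>2 \<le> nsq q f * nsq q g"
      unfolding nsq_def by (rule Cauchy_Schwarz_ineq_sum)
    then show ?thesis by (rule real_le_rsqrt)
  qed
  have "(\<Sum>k\<leftarrow>xs. cmod (k 0 * k 3 - k 1 * k 2)) = (\<Sum>w<q. cmod (V 0 w * V 3 w - V 1 w * V 2 w))"
    by (simp add: xs_def comp_def sum_list_upt)
  also have "\<dots> \<le> (\<Sum>w<q. cmod (V 0 w) * cmod (V 3 w) + cmod (V 1 w) * cmod (V 2 w))"
    by (intro sum_mono) (metis norm_mult norm_triangle_ineq4)
  also have "\<dots> \<le> sqrt (nsq q (V 0) * nsq q (V 3)) + sqrt (nsq q (V 1) * nsq q (V 2))"
    unfolding sum.distrib by (intro add_mono cs)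
  also have "\<dots> = sqrt (nsq q (V 0) * nsq q (V 3) + nsq q (V 1) * nsq q (V 2))"
    using z by auto
  finally have "(\<Sum>k\<leftarrow>xs. cmod (k 0 * k 3 - k 1 * k 2)) \<le> sqrt (nsq q (V 0) * nsq q (V 3) + nsq q (V 1) * nsq q (V 2))" .
  moreover have "ip q (V x) (V y) = (\<Sum>k\<leftarrow>xs. k x * cnj (k y))" for x y
    by (simp add: xs_def comp_def sum_list_upt ip_def)
  ultimately show ?thesis unfolding pair_bound_def by blast
qed

text \<open>Two vectors that span no area are linearly dependent, so a unitary on \<open>A\<close>
  that makes them orthogonal makes one of them zero. The mixed terms with inner products and areas
  then vanish from \<open>det_A_area_B\<close>.\<close>

lemma pair_bound_area_zero:
  assumes "area q (V 0) (V 2) = 0 \<or> area q (V 1) (V 3) = 0"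
  shows "pair_bound q V (sqrt (det_A q V - (area_B q V)\<^sup>2))"
proof -
  have "\<exists>s t. unit_pair s t \<and> (ip q (mix_A s t V 0) (mix_A s t V 2) = 0 \<and> area q (V 0) (V 2) = 0
      \<or> ip q (mix_A s t V 1) (mix_A s t V 3) = 0 \<and> area q (V 1) (V 3) = 0)"
    using assms exists_diagonalizing_unit_pair[of "ip q (V 0) (V 2)" "nsq q (V 2) - nsq q (V 0)"]
      exists_diagonalizing_unit_pair[of "ip q (V 1) (V 3)" "nsq q (V 3) - nsq q (V 1)"]
    unfolding mix_A_simps ip_mix_unitary by blast
  then obtain s t where st: "unit_pair s t" and
    "ip q (mix_A s t V 0) (mix_A s t V 2) = 0 \<and> area q (V 0) (V 2) = 0
      \<or> ip q (mix_A s t V 1) (mix_A s t V 3) = 0 \<and> area q (V 1) (V 3) = 0" by blast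
  moreover define W where "W = mix_A s t V"
  ultimately have W: "ip q (W 0) (W 2) = 0 \<and> area q (W 0) (W 2) = 0 \<or> ip q (W 1) (W 3) = 0 \<and> area q (W 1) (W 3) = 0"
    by (simp add: area_B_mix_A del: One_nat_def)
  then have "nsq q (W 0) * nsq q (W 2) = 0 \<or> nsq q (W 1) * nsq q (W 3) = 0"
    using area_sq[of q "W 0" "W 2"] area_sq[of q "W 1" "W 3"] by (auto simp: gram_det_def)
  then have "pair_bound q W (sqrt (nsq q (W 0) * nsq q (W 3) + nsq q (W 1) * nsq q (W 2)))"
    by (intro pair_bound_degenerate) auto
  moreover have "det_A q V - (area_B q V)\<^sup>2 = det_A q W - (area_B q W)\<^sup>2"
    using det_A_mix_A[OF st] area_B_mix_A[OF st] by (simp add: W_def area_B_def)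
  moreover have "\<dots> = nsq q (W 0) * nsq q (W 3) + nsq q (W 1) * nsq q (W 2)"
    unfolding det_A_area_B using W by auto
  ultimately show ?thesis using pair_bound_mix_A[OF st] by (simp add: W_def)
qed

text \<open>The equality case of Cauchy-Schwarz for the vectors with entries
  \<open>sqrt (p1 + h1), sqrt (p1 - h1)\<close> and \<open>sqrt (p2 + h2), sqrt (p2 - h2)\<close>:
  their squared norms are \<open>2 * p1\<close> and \<open>2 * p2\<close>, so they must be
  parallel.\<close>

lemma sqrt_sum_equality:
  fixes p1 p2 h1 h2 :: real
  assumes p: "0 < p1" "0 < p2" and h: "\<bar>h1\<bar> \<le> p1" "\<bar>h2\<bar> \<le> p2"
    and le: "2 * sqrt (p1 * p2) \<le> sqrt ((p1 + h1) * (p2 + h2)) + sqrt ((p1 - h1) * (p2 - h2))"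
  shows "p1 * h2 = p2 * h1"
proof -
  define X where "X = (p1 + h1) * (p2 + h2)"
  define Y where "Y = (p1 - h1) * (p2 - h2)"
  have nn: "0 \<le> X" "0 \<le> Y" using h by (auto simp: X_def Y_def abs_le_iff)
  have "\<bar>h1 * h2\<bar> \<le> p1 * p2" unfolding abs_mult using h p by (intro mult_mono) auto
  then have hh: "0 \<le> p1 * p2 - h1 * h2" by (auto simp: abs_le_iff)
  have "(2 * sqrt (p1 * p2))\<^sup>2 \<le> (sqrt X + sqrt Y)\<^sup>2"
    using le p unfolding X_def Y_def by (intro power_mono) auto
  then have "p1 * p2 - h1 * h2 \<le> sqrt (X * Y)"
    using nn p by (simp add: power2_sum real_sqrt_mult power_mult_distrib) (simp add: X_def Y_def algebra_simps)
  then have "(p1 * p2 - h1 * h2)\<^sup>2 \<le> X * Y"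
    using hh nn by (metis abs_of_nonneg mult_nonneg_nonneg power_mono real_sqrt_pow2)
  moreover have "(p1 * p2 - h1 * h2)\<^sup>2 - X * Y = (p1 * h2 - p2 * h1)\<^sup>2"
    by (simp add: X_def Y_def power2_eq_square algebra_simps)
  ultimately have "(p1 * h2 - p2 * h1)\<^sup>2 \<le> 0" by linarith
  then show ?thesis by simp
qed

lemma B_minimal_step:
  assumes "B_minimal q V" "cmod e = 1"
  shows "(1 + t\<^sup>2) * area_B q V \<le> area_B q (mix_B 1 (of_real t * e) V)"
proof -
  have "((cmod 1)\<^sup>2 + (cmod (of_real t * e))\<^sup>2) * area_B q V \<le> area_B q (mix_B 1 (of_real t * e) V)"
    using assms unfolding B_minimal_def by blast
  then show ?thesis using assms(2) by (simp add: norm_mult)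
qed

text \<open>The first-order condition is empty here, so minimality is used at the distant basis
  \<open>1, e\<close>. Bounding the new areas by products of norms puts
  \<open>sqrt_sum_equality\<close> into its equality case for every phase \<open>e\<close>, which
  gives the missing relation between the inner products. The bound to be reached is 0.\<close>

lemma pair_bound_proportional_diag:
  assumes min: "B_minimal q V" and xy: "0 < x" "0 < y"
    and n0: "x * nsq q (V 0) = y * nsq q (V 1)" and n2: "x * nsq q (V 2) = y * nsq q (V 3)"
    and i02: "ip q (V 0) (V 2) = 0" and i13: "ip q (V 1) (V 3) = 0"
    and pos: "0 < area q (V 0) (V 2)"
  shows "pair_bound q V (sqrt (det_A q V - (area_B q V)\<^sup>2))"
proof -
  define p1 where "p1 = nsq q (V 0) + nsq q (V 1)"
  define p2 where "p2 = nsq q (V 2) + nsq q (V 3)"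
  have a02: "area q (V 0) (V 2) = sqrt (nsq q (V 0) * nsq q (V 2))"
    and a13: "area q (V 1) (V 3) = sqrt (nsq q (V 1) * nsq q (V 3))"
    by (simp_all add: area_def gram_det_def i02 i13 del: One_nat_def)
  have "0 < nsq q (V 0) * nsq q (V 2)" using pos unfolding a02 by simp
  then have n02: "0 < nsq q (V 0)" "0 < nsq q (V 2)"
    using nsq_nonneg[of q "V 0"] nsq_nonneg[of q "V 2"] by (auto simp: zero_less_mult_iff)
  have p: "0 < p1" "0 < p2" using n02 by (auto simp: p1_def p2_def add_pos_nonneg)
  define c where "c = x / y"
  have c: "0 < c" "nsq q (V 1) = c * nsq q (V 0)" "nsq q (V 3) = c * nsq q (V 2)"
    using xy n0 n2 by (auto simp: c_def field_simps)
  have aB: "area_B q V = sqrt (p1 * p2)"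
  proof -
    have "p1 * p2 = ((1 + c) * area q (V 0) (V 2))\<^sup>2"
      using n02 unfolding a02 p1_def p2_def c(2,3) power_mult_distrib by (simp add: power2_eq_square algebra_simps)
    moreover have "area_B q V = (1 + c) * area q (V 0) (V 2)"
    proof -
      have "area q (V 1) (V 3) = sqrt (c\<^sup>2 * (nsq q (V 0) * nsq q (V 2)))"
        unfolding a13 c by (simp add: power2_eq_square mult_ac)
      also have "\<dots> = c * area q (V 0) (V 2)" unfolding a02 real_sqrt_mult using c(1) by simp
      finally show ?thesis by (simp add: area_B_def algebra_simps)
    qed
    ultimately show ?thesis using c(1) by simp
  qed
  have key: "p1 * (2 * Re (cnj e * ip q (V 2) (V 3))) = p2 * (2 * Re (cnj e * ip q (V 0) (V 1)))" if e: "cmod e = 1" for e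
  proof (rule sqrt_sum_equality[OF p])
    define h1 where "h1 = 2 * Re (cnj e * ip q (V 0) (V 1))"
    define h2 where "h2 = 2 * Re (cnj e * ip q (V 2) (V 3))"
    have plus: "nsq q (mix 1 e (V 0) (V 1)) = p1 + h1" "nsq q (mix 1 e (V 2) (V 3)) = p2 + h2"
      unfolding nsq_mix p1_def h1_def p2_def h2_def using e by simp_all
    have minus: "nsq q (mix (- cnj e) (cnj 1) (V 0) (V 1)) = p1 - h1" "nsq q (mix (- cnj e) (cnj 1) (V 2) (V 3)) = p2 - h2"
      unfolding nsq_mix_snd p1_def h1_def p2_def h2_def using e by simp_all
    show "\<bar>2 * Re (cnj e * ip q (V 0) (V 1))\<bar> \<le> p1"
      using nsq_nonneg[of q "mix 1 e (V 0) (V 1)"] nsq_nonneg[of q "mix (- cnj e) (cnj 1) (V 0) (V 1)"]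
      unfolding plus minus h1_def by (auto simp: abs_le_iff)
    show "\<bar>2 * Re (cnj e * ip q (V 2) (V 3))\<bar> \<le> p2"
      using nsq_nonneg[of q "mix 1 e (V 2) (V 3)"] nsq_nonneg[of q "mix (- cnj e) (cnj 1) (V 2) (V 3)"]
      unfolding plus minus h2_def by (auto simp: abs_le_iff)
    have le: "area q f g \<le> sqrt (nsq q f * nsq q g)" for f g
      by (simp add: area_def gram_det_def)
    have "2 * sqrt (p1 * p2) \<le> area_B q (mix_B 1 e V)"
      using B_minimal_step[OF min e, of 1] by (simp add: aB)
    also have "\<dots> \<le> sqrt ((p1 + h1) * (p2 + h2)) + sqrt ((p1 - h1) * (p2 - h2))"
      unfolding area_B_def mix_B_simps plus[symmetric] minus[symmetric] by (intro add_mono le)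
    finally show "2 * sqrt (p1 * p2) \<le> sqrt ((p1 + 2 * Re (cnj e * ip q (V 0) (V 1))) * (p2 + 2 * Re (cnj e * ip q (V 2) (V 3))))
       + sqrt ((p1 - 2 * Re (cnj e * ip q (V 0) (V 1))) * (p2 - 2 * Re (cnj e * ip q (V 2) (V 3))))"
      unfolding h1_def h2_def .
  qed
  have "pair_bound q V (p2 * \<bar>x * nsq q (V 0) - y * nsq q (V 1)\<bar> / sqrt (x * y * p1 * p2))"
  proof (rule pair_bound_balanced[OF xy p])
    show "of_real x * ip q (V 0) (V 2) = of_real y * ip q (V 1) (V 3)" by (simp only: i02 i13 mult_zero_right)
    show "of_real p2 * ip q (V 0) (V 1) = of_real p1 * ip q (V 2) (V 3)"
      using key[of 1] key[of \<i>] by (simp add: complex_eq_iff)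
    have "x = c * y" using xy by (simp add: c_def)
    then show "p2 * x * nsq q (V 0) = p1 * y * nsq q (V 3)" "x * p1 * nsq q (V 2) = y * p2 * nsq q (V 1)"
      unfolding p1_def p2_def c(2,3) by (simp_all add: algebra_simps)
  qed
  then have "pair_bound q V 0" using n0 by simp
  moreover have "det_A q V - (area_B q V)\<^sup>2 = 0"
    using p unfolding aB by (simp add: det_A_def gram_det_def i02 i13 p1_def p2_def del: One_nat_def)
  ultimately show ?thesis by simp
qed

text \<open>Proportional Gram matrices are diagonalised by the same unitary on
  \<open>A\<close>.\<close>

lemma pair_bound_proportional:
  assumes min: "B_minimal q V" and xy: "0 < x" "0 < y"
    and n0: "x * nsq q (V 0) = y * nsq q (V 1)" and n2: "x * nsq q (V 2) = y * nsq q (V 3)"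
    and i: "of_real x * ip q (V 0) (V 2) = of_real y * ip q (V 1) (V 3)"
    and pos: "0 < area q (V 0) (V 2)"
  shows "pair_bound q V (sqrt (det_A q V - (area_B q V)\<^sup>2))"
proof -
  obtain s t where st: "unit_pair s t" and
    diag: "s\<^sup>2 * ip q (V 0) (V 2) - t\<^sup>2 * cnj (ip q (V 0) (V 2)) + s * t * of_real (nsq q (V 2) - nsq q (V 0)) = 0"
    using exists_diagonalizing_unit_pair by blast
  define c where "c = x / y"
  have c: "0 < c" "nsq q (V 1) = c * nsq q (V 0)" "nsq q (V 3) = c * nsq q (V 2)" "x = c * y"
    using xy n0 n2 by (auto simp: c_def field_simps)
  have ci: "ip q (V 1) (V 3) = of_real c * ip q (V 0) (V 2)"
    using i xy by (simp add: c_def field_simps)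
  define W where "W = mix_A s t V"
  have W02: "ip q (W 0) (W 2) = 0"
    unfolding W_def mix_A_simps ip_mix_unitary using diag .
  have "ip q (W 1) (W 3) = of_real c * (s\<^sup>2 * ip q (V 0) (V 2) - t\<^sup>2 * cnj (ip q (V 0) (V 2)) + s * t * of_real (nsq q (V 2) - nsq q (V 0)))"
    unfolding W_def mix_A_simps ip_mix_unitary ci c(2,3) by (simp add: algebra_simps)
  then have W13: "ip q (W 1) (W 3) = 0" unfolding diag by simp
  have "nsq q (W 1) = c * nsq q (W 0)"
    unfolding W_def mix_A_simps nsq_mix ci c(2,3) by (simp add: algebra_simps)
  then have W01: "x * nsq q (W 0) = y * nsq q (W 1)" by (simp add: c(4))
  have "nsq q (W 3) = c * nsq q (W 2)"
    unfolding W_def mix_A_simps nsq_mix ci c(2,3) by (simp add: algebra_simps)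
  then have W23: "x * nsq q (W 2) = y * nsq q (W 3)" by (simp add: c(4))
  have "pair_bound q W (sqrt (det_A q W - (area_B q W)\<^sup>2))"
    using pair_bound_proportional_diag[OF _ xy W01 W23 W02 W13] B_minimal_mix_A[OF st min] pos area_B_mix_A[OF st]
    by (simp add: W_def)
  moreover have "det_A q W - (area_B q W)\<^sup>2 = det_A q V - (area_B q V)\<^sup>2"
    using det_A_mix_A[OF st] area_B_mix_A[OF st] by (simp add: W_def area_B_def)
  ultimately show ?thesis using pair_bound_mix_A[OF st] by (simp add: W_def)
qed

section \<open>Stationarity at a minimum with positive areas\<close>

lemma sqrt_sum_stationary:
  fixes P Q :: "real \<Rightarrow> real"
  assumes P: "(P has_real_derivative P') (at 0)" and Q: "(Q has_real_derivative Q') (at 0)"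
    and p: "P 0 = p\<^sup>2" "0 < p" and r: "Q 0 = r\<^sup>2" "0 < r"
    and min: "\<And>t. (1 + t\<^sup>2) * (p + r) \<le> sqrt (P t) + sqrt (Q t)"
  shows "P' / p + Q' / r = 0"
proof -
  define F where "F = (\<lambda>t. sqrt (P t) + sqrt (Q t) - (1 + t\<^sup>2) * (p + r))"
  have "(F has_real_derivative (P' / p + Q' / r) / 2) (at 0)"
    unfolding F_def using p r
    by (auto intro!: derivative_eq_intros DERIV_real_sqrt_generic P Q simp: field_simps)
  moreover have "F 0 \<le> F t" for t using min[of t] p r by (simp add: F_def)
  ultimately have "(P' / p + Q' / r) / 2 = 0"
    by (intro DERIV_local_min[of F _ 0 1]) auto
  then show ?thesis by simp
qed

text \<open>The first-order condition along the bases \<open>1, t * e\<close>. \<open>P\<close> and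
  \<open>Q\<close> are the squared areas of the two outcomes as polynomials in \<open>t\<close>;
  \<open>K\<close> is the linear coefficient of the inner product for the first outcome and
  \<open>- K\<close> for the second.\<close>

lemma area_stationary:
  fixes V q and e :: complex
  defines "K \<equiv> cnj e * ip q (V 0) (V 3) + e * ip q (V 1) (V 2)"
    and "r1 \<equiv> Re (cnj e * ip q (V 0) (V 1))" and "r2 \<equiv> Re (cnj e * ip q (V 2) (V 3))"
  assumes min: "B_minimal q V" and e: "cmod e = 1"
    and p: "0 < area q (V 0) (V 2)" and r: "0 < area q (V 1) (V 3)"
  shows "(r1 * nsq q (V 2) + nsq q (V 0) * r2 - Re (cnj (ip q (V 0) (V 2)) * K)) / area q (V 0) (V 2)
       = (r1 * nsq q (V 3) + nsq q (V 1) * r2 - Re (cnj (ip q (V 1) (V 3)) * K)) / area q (V 1) (V 3)"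
proof -
  let ?n0 = "nsq q (V 0)" and ?n1 = "nsq q (V 1)" and ?n2 = "nsq q (V 2)" and ?n3 = "nsq q (V 3)"
  let ?z = "ip q (V 0) (V 2)" and ?y = "ip q (V 1) (V 3)"
  define P where "P = (\<lambda>t. (?n0 + t\<^sup>2 * ?n1 + 2 * t * r1) * (?n2 + t\<^sup>2 * ?n3 + 2 * t * r2)
      - ((Re ?z + t * Re K + t\<^sup>2 * Re ?y)\<^sup>2 + (Im ?z + t * Im K + t\<^sup>2 * Im ?y)\<^sup>2))"
  define Q where "Q = (\<lambda>t. (t\<^sup>2 * ?n0 + ?n1 - 2 * t * r1) * (t\<^sup>2 * ?n2 + ?n3 - 2 * t * r2)
      - ((t\<^sup>2 * Re ?z - t * Re K + Re ?y)\<^sup>2 + (t\<^sup>2 * Im ?z - t * Im K + Im ?y)\<^sup>2))"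
  have e1: "cnj e * e = 1" using e by (metis complex_norm_square mult.commute of_real_1 power_one)
  have "area q (mix 1 (of_real t * e) (V 0) (V 1)) (mix 1 (of_real t * e) (V 2) (V 3)) = sqrt (P t)" for t
  proof -
    have "nsq q (mix 1 (of_real t * e) (V 0) (V 1)) = ?n0 + t\<^sup>2 * ?n1 + 2 * t * r1"
      "nsq q (mix 1 (of_real t * e) (V 2) (V 3)) = ?n2 + t\<^sup>2 * ?n3 + 2 * t * r2"
      unfolding nsq_mix r1_def r2_def using e by (simp_all add: norm_mult power_mult_distrib algebra_simps)
    moreover have "ip q (mix 1 (of_real t * e) (V 0) (V 1)) (mix 1 (of_real t * e) (V 2) (V 3))
       = ?z + of_real t * K + (of_real t * of_real t) * (cnj e * e) * ?y"
      unfolding K_def by (simp add: ip_mix_left ip_mix_right algebra_simps)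
    ultimately show ?thesis
      unfolding area_def gram_det_def P_def cmod_power2 e1 by (simp add: power2_eq_square)
  qed
  moreover have "area q (mix (- cnj (of_real t * e)) (cnj 1) (V 0) (V 1)) (mix (- cnj (of_real t * e)) (cnj 1) (V 2) (V 3)) = sqrt (Q t)" for t
  proof -
    have "nsq q (mix (- cnj (of_real t * e)) (cnj 1) (V 0) (V 1)) = t\<^sup>2 * ?n0 + ?n1 - 2 * t * r1"
      "nsq q (mix (- cnj (of_real t * e)) (cnj 1) (V 2) (V 3)) = t\<^sup>2 * ?n2 + ?n3 - 2 * t * r2"
      unfolding nsq_mix_snd r1_def r2_def using e by (simp_all add: norm_mult power_mult_distrib algebra_simps)
    moreover have "ip q (mix (- cnj (of_real t * e)) (cnj 1) (V 0) (V 1)) (mix (- cnj (of_real t * e)) (cnj 1) (V 2) (V 3))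
       = (of_real t * of_real t) * (cnj e * e) * ?z - of_real t * K + ?y"
      unfolding K_def by (simp add: ip_mix_left ip_mix_right algebra_simps)
    ultimately show ?thesis
      unfolding area_def gram_det_def Q_def cmod_power2 e1 by (simp add: power2_eq_square)
  qed
  ultimately have step: "(1 + t\<^sup>2) * (area q (V 0) (V 2) + area q (V 1) (V 3)) \<le> sqrt (P t) + sqrt (Q t)" for t
    using B_minimal_step[OF min e, of t] unfolding area_B_def mix_B_simps by simp
  have P': "(P has_real_derivative 2 * (r1 * ?n2 + ?n0 * r2 - Re (cnj ?z * K))) (at 0)"
    unfolding P_def by (rule derivative_eq_intros refl)+ (simp add: algebra_simps)
  have Q': "(Q has_real_derivative - 2 * (r1 * ?n3 + ?n1 * r2 - Re (cnj ?y * K))) (at 0)"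
    unfolding Q_def by (rule derivative_eq_intros refl)+ (simp add: algebra_simps)
  have "P 0 = (area q (V 0) (V 2))\<^sup>2" "Q 0 = (area q (V 1) (V 3))\<^sup>2"
    by (simp_all add: P_def Q_def area_sq gram_det_def cmod_power2)
  from sqrt_sum_stationary[OF P' Q' this(1) p this(2) r step]
  have "2 * (r1 * ?n2 + ?n0 * r2 - Re (cnj ?z * K)) / area q (V 0) (V 2)
    + - 2 * (r1 * ?n3 + ?n1 * r2 - Re (cnj ?y * K)) / area q (V 1) (V 3) = 0" .
  moreover have "X / a = Y / b" if "2 * X / a + - 2 * Y / b = 0" for X Y a b :: real
    using that by simp
  ultimately show ?thesis by blast
qed

text \<open>Scaled by \<open>x\<close> and \<open>y\<close>, both Gram matrices have determinant 1
  and, by the last assumption, the same off-diagonal entry \<open>z\<close>. Hence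
  \<open>a * c = b * d\<close>, and the terms with \<open>K\<close> cancel from the first-order
  condition.\<close>

lemma pair_bound_diag:
  assumes min: "B_minimal q V"
    and p: "0 < area q (V 0) (V 2)" and r: "0 < area q (V 1) (V 3)"
    and i: "ip q (V 0) (V 2) / of_real (area q (V 0) (V 2)) = ip q (V 1) (V 3) / of_real (area q (V 1) (V 3))"
  shows "pair_bound q V (sqrt (det_A q V - (area_B q V)\<^sup>2))"
proof -
  define x where "x = 1 / area q (V 0) (V 2)"
  define y where "y = 1 / area q (V 1) (V 3)"
  have xy: "0 < x" "0 < y" using p r by (auto simp: x_def y_def)
  have ixy: "of_real x * ip q (V 0) (V 2) = of_real y * ip q (V 1) (V 3)"
    using i by (simp add: x_def y_def)
  define z where "z = of_real x * ip q (V 0) (V 2)"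
  define a where "a = x * nsq q (V 0)"
  define b where "b = y * nsq q (V 1)"
  define c where "c = x * nsq q (V 2)"
  define d where "d = y * nsq q (V 3)"
  have nn: "0 \<le> a" "0 \<le> b" "0 \<le> c" "0 \<le> d" using xy by (auto simp: a_def b_def c_def d_def)
  define m where "m = 1 + (cmod z)\<^sup>2"
  have m: "0 < m" by (simp add: m_def add_pos_nonneg)
  have ac: "a * c = m"
  proof -
    have "x\<^sup>2 * (area q (V 0) (V 2))\<^sup>2 = 1" using p by (simp add: x_def power_divide)
    then show ?thesis using xy
      by (simp add: area_sq gram_det_def m_def z_def a_def c_def norm_mult power_mult_distrib) (simp add: algebra_simps power2_eq_square)
  qed
  have bd: "b * d = m"
  proof -
    have "y\<^sup>2 * (area q (V 1) (V 3))\<^sup>2 = 1" using r by (simp add: y_def power_divide)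
    then show ?thesis using xy
      by (simp add: area_sq gram_det_def m_def z_def ixy b_def d_def norm_mult power_mult_distrib del: One_nat_def) (simp add: algebra_simps power2_eq_square)
  qed
  have stat: "(c - d) * Re (cnj e * ip q (V 0) (V 1)) + (a - b) * Re (cnj e * ip q (V 2) (V 3)) = 0" if e: "cmod e = 1" for e
  proof -
    define K where "K = cnj e * ip q (V 0) (V 3) + e * ip q (V 1) (V 2)"
    have "x * Re (cnj (ip q (V 0) (V 2)) * K) = Re (cnj z * K)"
      "y * Re (cnj (ip q (V 1) (V 3)) * K) = Re (cnj z * K)"
      unfolding z_def by (simp add: algebra_simps) (simp add: ixy algebra_simps del: One_nat_def)
    then show ?thesis
      using area_stationary[OF min e p r] unfolding K_def[symmetric]
      by (simp add: divide_inverse x_def[unfolded divide_inverse mult_1, symmetric] y_def[unfolded divide_inverse mult_1, symmetric] a_def b_def c_def d_def algebra_simps del: One_nat_def)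
  qed
  \<comment> \<open>The phases 1 and \<open>\<i>\<close> give the real and the imaginary
    part.\<close>
  have cstat: "of_real (c - d) * ip q (V 0) (V 1) = of_real (b - a) * ip q (V 2) (V 3)"
    using stat[of 1] stat[of \<i>] by (simp add: complex_eq_iff algebra_simps)
  have val: "det_A q V - (area_B q V)\<^sup>2 = (a * d + b * c - 2 * m) / (x * y)"
  proof -
    have "x * y * Re (ip q (V 0) (V 2) * cnj (ip q (V 1) (V 3))) = Re (z * cnj (of_real y * ip q (V 1) (V 3)))"
      by (simp add: z_def algebra_simps)
    also have "\<dots> = (cmod z)\<^sup>2" unfolding ixy[symmetric] z_def[symmetric]
      by (simp add: complex_norm_square[symmetric] del: of_real_power)
    finally have "x * y * Re (ip q (V 0) (V 2) * cnj (ip q (V 1) (V 3))) = m - 1" by (simp add: m_def)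
    moreover have "x * y * (area q (V 0) (V 2) * area q (V 1) (V 3)) = 1" using p r by (simp add: x_def y_def)
    ultimately have "x * y * (det_A q V - (area_B q V)\<^sup>2) = a * d + b * c - 2 * m"
      unfolding det_A_area_B a_def b_def c_def d_def by (simp add: algebra_simps)
    then show ?thesis using xy by (simp add: field_simps)
  qed
  \<comment> \<open>The weights are \<open>|a - b|\<close> and \<open>|c - d|\<close>. Since
    \<open>a * d + b * c - 2 * m = (a - b) * (d - c)\<close>, the bound of
    \<open>pair_bound_balanced\<close> becomes exactly the remainder computed in
    \<open>val\<close>.\<close>
  have final: "pair_bound q V (sqrt (det_A q V - (area_B q V)\<^sup>2))"
    if y12: "0 < y1" "0 < y2" "y1 = \<bar>a - b\<bar>" "y1 * y2 = a * d + b * c - 2 * m"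
      "of_real y2 * ip q (V 0) (V 1) = of_real y1 * ip q (V 2) (V 3)" "y2 * a = y1 * d" "y1 * c = y2 * b" for y1 y2
  proof -
    have "pair_bound q V (y2 * \<bar>x * nsq q (V 0) - y * nsq q (V 1)\<bar> / sqrt (x * y * y1 * y2))"
      using y12 ixy xy by (intro pair_bound_balanced) (simp_all add: a_def b_def c_def d_def mult_ac)
    also have "x * nsq q (V 0) - y * nsq q (V 1) = a - b" by (simp add: a_def b_def)
    also have "y2 * \<bar>a - b\<bar> / sqrt (x * y * y1 * y2) = sqrt (y1 * y2 / (x * y))"
    proof -
      define S where "S = sqrt (y1 * y2)"
      define T where "T = sqrt (x * y)"
      have "0 < S" "0 < T" "S * S = y2 * y1"
        using xy y12(1,2) by (simp_all add: S_def T_def mult.commute)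
      moreover have "sqrt (x * y * y1 * y2) = T * S" "sqrt (y1 * y2 / (x * y)) = S / T"
        by (simp_all add: S_def T_def real_sqrt_mult real_sqrt_divide)
      ultimately show ?thesis unfolding y12(3)[symmetric] by (simp flip: \<open>S * S = y2 * y1\<close>)
    qed
    finally show ?thesis unfolding val y12(4) .
  qed
  \<comment> \<open>As \<open>a * c = b * d\<close> is positive, \<open>a - b\<close> and
    \<open>c - d\<close> have opposite signs or both vanish. If they vanish, so would the weights;
    the scaled Gram matrices then coincide.\<close>
  consider "a = b" | "a > b" | "a < b" by linarith
  then show ?thesis
  proof cases
    case 1
    then have "a \<noteq> 0" "c = d" using ac bd m by auto
    then show ?thesis using pair_bound_proportional[OF min xy _ _ ixy p] 1
      by (simp add: a_def b_def c_def d_def)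
  next
    case 2
    have "b \<noteq> 0" using bd m by auto
    then have "0 < b" using nn by simp
    have "c < d"
    proof (rule ccontr)
      assume "\<not> c < d"
      then have "b * d \<le> b * c" using nn by (simp add: mult_left_mono)
      also have "\<dots> < a * c" using 2 ac m nn by (intro mult_strict_right_mono) (auto intro: le_neq_trans)
      finally show False using ac bd by simp
    qed
    then show ?thesis using 2 cstat ac bd
      by (intro final[of "a - b" "d - c"]) (simp_all add: algebra_simps complex_eq_iff)
  next
    case 3
    have "a \<noteq> 0" using ac m by auto
    then have "0 < a" using nn by simp
    have "d < c"
    proof (rule ccontr)
      assume "\<not> d < c"
      then have "a * c \<le> a * d" using nn by (simp add: mult_left_mono)
      also have "\<dots> < b * d" using 3 bd m nn by (intro mult_strict_right_mono) (auto intro: le_neq_trans)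
      finally show False using ac bd by simp
    qed
    then show ?thesis using 3 cstat ac bd
      by (intro final[of "b - a" "c - d"]) (simp_all add: algebra_simps complex_eq_iff)
  qed
qed

text \<open>The unitary on \<open>A\<close> diagonalises the difference of the two scaled Gram
  matrices, so that their off-diagonal entries agree. \<open>z\<close> is the off-diagonal entry of
  this difference and \<open>d\<close> the gap between its diagonal entries.\<close>

lemma pair_bound_B_minimal:
  assumes min: "B_minimal q V"
  shows "pair_bound q V (sqrt (det_A q V - (area_B q V)\<^sup>2))"
proof (cases "area q (V 0) (V 2) = 0 \<or> area q (V 1) (V 3) = 0")
  case True
  then show ?thesis by (rule pair_bound_area_zero)
next
  case False
  then have pos: "0 < area q (V 0) (V 2)" "0 < area q (V 1) (V 3)"
    using area_nonneg by (metis less_eq_real_def)+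
  define x where "x = 1 / area q (V 0) (V 2)"
  define y where "y = 1 / area q (V 1) (V 3)"
  define z where "z = of_real x * ip q (V 0) (V 2) - of_real y * ip q (V 1) (V 3)"
  define d where "d = x * (nsq q (V 2) - nsq q (V 0)) - y * (nsq q (V 3) - nsq q (V 1))"
  obtain s t where st: "unit_pair s t" and diag: "s\<^sup>2 * z - t\<^sup>2 * cnj z + s * t * of_real d = 0"
    using exists_diagonalizing_unit_pair by blast
  define W where "W = mix_A s t V"
  have WV: "area q (W 0) (W 2) = area q (V 0) (V 2)" "area q (W 1) (W 3) = area q (V 1) (V 3)"
    unfolding W_def by (simp_all only: area_B_mix_A[OF st])
  have "of_real x * ip q (W 0) (W 2) - of_real y * ip q (W 1) (W 3) = s\<^sup>2 * z - t\<^sup>2 * cnj z + s * t * of_real d"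
    unfolding W_def mix_A_simps ip_mix_unitary z_def d_def by (simp add: algebra_simps)
  then have "pair_bound q W (sqrt (det_A q W - (area_B q W)\<^sup>2))"
    using pos diag B_minimal_mix_A[OF st min]
    by (intro pair_bound_diag) (simp_all add: WV x_def y_def W_def[symmetric] del: One_nat_def)
  moreover have "det_A q W - (area_B q W)\<^sup>2 = det_A q V - (area_B q V)\<^sup>2"
    using det_A_mix_A[OF st] WV by (simp add: W_def area_B_def)
  ultimately show ?thesis using pair_bound_mix_A[OF st] by (simp add: W_def)
qed

section \<open>Existence of a minimal measurement basis\<close>

lemma mix_mix:
  "mix a b (mix s t f g) (mix (- cnj t) (cnj s) f g) = mix (a * s - b * cnj t) (a * t + b * cnj s) f g"
  by (simp add: mix_def fun_eq_iff algebra_simps)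

lemma mix_B_mix_B:
  "mix_B a b (mix_B s t V) = mix_B (a * s - b * cnj t) (a * t + b * cnj s) V"
proof -
  have "mix (- cnj b) (cnj a) (mix s t f g) (mix (- cnj t) (cnj s) f g)
    = mix (- cnj (a * t + b * cnj s)) (cnj (a * s - b * cnj t)) f g" for f g
    unfolding mix_mix by (rule arg_cong2[where f = "\<lambda>x y. mix x y f g"]) (simp_all add: algebra_simps)
  then show ?thesis
    unfolding mix_B_def[of a b] mix_B_simps mix_mix unfolding mix_B_def by simp
qed

lemma area_mix_scale:
  "area q (mix (of_real c * s) (of_real c * t) f g) (mix (of_real c * s) (of_real c * t) h k)
   = c\<^sup>2 * area q (mix s t f g) (mix s t h k)"
proof -
  have m: "mix (of_real c * s) (of_real c * t) f g = (\<lambda>w. of_real c * mix s t f g w)" for f g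
    by (simp add: mix_def fun_eq_iff algebra_simps)
  have eq: "gram_det (c\<^sup>2 * a) (c\<^sup>2 * b) (of_real (c * c) * z) = (c\<^sup>2)\<^sup>2 * gram_det a b z" for a b z
    by (simp add: gram_det_def norm_mult power_mult_distrib power2_eq_square algebra_simps)
  show ?thesis unfolding area_def m ip_scale nsq_scale eq by (simp only: real_sqrt_mult real_sqrt_abs abs_power2)
qed

lemma area_B_mix_B_scale:
  "area_B q (mix_B (of_real c * s) (of_real c * t) V) = c\<^sup>2 * area_B q (mix_B s t V)"
proof -
  have "- cnj (of_real c * t) = of_real c * - cnj t" "cnj (of_real c * s) = of_real c * cnj s" for s t by simp_all
  then show ?thesis unfolding area_B_def mix_B_simps by (simp only: area_mix_scale distrib_left)
qed

text \<open>Unit pairs form a compact 3-sphere, on which the continuous area attains its minimum.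
  Scaling extends minimality to all pairs, and composition with the unitary \<open>s, t\<close>,
  which preserves lengths, transfers it to the new basis.\<close>

lemma exists_B_minimal: "\<exists>s t. unit_pair s t \<and> B_minimal q (mix_B s t V)"
proof -
  define F where "F = (\<lambda>p :: (real \<times> real) \<times> (real \<times> real).
     area_B q (mix_B (Complex (fst (fst p)) (snd (fst p))) (Complex (fst (snd p)) (snd (snd p))) V))"
  define S where "S = sphere (0 :: (real \<times> real) \<times> (real \<times> real)) 1"
  have F_cont: "continuous_on S F"
    unfolding F_def area_B_def mix_B_simps area_def gram_det_def nsq_def ip_def mix_def
    by (simp add: Complex_eq, intro continuous_intros)
  have "closed S" unfolding S_def sphere_def by (intro closed_Collect_eq continuous_intros)
  moreover have "bounded S" unfolding S_def by (rule bounded_subset[OF bounded_cball sphere_cball])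
  ultimately have "compact S" by (simp add: compact_eq_bounded_closed)
  moreover have "((1, 0), (0, 0)) \<in> S" by (simp add: S_def norm_Pair)
  ultimately obtain p where p: "p \<in> S" "\<And>p'. p' \<in> S \<Longrightarrow> F p \<le> F p'"
    using continuous_attains_inf[OF _ _ F_cont] by blast
  define s where "s = Complex (fst (fst p)) (snd (fst p))"
  define t where "t = Complex (fst (snd p)) (snd (snd p))"
  have inS: "((Re a, Im a), (Re b, Im b)) \<in> S \<longleftrightarrow> unit_pair a b" for a b
    by (simp add: S_def unit_pair_def norm_Pair cmod_power2)
  have st: "unit_pair s t" using p(1) inS[of s t] by (simp add: s_def t_def)
  have min: "area_B q (mix_B s t V) \<le> area_B q (mix_B a b V)" if "unit_pair a b" for a b
    using p(2)[OF iffD2[OF inS that]] by (simp add: F_def s_def t_def)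
  have "((cmod a)\<^sup>2 + (cmod b)\<^sup>2) * area_B q (mix_B s t V) \<le> area_B q (mix_B a b V)" for a b
  proof (cases "a = 0 \<and> b = 0")
    case True
    then show ?thesis by simp
  next
    case False
    define c where "c = sqrt ((cmod a)\<^sup>2 + (cmod b)\<^sup>2)"
    have "0 < (cmod a)\<^sup>2 + (cmod b)\<^sup>2" using False by (simp add: sum_power2_gt_zero_iff)
    then have c: "0 < c" "c\<^sup>2 = (cmod a)\<^sup>2 + (cmod b)\<^sup>2" by (simp_all add: c_def)
    have "unit_pair (a / of_real c) (b / of_real c)"
      using c by (simp add: unit_pair_def norm_divide power_divide flip: add_divide_distrib c(2))
    from mult_left_mono[OF min[OF this], of "c\<^sup>2"] c
    have "c\<^sup>2 * area_B q (mix_B s t V) \<le> area_B q (mix_B (of_real c * (a / of_real c)) (of_real c * (b / of_real c)) V)"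
      unfolding area_B_mix_B_scale by simp
    then show ?thesis using c by simp
  qed
  moreover have "(cmod (a * s - b * cnj t))\<^sup>2 + (cmod (a * t + b * cnj s))\<^sup>2 = (cmod a)\<^sup>2 + (cmod b)\<^sup>2" for a b
  proof -
    have "(cmod (a * s - b * cnj t))\<^sup>2 + (cmod (a * t + b * cnj s))\<^sup>2 = ((cmod a)\<^sup>2 + (cmod b)\<^sup>2) * ((cmod s)\<^sup>2 + (cmod t)\<^sup>2)"
      unfolding cmod_power2 by (simp add: power2_eq_square algebra_simps)
    then show ?thesis using st by (simp add: unit_pair_def)
  qed
  ultimately have "B_minimal q (mix_B s t V)"
    unfolding B_minimal_def mix_B_mix_B by metis
  then show ?thesis using st by blast
qed

lemma pair_bound_nonneg:
  assumes "pair_bound q V r"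
  shows "0 \<le> r"
proof -
  obtain xs where "(\<Sum>k\<leftarrow>xs. cmod (k 0 * k 3 - k 1 * k (2::nat))) \<le> r"
    using assms unfolding pair_bound_def by blast
  moreover have "0 \<le> (\<Sum>k\<leftarrow>xs. cmod (k 0 * k 3 - k 1 * k (2::nat)))"
    by (rule sum_list_nonneg) auto
  ultimately show ?thesis by linarith
qed

text \<open>Measuring \<open>B\<close> in the basis that minimises the average area leaves exactly enough of
  \<open>det_A\<close> for the pair \<open>A B\<close>.\<close>

theorem pure_state_monogamy:
  obtains s t where "unit_pair s t" "(area_B q (mix_B s t V))\<^sup>2 \<le> det_A q V"
    "pair_bound q V (sqrt (det_A q V - (area_B q (mix_B s t V))\<^sup>2))"
proof -
  obtain s t where st: "unit_pair s t" "B_minimal q (mix_B s t V)" using exists_B_minimal by blast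
  have "pair_bound q (mix_B s t V) (sqrt (det_A q V - (area_B q (mix_B s t V))\<^sup>2))"
    using pair_bound_B_minimal[OF st(2)] det_A_mix_B[OF st(1)] by simp
  from pair_bound_mix_B[OF st(1) this]
  have pb: "pair_bound q V (sqrt (det_A q V - (area_B q (mix_B s t V))\<^sup>2))" .
  then have "0 \<le> sqrt (det_A q V - (area_B q (mix_B s t V))\<^sup>2)"
    by (rule pair_bound_nonneg)
  then have "(area_B q (mix_B s t V))\<^sup>2 \<le> det_A q V" by simp
  then show ?thesis using that st(1) pb by blast
qed

section \<open>Square roots of positive semidefinite matrices\<close>

text \<open>Matrices are functions of two indices here, so that an induction on the dimension can
  restrict them without resizing.\<close>

definition sesq :: "nat \<Rightarrow> (nat \<Rightarrow> nat \<Rightarrow> complex) \<Rightarrow> (nat \<Rightarrow> complex) \<Rightarrow> (nat \<Rightarrow> complex) \<Rightarrow> complex" where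
  "sesq d A u v = (\<Sum>x<d. \<Sum>y<d. cnj (u x) * A x y * v y)"

definition psd_fun :: "nat \<Rightarrow> (nat \<Rightarrow> nat \<Rightarrow> complex) \<Rightarrow> bool" where
  "psd_fun d A \<longleftrightarrow> (\<forall>v. 0 \<le> sesq d A v v)"

lemma sesq_add_scale:
  "sesq d A (\<lambda>x. u x + c * v x) (\<lambda>x. u x + c * v x)
   = sesq d A u u + c * sesq d A u v + cnj c * sesq d A v u + cnj c * c * sesq d A v v"
  by (simp add: sesq_def algebra_simps sum.distrib sum_distrib_left)

lemma sesq_delta:
  "x < d \<Longrightarrow> sesq d A (\<lambda>z. if z = x then 1 else 0) v = (\<Sum>y<d. A x y * v y)"
  "y < d \<Longrightarrow> sesq d A u (\<lambda>z. if z = y then 1 else 0) = (\<Sum>x<d. cnj (u x) * A x y)"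
  unfolding sesq_def
   apply (subst sum.swap)
  by (simp_all add: if_distrib[of cnj] if_distrib[of "\<lambda>z. z * _"] if_distrib[of "\<lambda>z. _ * z"] cong: if_cong)

text \<open>The form is real at \<open>u + c * v\<close>; the choices \<open>c = 1\<close> and
  \<open>c = \<i>\<close> separate real and imaginary parts.\<close>

lemma psd_fun_sesq_cnj:
  assumes "psd_fun d A"
  shows "sesq d A v u = cnj (sesq d A u v)"
proof -
  have im: "Im (c * sesq d A u v + cnj c * sesq d A v u) = 0" for c
  proof -
    have "0 \<le> sesq d A u u" "0 \<le> sesq d A v v" "0 \<le> sesq d A (\<lambda>x. u x + c * v x) (\<lambda>x. u x + c * v x)"
      using assms unfolding psd_fun_def by blast+
    then show ?thesis
      unfolding sesq_add_scale by (simp add: less_eq_complex_def complex_eq_iff)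
  qed
  show ?thesis using im[of 1] im[of \<i>] by (simp add: complex_eq_iff)
qed

text \<open>Moving from \<open>v\<close> by \<open>- t * z\<close> times \<open>u\<close> changes
  the form by a negative term linear in \<open>t\<close> and a nonnegative quadratic one. With
  \<open>t * m < 1\<close> the linear term wins, and the form would be negative.\<close>

lemma psd_fun_null:
  assumes A: "psd_fun d A" and v: "sesq d A v v = 0"
  shows "sesq d A u v = 0"
proof (rule ccontr)
  assume nz: "sesq d A u v \<noteq> 0"
  define z where "z = sesq d A u v"
  define m where "m = Re (sesq d A u u)"
  have uu: "0 \<le> sesq d A u u" using A by (simp add: psd_fun_def)
  then have m: "sesq d A u u = of_real m" "0 \<le> m"
    by (auto simp: m_def less_eq_complex_def complex_eq_iff)
  define t where "t = 1 / (1 + m)"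
  have t: "0 < t" "t * m < 1" using m(2) by (auto simp: t_def field_simps)
  have "0 \<le> sesq d A (\<lambda>x. v x + - of_real t * z * u x) (\<lambda>x. v x + - of_real t * z * u x)"
    using A by (simp add: psd_fun_def)
  also have "\<dots> = of_real (- 2 * t * (cmod z)\<^sup>2 + t * t * (cmod z)\<^sup>2 * m)"
    unfolding sesq_add_scale v psd_fun_sesq_cnj[OF A, of v u] m(1)
    unfolding z_def[symmetric] of_real_add of_real_mult complex_norm_square
    by (simp add: algebra_simps)
  finally have "0 \<le> - 2 * t * (cmod z)\<^sup>2 + t * t * (cmod z)\<^sup>2 * m"
    by (simp add: less_eq_complex_def)
  also have "\<dots> = t * (cmod z)\<^sup>2 * (t * m - 2)" by (simp add: algebra_simps)
  also have "\<dots> < 0" using t nz by (simp add: z_def mult_less_0_iff)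
  finally show False by simp
qed

lemma psd_fun_cnj:
  assumes "psd_fun d A" "x < d" "y < d"
  shows "A y x = cnj (A x y)"
proof -
  have e: "sesq d A (\<lambda>z. if z = x then 1 else 0) (\<lambda>z. if z = y then 1 else 0) = A x y"
    if "x < d" "y < d" for x y
    using that by (simp add: sesq_delta if_distrib[of "\<lambda>z. _ * z"] cong: if_cong)
  show ?thesis
    using psd_fun_sesq_cnj[OF assms(1), of "\<lambda>z. if z = y then 1 else 0" "\<lambda>z. if z = x then 1 else 0"]
    by (simp add: e assms)
qed

lemma psd_fun_null_apply:
  assumes "psd_fun d A" "sesq d A v v = 0" "x < d"
  shows "(\<Sum>y<d. A x y * v y) = 0"
  using psd_fun_null[OF assms(1,2)] sesq_delta(1)[OF assms(3)] by metis

lemma sesq_cong: "(\<And>x y. \<lbrakk>x < d; y < d\<rbrakk> \<Longrightarrow> A x y = B x y) \<Longrightarrow> sesq d A u v = sesq d B u v"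
  by (simp add: sesq_def)

text \<open>With \<open>D = R - S\<close> and \<open>P = R + S\<close> one has \<open>P D + D P = 2 (R\<^sup>2 - S\<^sup>2) = 0\<close>, so the trace
  of \<open>D P D\<close> vanishes, whence \<open>P D = 0\<close>, then \<open>R D = S D = 0\<close> and \<open>D\<^sup>2 = 0\<close>.\<close>

lemma psd_fun_root_unique:
  assumes R: "psd_fun d R" and S: "psd_fun d S"
    and eq: "\<And>x y. \<lbrakk>x < d; y < d\<rbrakk> \<Longrightarrow> (\<Sum>z<d. R x z * R z y) = (\<Sum>z<d. S x z * S z y)"
    and xy: "x < d" "y < d"
  shows "R x y = S x y"
proof -
  define D where "D = (\<lambda>x y. R x y - S x y)"
  define P where "P = (\<lambda>x y. R x y + S x y)"
  have Dh: "cnj (D x y) = D y x" if "x < d" "y < d" for x y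
    using psd_fun_cnj[OF R that] psd_fun_cnj[OF S that] by (simp add: D_def)
  have anti: "(\<Sum>z<d. D x z * P z y) = - (\<Sum>z<d. P x z * D z y)" if "x < d" "y < d" for x y
  proof -
    have "(\<Sum>z<d. D x z * P z y) + (\<Sum>z<d. P x z * D z y)
      = 2 * ((\<Sum>z<d. R x z * R z y) - (\<Sum>z<d. S x z * S z y))"
      unfolding D_def P_def sum.distrib[symmetric] sum_subtractf[symmetric] sum_distrib_left
      by (intro sum.cong refl) (simp add: algebra_simps)
    then show ?thesis using eq[OF that] by (simp add: eq_neg_iff_add_eq_0)
  qed
  have sq: "sesq d P (\<lambda>y. D y j) (\<lambda>y. D y j) = (\<Sum>x<d. \<Sum>y<d. D j x * P x y * D y j)" if "j < d" for j
    using that by (simp add: sesq_def Dh)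
  define T where "T = (\<Sum>j<d. \<Sum>x<d. \<Sum>y<d. D j x * P x y * D y j)"
  have "T = (\<Sum>j<d. \<Sum>y<d. (\<Sum>x<d. D j x * P x y) * D y j)"
    unfolding T_def sum_distrib_right by (intro sum.cong refl sum.swap)
  also have "\<dots> = - (\<Sum>j<d. \<Sum>y<d. \<Sum>x<d. P j x * D x y * D y j)"
    by (simp add: anti sum_negf sum_distrib_right)
  also have "(\<Sum>j<d. \<Sum>y<d. \<Sum>x<d. P j x * D x y * D y j) = (\<Sum>y<d. \<Sum>j<d. \<Sum>x<d. P j x * D x y * D y j)"
    by (rule sum.swap)
  also have "\<dots> = T"
    unfolding T_def by (intro sum.cong refl) (simp add: mult.commute mult.left_commute)
  finally have T0: "T = 0" by (simp add: eq_neg_iff_add_eq_0)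
  have PRS: "sesq d P u v = sesq d R u v + sesq d S u v" for u v
    by (simp add: sesq_def P_def algebra_simps sum.distrib)
  have nn: "0 \<le> sesq d R v v" "0 \<le> sesq d S v v" for v using R S by (auto simp: psd_fun_def)
  have "sesq d P (\<lambda>y. D y j) (\<lambda>y. D y j) = 0" if "j < d" for j
  proof -
    have "(\<Sum>j<d. sesq d P (\<lambda>y. D y j) (\<lambda>y. D y j)) = 0"
      using T0 unfolding T_def by (simp add: sq)
    moreover have "0 \<le> sesq d P (\<lambda>y. D y j) (\<lambda>y. D y j)" for j
      unfolding PRS using nn by (simp add: add_nonneg_nonneg)
    ultimately show ?thesis using that by (simp add: sum_nonneg_eq_0_iff)
  qed
  then have "sesq d R (\<lambda>y. D y j) (\<lambda>y. D y j) = 0" "sesq d S (\<lambda>y. D y j) (\<lambda>y. D y j) = 0" if "j < d" for j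
    using that nn[of "\<lambda>y. D y j"] unfolding PRS by (metis add_nonneg_eq_0_iff)+
  then have "(\<Sum>y<d. R i y * D y j) = 0" "(\<Sum>y<d. S i y * D y j) = 0" if "i < d" "j < d" for i j
    using that psd_fun_null_apply[OF R] psd_fun_null_apply[OF S] by metis+
  then have "(\<Sum>z<d. D y z * D z y) = 0"
    using xy unfolding D_def by (simp add: left_diff_distrib sum_subtractf)
  then have "of_real (\<Sum>z<d. (cmod (D z y))\<^sup>2) = (0 :: complex)"
    unfolding of_real_sum complex_norm_square using xy by (simp add: Dh mult.commute)
  then have "(\<Sum>z<d. (cmod (D z y))\<^sup>2) = 0" by (simp only: of_real_eq_0_iff)
  then have "D x y = 0" using xy by (simp add: sum_nonneg_eq_0_iff)
  then show ?thesis by (simp add: D_def)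
qed

lemma psd_iff_psd_fun:
  assumes A: "A \<in> carrier_mat d d"
  shows "psd d A \<longleftrightarrow> psd_fun d (\<lambda>x y. A $$ (x, y))"
proof -
  have form: "(A *\<^sub>v v) \<bullet>c v = sesq d (\<lambda>x y. A $$ (x, y)) (\<lambda>x. v $ x) (\<lambda>x. v $ x)" if "v \<in> carrier_vec d" for v
    using that A by (simp add: sesq_def scalar_prod_def mult_mat_vec_def atLeast0LessThan
        sum_distrib_right sum_distrib_left mult.commute mult.left_commute)
  have ext: "sesq d B u u = sesq d B (\<lambda>x. vec d u $ x) (\<lambda>x. vec d u $ x)" for B u
    by (simp add: sesq_def)
  show ?thesis
  proof
    assume "psd d A"
    then show "psd_fun d (\<lambda>x y. A $$ (x, y))"
      unfolding psd_fun_def psd_def by (metis ext form vec_carrier)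
  next
    assume "psd_fun d (\<lambda>x y. A $$ (x, y))"
    then show "psd d A" using A form unfolding psd_fun_def psd_def by simp
  qed
qed

text \<open>\<open>psd_sqrt\<close> is a definite description, so evaluating it means exhibiting a
  root and knowing that it is the only one.\<close>

lemma psd_sqrt_eqI:
  assumes R: "psd d R" and A: "R * R = A"
  shows "psd_sqrt A = R"
proof -
  have Rc: "R \<in> carrier_mat d d" using R by (simp add: psd_def)
  then have dA: "dim_row A = d" using A by auto
  show ?thesis unfolding psd_sqrt_def dA
  proof (rule the_equality)
    show "psd d R \<and> R * R = A" using assms by blast
    fix S assume S: "psd d S \<and> S * S = A"
    then have Sc: "S \<in> carrier_mat d d" by (simp add: psd_def)
    have prod: "(\<Sum>z<d. M $$ (x, z) * M $$ (z, y)) = (M * M) $$ (x, y)"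
      if "M \<in> carrier_mat d d" "x < d" "y < d" for M :: "complex mat" and x y
      using that by (simp add: scalar_prod_def atLeast0LessThan)
    have "S $$ (x, y) = R $$ (x, y)" if "x < d" "y < d" for x y
    proof (rule psd_fun_root_unique[where R = "\<lambda>x y. S $$ (x, y)" and S = "\<lambda>x y. R $$ (x, y)", OF _ _ _ that])
      show "psd_fun d (\<lambda>x y. S $$ (x, y))" "psd_fun d (\<lambda>x y. R $$ (x, y))"
        using S R psd_iff_psd_fun[OF Sc] psd_iff_psd_fun[OF Rc] by blast+
      show "(\<Sum>z<d. S $$ (u, z) * S $$ (z, v)) = (\<Sum>z<d. R $$ (u, z) * R $$ (z, v))" if "u < d" "v < d" for u v
        using S A prod[OF Sc that] prod[OF Rc that] by simp
    qed
    then show "S = R" using Rc Sc by (intro eq_matI) auto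
  qed
qed

text \<open>The nonzero \<open>f i\<close> are orthogonal, unnormalised eigenvectors with
  eigenvalues \<open>c i * \<nu> i\<close>.\<close>

lemma mat_trace_psd_sqrt_orthogonal:
  fixes f :: "'i \<Rightarrow> nat \<Rightarrow> complex" and c \<nu> :: "'i \<Rightarrow> real"
  assumes I: "finite I" and c: "\<And>i. i \<in> I \<Longrightarrow> 0 \<le> c i"
    and orth: "\<And>i j. \<lbrakk>i \<in> I; j \<in> I\<rbrakk> \<Longrightarrow> ip d (f i) (f j) = (if i = j then of_real (\<nu> i) else 0)"
  shows "mat_trace (psd_sqrt (mat d d (\<lambda>(x, y). \<Sum>i\<in>I. of_real (c i) * (f i x * cnj (f i y)))))
    = of_real (\<Sum>i\<in>I. sqrt (c i * \<nu> i))"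
proof -
  have \<nu>: "\<nu> i = nsq d (f i)" if "i \<in> I" for i
    using orth[OF that that] by (simp add: ip_self)
  then have \<nu>nn: "0 \<le> \<nu> i" if "i \<in> I" for i using that by simp
  \<comment> \<open>Chosen so that the square of \<open>\<kappa> i\<close> times
    \<open>\<nu> i\<close> is \<open>c i\<close>. For \<open>\<nu> i = 0\<close> the quotient is 0,
    which is harmless because \<open>f i\<close> vanishes.\<close>
  define \<kappa> where "\<kappa> = (\<lambda>i. sqrt (c i / \<nu> i))"
  define R where "R = mat d d (\<lambda>(x, y). \<Sum>i\<in>I. of_real (\<kappa> i) * (f i x * cnj (f i y)))"
  have "psd d R"
  proof -
    have "sesq d (\<lambda>x y. \<Sum>i\<in>I. of_real (\<kappa> i) * (f i x * cnj (f i y))) v v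
      = (\<Sum>i\<in>I. of_real (\<kappa> i * (cmod (ip d (f i) v))\<^sup>2))" for v
    proof -
      have "sesq d (\<lambda>x y. \<Sum>i\<in>I. of_real (\<kappa> i) * (f i x * cnj (f i y))) v v
        = (\<Sum>x<d. \<Sum>y<d. \<Sum>i\<in>I. of_real (\<kappa> i) * ((f i x * cnj (v x)) * (v y * cnj (f i y))))"
        by (simp add: sesq_def sum_distrib_left sum_distrib_right algebra_simps)
      also have "\<dots> = (\<Sum>i\<in>I. \<Sum>x<d. \<Sum>y<d. of_real (\<kappa> i) * ((f i x * cnj (v x)) * (v y * cnj (f i y))))"
        by (subst sum.swap[of _ I]) (intro sum.cong refl sum.swap)
      also have "\<dots> = (\<Sum>i\<in>I. of_real (\<kappa> i) * (ip d (f i) v * ip d v (f i)))"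
        unfolding ip_def sum_product unfolding sum_distrib_left ..
      also have "\<dots> = (\<Sum>i\<in>I. of_real (\<kappa> i * (cmod (ip d (f i) v))\<^sup>2))"
        unfolding of_real_mult complex_norm_square ip_cnj ..
      finally show ?thesis .
    qed
    moreover have "0 \<le> \<kappa> i" if "i \<in> I" for i using c \<nu>nn that by (simp add: \<kappa>_def)
    ultimately have "psd_fun d (\<lambda>x y. \<Sum>i\<in>I. of_real (\<kappa> i) * (f i x * cnj (f i y)))"
      unfolding psd_fun_def by (simp add: sum_nonneg less_eq_complex_def)
    then have "psd_fun d (\<lambda>x y. R $$ (x, y))"
      unfolding psd_fun_def R_def by (subst sesq_cong[where B = "\<lambda>x y. \<Sum>i\<in>I. of_real (\<kappa> i) * (f i x * cnj (f i y))"]) auto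
    then show ?thesis by (subst psd_iff_psd_fun) (auto simp: R_def)
  qed
  moreover have "R * R = mat d d (\<lambda>(x, y). \<Sum>i\<in>I. of_real (c i) * (f i x * cnj (f i y)))"
  proof (rule eq_matI)
    fix x y assume xy: "x < dim_row (mat d d (\<lambda>(x, y). \<Sum>i\<in>I. of_real (c i) * (f i x * cnj (f i y))))"
      "y < dim_col (mat d d (\<lambda>(x, y). \<Sum>i\<in>I. of_real (c i) * (f i x * cnj (f i y))))"
    then have lt: "x < d" "y < d" by auto
    have "(R * R) $$ (x, y) = (\<Sum>z<d. \<Sum>i\<in>I. \<Sum>j\<in>I. of_real (\<kappa> i * \<kappa> j) * (f j x * cnj (f i y)) * (f i z * cnj (f j z)))"
      using lt by (simp add: R_def scalar_prod_def atLeast0LessThan sum_product algebra_simps)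
    also have "\<dots> = (\<Sum>i\<in>I. \<Sum>j\<in>I. of_real (\<kappa> i * \<kappa> j) * (f j x * cnj (f i y)) * ip d (f i) (f j))"
      unfolding ip_def sum_distrib_left
      by (subst sum.swap) (intro sum.cong refl sum.swap)
    also have "\<dots> = (\<Sum>i\<in>I. of_real (\<kappa> i * \<kappa> i) * (f i x * cnj (f i y)) * of_real (\<nu> i))"
      using I by (intro sum.cong refl) (simp add: orth if_distrib[of "\<lambda>z. _ * z"] cong: if_cong)
    also have "\<dots> = (\<Sum>i\<in>I. of_real (c i) * (f i x * cnj (f i y)))"
    proof (intro sum.cong refl)
      fix i assume i: "i \<in> I"
      show "of_real (\<kappa> i * \<kappa> i) * (f i x * cnj (f i y)) * of_real (\<nu> i) = of_real (c i) * (f i x * cnj (f i y))"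
      proof (cases "\<nu> i = 0")
        case True
        then show ?thesis using nsq_eq_0D[of d "f i"] lt \<nu>[OF i] by simp
      next
        case False
        then have "\<kappa> i * \<kappa> i * \<nu> i = c i" using c \<nu>nn i by (simp add: \<kappa>_def)
        then have "(of_real (\<kappa> i) * of_real (\<kappa> i) * of_real (\<nu> i) :: complex) = of_real (c i)"
          by (metis of_real_mult)
        then show ?thesis by (metis (no_types, lifting) mult.assoc mult.commute of_real_mult)
      qed
    qed
    finally show "(R * R) $$ (x, y) = mat d d (\<lambda>(x, y). \<Sum>i\<in>I. of_real (c i) * (f i x * cnj (f i y))) $$ (x, y)"
      using lt by simp
  qed (auto simp: R_def)
  ultimately have "psd_sqrt (mat d d (\<lambda>(x, y). \<Sum>i\<in>I. of_real (c i) * (f i x * cnj (f i y)))) = R"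
    by (rule psd_sqrt_eqI)
  moreover have "mat_trace R = (\<Sum>i\<in>I. of_real (\<kappa> i) * ip d (f i) (f i))"
    unfolding mat_trace_def R_def ip_def sum_distrib_left by (subst sum.swap) simp
  moreover have "\<dots> = of_real (\<Sum>i\<in>I. sqrt (c i * \<nu> i))"
  proof -
    have "\<kappa> i * \<nu> i = sqrt (c i * \<nu> i)" if "i \<in> I" for i
    proof -
      have "c i * \<nu> i = c i / \<nu> i * (\<nu> i)\<^sup>2" by (simp add: power2_eq_square)
      then have "sqrt (c i * \<nu> i) = sqrt (c i / \<nu> i) * sqrt ((\<nu> i)\<^sup>2)" by (simp only: real_sqrt_mult)
      then show ?thesis using \<nu>nn[OF that] by (simp add: \<kappa>_def)
    qed
    then show ?thesis by (simp add: orth of_real_mult[symmetric] del: of_real_mult)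
  qed
  ultimately show ?thesis by simp
qed

text \<open>Cholesky elimination: subtracting the rank-one matrix of the scaled last column leaves
  the Schur complement, which is again positive and one dimension smaller.\<close>

lemma psd_fun_rank_one_sum:
  "psd_fun d A \<Longrightarrow> \<exists>xs. \<forall>x<d. \<forall>y<d. A x y = (\<Sum>k\<leftarrow>xs. k x * cnj (k y))"
proof (induction d arbitrary: A)
  case 0
  then show ?case by simp
next
  case (Suc d)
  define a where "a = Re (A d d)"
  have "0 \<le> sesq (Suc d) A (\<lambda>z. if z = d then 1 else 0) (\<lambda>z. if z = d then 1 else 0)"
    using Suc.prems by (simp add: psd_fun_def)
  also have dd: "\<dots> = A d d"
    by (simp add: sesq_delta if_distrib[of "\<lambda>z. _ * z"] cong: if_cong)
  finally have a: "A d d = of_real a" "0 \<le> a"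
    by (auto simp: a_def less_eq_complex_def complex_eq_iff)
  have herm: "A y x = cnj (A x y)" if "x \<le> d" "y \<le> d" for x y
    using psd_fun_cnj[OF Suc.prems, of x y] that by simp
  have split: "sesq (Suc d) A (v(d := c)) (v(d := c)) = sesq d A v v + cnj c * (\<Sum>y<d. A d y * v y)
     + c * cnj (\<Sum>y<d. A d y * v y) + cnj c * c * of_real a" for v c
  proof -
    have "cnj (\<Sum>y<d. A d y * v y) = (\<Sum>x<d. cnj (v x) * A x d)"
      by (simp add: herm[of d] mult.commute)
    then show ?thesis
      by (simp add: sesq_def sum.distrib sum_distrib_left a algebra_simps)
  qed
  define k where "k = (\<lambda>x. A x d / of_real (sqrt a))"
  have kk: "k x * cnj (k y) = A x d * A d y / of_real a" if "x \<le> d" "y \<le> d" for x y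
  proof -
    have "(of_real (sqrt a) * of_real (sqrt a) :: complex) = of_real a"
      using a(2) by (metis of_real_mult real_sqrt_mult_self abs_of_nonneg)
    then show ?thesis by (simp add: k_def herm[of y d] that)
  qed
  have psd': "psd_fun d (\<lambda>x y. A x y - A x d * A d y / of_real a)"
    unfolding psd_fun_def
  proof
    fix v
    define s where "s = (\<Sum>y<d. A d y * v y)"
    have cs: "cnj s = (\<Sum>x<d. cnj (v x) * A x d)"
      by (simp add: s_def herm[of d] mult.commute)
    have "sesq d (\<lambda>x y. A x y - A x d * A d y / of_real a) v v = sesq d A v v - cnj s * s / of_real a"
      unfolding cs unfolding s_def sum_product sum_divide_distrib sesq_def sum_subtractf[symmetric]
      by (simp add: algebra_simps)
    \<comment> \<open>For \<open>a > 0\<close> this last coordinate minimises the form, and the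
      minimum is the form of the Schur complement. For \<open>a = 0\<close> the quotients are 0 and
      both sides reduce to the form on the first \<open>d\<close> coordinates.\<close>
    also have "\<dots> = sesq (Suc d) A (v(d := - s / of_real a)) (v(d := - s / of_real a))"
      unfolding split s_def[symmetric] by (cases "a = 0") (simp_all add: field_simps)
    finally show "0 \<le> sesq d (\<lambda>x y. A x y - A x d * A d y / of_real a) v v"
      using Suc.prems by (simp add: psd_fun_def)
  qed
  from Suc.IH[OF this] obtain xs where
    xs: "\<And>x y. \<lbrakk>x < d; y < d\<rbrakk> \<Longrightarrow> A x y - A x d * A d y / of_real a = (\<Sum>k\<leftarrow>xs. k x * cnj (k y))" by blast
  define ys where "ys = k # map (\<lambda>f. f(d := 0)) xs"
  \<comment> \<open>For \<open>a = 0\<close> the division makes \<open>k\<close> zero, which is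
    right because the last row and column then vanish.\<close>
  have zero: "A x d = 0 \<and> A d x = 0" if "a = 0" "x \<le> d" for x
  proof -
    have "A x d = 0" using psd_fun_null_apply[OF Suc.prems, of "\<lambda>z. if z = d then 1 else 0" x] dd a that
      by (simp add: if_distrib[of "\<lambda>z. _ * z"] cong: if_cong)
    then show ?thesis using herm[of x d] that by simp
  qed
  have "A x y = (\<Sum>k\<leftarrow>ys. k x * cnj (k y))" if "x < Suc d" "y < Suc d" for x y
  proof -
    have le: "x \<le> d" "y \<le> d" using that by auto
    have "(\<Sum>k\<leftarrow>ys. k x * cnj (k y)) = A x d * A d y / of_real a +
        (\<Sum>f\<leftarrow>xs. (f(d := 0)) x * cnj ((f(d := 0)) y))"
      by (simp add: ys_def comp_def kk le)
    also have "\<dots> = A x y"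
    proof (cases "x < d \<and> y < d")
      case True
      then show ?thesis by (simp flip: xs)
    next
      case False
      then have "x = d \<or> y = d" using le by auto
      moreover from this have "(\<Sum>f\<leftarrow>xs. (f(d := 0)) x * cnj ((f(d := 0)) y)) = 0"
        by (induct xs) auto
      ultimately show ?thesis using zero a le by (cases "a = 0") auto
    qed
    finally show ?thesis by simp
  qed
  then show ?case by blast
qed

section \<open>Negativity of pure states\<close>

lemma sum_lessThan_add:
  "(\<Sum>z<a + (b::nat). f z) = (\<Sum>z<a. f z) + (\<Sum>w<b. (f (a + w) :: 'a::comm_monoid_add))"
  by (induction b) (simp_all add: add.assoc)

lemma sum_split_div_mod:
  "(\<Sum>z<m * (q::nat). f z) = (\<Sum>r<m. \<Sum>w<q. (f (r * q + w) :: 'a::comm_monoid_add))"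
proof (induction m)
  case (Suc m)
  have "(\<Sum>z<Suc m * q. f z) = (\<Sum>z<m * q + q. f z)" by (simp add: add.commute)
  then show ?case by (simp only: sum_lessThan_add Suc.IH sum.lessThan_Suc)
qed simp

lemma sum_lessThan_2: "(\<Sum>i<2. f i) = f 0 + f (1::nat)"
  by (simp add: eval_nat_numeral)

lemma unit_pair_orthonormal:
  assumes st: "unit_pair s t"
  defines "E \<equiv> \<lambda>(r::nat) (i::nat). if r = 0 then (if i = 0 then cnj s else - t) else (if i = 0 then cnj t else s)"
  shows "\<lbrakk>i < 2; j < 2\<rbrakk> \<Longrightarrow> (\<Sum>r<2. cnj (E r i) * E r j) = (if i = j then 1 else 0)"
  using unit_pair_cnj[OF st]
  by (auto simp: E_def eval_nat_numeral less_Suc_eq algebra_simps)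

definition area_rows :: "nat \<Rightarrow> (nat \<Rightarrow> complex) \<Rightarrow> real" where
  "area_rows q f = area q f (\<lambda>w. f (q + w))"

text \<open>Orthogonal \<open>p 0\<close>, \<open>p 1\<close> give the Schmidt decomposition of
  \<open>\<psi>\<close>, with squared coefficients \<open>ev\<close>. The partial transpose has the
  singular values \<open>sqrt (ev i * ev j)\<close>, whose sum is
  \<open>ev 0 + ev 1 + 2 * sqrt (ev 0 * ev 1)\<close>, that is, 1 plus twice the area.\<close>

lemma negativity_pure_state:
  assumes \<psi>: "pure_state (2 * q) \<psi>"
  shows "negativity 2 q (ket_bra \<psi>) = 2 * area_rows q (\<lambda>x. \<psi> $ x)"
proof -
  define u where "u = (\<lambda>w. \<psi> $ w)"
  define v where "v = (\<lambda>w. \<psi> $ (q + w))"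
  have dim: "dim_vec \<psi> = 2 * q" and norm1: "\<psi> \<bullet>c \<psi> = 1" using \<psi> by (auto simp: pure_state_def)
  obtain s t where st: "unit_pair s t" and
    diag: "s\<^sup>2 * ip q u v - t\<^sup>2 * cnj (ip q u v) + s * t * of_real (nsq q v - nsq q u) = 0"
    using exists_diagonalizing_unit_pair by blast
  define p where "p = (\<lambda>i::nat. if i = 0 then mix s t u v else mix (- cnj t) (cnj s) u v)"
  define ev where "ev = (\<lambda>i. nsq q (p i))"
  define E where "E = (\<lambda>(r::nat) (i::nat). if r = 0 then (if i = 0 then cnj s else - t) else (if i = 0 then cnj t else s))"
  have E: "(\<Sum>r<2. cnj (E r i) * E r j) = (if i = j then 1 else 0)" if "i < 2" "j < 2" for i j
    using unit_pair_orthonormal[OF st that] by (simp add: E_def)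
  have "ip q (p 0) (p 1) = 0" using diag by (simp add: p_def ip_mix_unitary)
  then have orth: "ip q (p i) (p j) = (if i = j then of_real (ev i) else 0)" if "i < 2" "j < 2" for i j
    using that ip_cnj[of q "p 0" "p 1"] by (auto simp: less_2_cases_iff ev_def ip_self)
  have \<psi>E: "\<psi> $ (r * q + w) = (\<Sum>i<2. E r i * p i w)" if "r < 2" for r w
  proof -
    have "r = 0 \<or> r = 1" using that by auto
    then show ?thesis
      using mix_inverse[OF st, where f = u and g = v and w = w]
      by (auto simp: E_def p_def u_def v_def sum_lessThan_2)
  qed
  \<comment> \<open>Eigenvectors of \<open>Z * mat_adjoint Z\<close>: a conjugated Schmidt vector of
    the first factor times an unnormalised one of the second.\<close>
  define f where "f = (\<lambda>ij x. cnj (E (x div q) (snd ij)) * p (fst ij) (x mod q))"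
  let ?I = "{..<2::nat} \<times> {..<2::nat}"
  define Z where "Z = partial_transpose 2 q (ket_bra \<psi>)"
  have Zdim: "Z \<in> carrier_mat (2 * q) (2 * q)" by (simp add: Z_def partial_transpose_def)
  have Zent: "Z $$ (x, r * q + w) = (\<Sum>i<2. E r i * p i (x mod q)) * cnj (\<Sum>i<2. E (x div q) i * p i w)"
    if "x < 2 * q" "r < 2" "w < q" for x r w
  proof -
    have q: "0 < q" using that by simp
    have xd: "x div q < 2" using that by (simp add: less_mult_imp_div_less)
    have lt: "r' * q + w' < 2 * q" if "r' < 2" "w' < q" for r' w'
    proof -
      have "r' = 0 \<or> r' = 1" using that by auto
      then show ?thesis using that by auto
    qed
    have dm: "(r * q + w) div q = r" "(r * q + w) mod q = w" using that by simp_all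
    have "Z $$ (x, r * q + w) = ket_bra \<psi> $$ (r * q + x mod q, (x div q) * q + w)"
      unfolding Z_def partial_transpose_def using that lt[OF that(2,3)] by (simp only: index_mat split_conv dm)
    also have "\<dots> = \<psi> $ (r * q + x mod q) * cnj (\<psi> $ ((x div q) * q + w))"
      unfolding ket_bra_def dim using lt[OF that(2) mod_less_divisor[OF q]] lt[OF xd that(3)]
      by (simp only: index_mat split_conv)
    finally have "Z $$ (x, r * q + w) = \<psi> $ (r * q + x mod q) * cnj (\<psi> $ ((x div q) * q + w))" .
    then show ?thesis by (simp only: \<psi>E[OF that(2)] \<psi>E[OF xd])
  qed
  have "Z * mat_adjoint Z = mat (2 * q) (2 * q) (\<lambda>(x, y). \<Sum>ij\<in>?I. of_real (ev (snd ij)) * (f ij x * cnj (f ij y)))"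
  proof (rule eq_matI)
    fix x y assume "x < dim_row (mat (2 * q) (2 * q) (\<lambda>(x, y). \<Sum>ij\<in>?I. of_real (ev (snd ij)) * (f ij x * cnj (f ij y))))"
      "y < dim_col (mat (2 * q) (2 * q) (\<lambda>(x, y). \<Sum>ij\<in>?I. of_real (ev (snd ij)) * (f ij x * cnj (f ij y))))"
    then have x: "x < 2 * q" and y: "y < 2 * q" by auto
    have "(Z * mat_adjoint Z) $$ (x, y) = (\<Sum>z<2 * q. Z $$ (x, z) * cnj (Z $$ (y, z)))"
      using x y Zdim by (simp add: mat_adjoint_def mat_of_rows_def scalar_prod_def atLeast0LessThan)
    also have "\<dots> = (\<Sum>r<2. \<Sum>w<q. (\<Sum>i<2. E r i * p i (x mod q)) * cnj (\<Sum>i<2. E (x div q) i * p i w)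
        * cnj ((\<Sum>i<2. E r i * p i (y mod q)) * cnj (\<Sum>i<2. E (y div q) i * p i w)))"
      unfolding sum_split_div_mod using x y by (intro sum.cong refl) (simp only: lessThan_iff Zent)
    also have "\<dots> = (\<Sum>r<2. (\<Sum>i<2. E r i * p i (x mod q)) * cnj (\<Sum>i<2. E r i * p i (y mod q)))
        * (\<Sum>w<q. cnj (\<Sum>i<2. E (x div q) i * p i w) * (\<Sum>i<2. E (y div q) i * p i w))"
      unfolding sum_product by (intro sum.cong refl) (simp add: mult_ac)
    also have "(\<Sum>r<2. (\<Sum>i<2. E r i * p i (x mod q)) * cnj (\<Sum>i<2. E r i * p i (y mod q)))
        = (\<Sum>i<2. p i (x mod q) * cnj (p i (y mod q)))"
    proof -
      have "(\<Sum>r<2. (\<Sum>i<2. E r i * p i (x mod q)) * cnj (\<Sum>i<2. E r i * p i (y mod q)))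
        = (\<Sum>r<2. \<Sum>i<2. \<Sum>j<2. (cnj (E r j) * E r i) * (p i (x mod q) * cnj (p j (y mod q))))"
        unfolding cnj_sum sum_product by (intro sum.cong refl) (simp add: mult_ac)
      also have "\<dots> = (\<Sum>i<2. \<Sum>j<2. (\<Sum>r<2. cnj (E r j) * E r i) * (p i (x mod q) * cnj (p j (y mod q))))"
        unfolding sum_distrib_right by (subst sum.swap) (intro sum.cong refl sum.swap)
      also have "\<dots> = (\<Sum>i<2. \<Sum>j<2. if j = i then p i (x mod q) * cnj (p j (y mod q)) else 0)"
        by (intro sum.cong refl) (simp add: E)
      finally show ?thesis by simp
    qed
    also have "(\<Sum>w<q. cnj (\<Sum>i<2. E (x div q) i * p i w) * (\<Sum>i<2. E (y div q) i * p i w))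
        = (\<Sum>j<2. of_real (ev j) * (cnj (E (x div q) j) * E (y div q) j))"
    proof -
      have "(\<Sum>w<q. cnj (\<Sum>i<2. E (x div q) i * p i w) * (\<Sum>i<2. E (y div q) i * p i w))
        = (\<Sum>w<q. \<Sum>i<2. \<Sum>j<2. (cnj (E (x div q) i) * E (y div q) j) * (p j w * cnj (p i w)))"
        unfolding cnj_sum sum_product by (intro sum.cong refl) (simp add: mult_ac)
      also have "\<dots> = (\<Sum>i<2. \<Sum>j<2. (cnj (E (x div q) i) * E (y div q) j) * ip q (p j) (p i))"
        unfolding ip_def sum_distrib_left by (subst sum.swap) (intro sum.cong refl sum.swap)
      also have "\<dots> = (\<Sum>i<2. \<Sum>j<2. if j = i then (cnj (E (x div q) i) * E (y div q) j) * of_real (ev j) else 0)"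
        by (intro sum.cong refl) (simp add: orth)
      finally show ?thesis by (simp add: mult_ac)
    qed
    also have "(\<Sum>i<2. p i (x mod q) * cnj (p i (y mod q))) * (\<Sum>j<2. of_real (ev j) * (cnj (E (x div q) j) * E (y div q) j))
      = (\<Sum>ij\<in>?I. of_real (ev (snd ij)) * (f ij x * cnj (f ij y)))"
      unfolding sum_product sum.cartesian_product
      by (intro sum.cong refl) (auto simp: f_def mult_ac)
    finally show "(Z * mat_adjoint Z) $$ (x, y)
      = mat (2 * q) (2 * q) (\<lambda>(x, y). \<Sum>ij\<in>?I. of_real (ev (snd ij)) * (f ij x * cnj (f ij y))) $$ (x, y)"
      using x y by simp
  qed (use Zdim in \<open>auto simp: mat_adjoint_def\<close>)
  moreover have "ip (2 * q) (f a) (f b) = (if a = b then of_real (ev (fst a)) else 0)" if "a \<in> ?I" "b \<in> ?I" for a b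
  proof -
    have ab: "fst a < 2" "snd a < 2" "fst b < 2" "snd b < 2" using that by auto
    have "ip (2 * q) (f a) (f b) = (\<Sum>r<2. \<Sum>w<q. (cnj (E r (snd a)) * E r (snd b)) * (p (fst a) w * cnj (p (fst b) w)))"
      unfolding ip_def sum_split_div_mod by (intro sum.cong refl) (simp add: f_def mult_ac)
    also have "\<dots> = (\<Sum>r<2. cnj (E r (snd a)) * E r (snd b)) * ip q (p (fst a)) (p (fst b))"
      unfolding ip_def sum_product ..
    also have "\<dots> = (if a = b then of_real (ev (fst a)) else 0)"
      using ab by (simp add: E orth prod_eq_iff)
    finally show ?thesis .
  qed
  ultimately have "mat_trace (psd_sqrt (Z * mat_adjoint Z)) = of_real (\<Sum>ij\<in>?I. sqrt (ev (snd ij) * ev (fst ij)))"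
    using mat_trace_psd_sqrt_orthogonal[of ?I "\<lambda>ij. ev (snd ij)" "2 * q" f "\<lambda>ij. ev (fst ij)"]
    by (simp add: ev_def)
  then have "trace_norm Z = (\<Sum>i<2. \<Sum>j<2. sqrt (ev j * ev i))"
    by (simp add: trace_norm_def sum.cartesian_product case_prod_beta)
  also have "\<dots> = ev 0 + ev 1 + 2 * sqrt (ev 0 * ev 1)"
    by (simp add: eval_nat_numeral ev_def mult.commute)
  also have "ev 0 + ev 1 = 1"
  proof -
    have "ev 0 + ev 1 = ((cmod s)\<^sup>2 + (cmod t)\<^sup>2) * (nsq q u + nsq q v)"
      unfolding ev_def p_def by (simp add: nsq_mix algebra_simps)
    also have "\<dots> = nsq q u + nsq q v" using st by (simp add: unit_pair_def)
    also have "complex_of_real (nsq q u + nsq q v) = \<psi> \<bullet>c \<psi>"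
    proof -
      have "\<psi> \<bullet>c \<psi> = (\<Sum>x<2 * q. \<psi> $ x * cnj (\<psi> $ x))"
        by (simp add: scalar_prod_def dim atLeast0LessThan)
      also have "\<dots> = ip q u u + ip q v v"
        unfolding sum_split_div_mod by (simp add: ip_def u_def v_def eval_nat_numeral)
      finally show ?thesis by (simp add: ip_self)
    qed
    then have "nsq q u + nsq q v = 1" using norm1 by (metis of_real_1 of_real_eq_iff)
    finally show ?thesis .
  qed
  also have "sqrt (ev 0 * ev 1) = area q u v"
    using area_unitary[OF st, of q u v] \<open>ip q (p 0) (p 1) = 0\<close>
    by (simp add: area_def[of q "mix s t u v"] gram_det_def p_def ev_def)
  finally show ?thesis
    by (simp add: negativity_def Z_def area_rows_def u_def v_def)
qed

section \<open>The convex roof as an infimum over unnormalised ensembles\<close>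

text \<open>Probabilities are absorbed into the lengths of the vectors, consistently with the
  quadratic scaling of \<open>area_rows\<close>. With lists, joining ensembles is
  concatenation.\<close>

definition represents :: "nat \<Rightarrow> complex mat \<Rightarrow> (nat \<Rightarrow> complex) list \<Rightarrow> bool" where
  "represents d \<sigma> xs \<longleftrightarrow> \<sigma> \<in> carrier_mat d d \<and> (\<forall>x<d. \<forall>y<d. \<sigma> $$ (x, y) = (\<Sum>k\<leftarrow>xs. k x * cnj (k y)))"

definition cost :: "nat \<Rightarrow> (nat \<Rightarrow> complex) list \<Rightarrow> real" where
  "cost q xs = (\<Sum>k\<leftarrow>xs. 2 * area_rows q k)"

lemma area_rows_nonneg [simp]: "0 \<le> area_rows q k"
  by (simp add: area_rows_def)

lemma cost_nonneg: "0 \<le> cost q xs"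
  unfolding cost_def by (rule sum_list_nonneg) auto

lemma area_rows_cong: "(\<And>x. x < 2 * q \<Longrightarrow> f x = g x) \<Longrightarrow> area_rows q f = area_rows q g"
  unfolding area_rows_def by (rule area_cong) auto

lemma area_rows_scale: "area_rows q (\<lambda>x. of_real c * k x) = c\<^sup>2 * area_rows q k"
  using area_mix_scale[of q c 1 0 k k "\<lambda>w. k (q + w)" "\<lambda>w. k (q + w)"]
  by (simp add: area_rows_def mix_def)

lemma psd_represents: "psd d A \<Longrightarrow> \<exists>xs. represents d A xs"
  using psd_fun_rank_one_sum[of d "\<lambda>x y. A $$ (x, y)"] psd_iff_psd_fun[of A d]
  by (auto simp: represents_def psd_def)

lemma represents_sum_nsq:
  assumes "represents d \<sigma> xs"
  shows "mat_trace \<sigma> = of_real (\<Sum>k\<leftarrow>xs. nsq d k)"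
proof -
  have "mat_trace \<sigma> = (\<Sum>x<d. \<Sum>k\<leftarrow>xs. k x * cnj (k x))"
    using assms unfolding mat_trace_def represents_def by (intro sum.cong) auto
  also have "\<dots> = (\<Sum>k\<leftarrow>xs. ip d k k)"
    by (simp add: ip_def sum_list_sum_swap)
  also have "\<dots> = of_real (\<Sum>k\<leftarrow>xs. nsq d k)"
    unfolding ip_self by (induction xs) auto
  finally show ?thesis .
qed

lemma sum_list_nth: "(\<Sum>k\<leftarrow>xs. f k) = (\<Sum>i<length xs. (f (xs ! i) :: 'a::comm_monoid_add))"
  by (simp add: sum_list_sum_nth atLeast0LessThan)

lemma cren_eq_Inf_cost:
  assumes q: "0 < q" and tr: "mat_trace \<sigma> = 1"
  shows "cren 2 q \<sigma> = Inf {cost q xs | xs. represents (2 * q) \<sigma> xs}"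
proof -
  have "{\<Sum>i<n. p i * negativity 2 q (ket_bra (\<psi> i)) | n p \<psi>. pure_decomposition (2 * q) \<sigma> n p \<psi>}
      = {cost q xs | xs. represents (2 * q) \<sigma> xs}" (is "?A = ?B")
  proof (intro equalityI subsetI)
    fix v assume "v \<in> ?A"
    then obtain n p \<psi> where v: "v = (\<Sum>i<n. p i * negativity 2 q (ket_bra (\<psi> i)))"
      and dec: "pure_decomposition (2 * q) \<sigma> n p \<psi>" by blast
    have p: "0 \<le> p i" and \<psi>: "pure_state (2 * q) (\<psi> i)" if "i < n" for i
      using dec that by (auto simp: pure_decomposition_def)
    define xs where "xs = map (\<lambda>i x. of_real (sqrt (p i)) * \<psi> i $ x) [0..<n]"
    have "represents (2 * q) \<sigma> xs"
      unfolding represents_def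
    proof (intro conjI allI impI)
      show "\<sigma> \<in> carrier_mat (2 * q) (2 * q)" using dec by (auto simp: pure_decomposition_def)
      fix x y assume xy: "x < 2 * q" "y < 2 * q"
      have "\<sigma> = mat (2 * q) (2 * q) (\<lambda>xy. \<Sum>i<n. complex_of_real (p i) * ket_bra (\<psi> i) $$ xy)"
        using dec by (simp add: pure_decomposition_def)
      then have "\<sigma> $$ (x, y) = (\<Sum>i<n. of_real (p i) * ket_bra (\<psi> i) $$ (x, y))"
        using xy by simp
      also have "\<dots> = (\<Sum>i<n. of_real (sqrt (p i)) * \<psi> i $ x * cnj (of_real (sqrt (p i)) * \<psi> i $ y))"
      proof (intro sum.cong refl)
        fix i assume i: "i \<in> {..<n}"
        have "(of_real (sqrt (p i)) * of_real (sqrt (p i)) :: complex) = of_real (p i)"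
          unfolding of_real_mult[symmetric] using p i by simp
        moreover have "dim_vec (\<psi> i) = 2 * q" using \<psi> i by (auto simp: pure_state_def)
        ultimately show "of_real (p i) * ket_bra (\<psi> i) $$ (x, y)
          = of_real (sqrt (p i)) * \<psi> i $ x * cnj (of_real (sqrt (p i)) * \<psi> i $ y)"
          using xy by (simp add: ket_bra_def mult_ac)
      qed
      also have "\<dots> = (\<Sum>k\<leftarrow>xs. k x * cnj (k y))" by (simp add: xs_def comp_def sum_list_upt)
      finally show "\<sigma> $$ (x, y) = (\<Sum>k\<leftarrow>xs. k x * cnj (k y))" .
    qed
    moreover have "v = cost q xs"
      unfolding v cost_def xs_def using p \<psi>
      by (simp add: comp_def sum_list_upt area_rows_scale negativity_pure_state mult.left_commute)
    ultimately show "v \<in> ?B" by blast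
  next
    fix v assume "v \<in> ?B"
    then obtain xs where v: "v = cost q xs" and rep: "represents (2 * q) \<sigma> xs" by blast
    define p where "p = (\<lambda>i. nsq (2 * q) (xs ! i))"
    \<comment> \<open>A zero vector carries weight 0, so any state may replace it;
      \<open>0 < q\<close> provides one.\<close>
    define \<psi> where "\<psi> = (\<lambda>i. if p i = 0 then unit_vec (2 * q) 0 else vec (2 * q) (\<lambda>x. (xs ! i) x / of_real (sqrt (p i))))"
    have p: "0 \<le> p i" for i by (simp add: p_def)
    have \<psi>: "pure_state (2 * q) (\<psi> i)" for i
    proof (cases "p i = 0")
      case True
      have "unit_vec (2 * q) 0 \<bullet>c unit_vec (2 * q) 0 = (1 :: complex)"
        by (subst scalar_prod_left_unit[of _ "2 * q"]) (use q in auto)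
      then show ?thesis using True by (simp add: pure_state_def \<psi>_def)
    next
      case False
      have "\<psi> i \<bullet>c \<psi> i = (\<Sum>x<2 * q. (xs ! i) x / of_real (sqrt (p i)) * cnj ((xs ! i) x / of_real (sqrt (p i))))"
        using False by (simp add: \<psi>_def scalar_prod_def atLeast0LessThan)
      also have "\<dots> = (\<Sum>x<2 * q. (xs ! i) x * cnj ((xs ! i) x)) / (of_real (sqrt (p i)) * of_real (sqrt (p i)))"
        by (simp add: sum_divide_distrib)
      also have "\<dots> = of_real (p i) / of_real (p i)"
        unfolding of_real_mult[symmetric] using p[of i] by (simp add: ip_def[symmetric] ip_self p_def)
      finally show ?thesis using False by (simp add: pure_state_def \<psi>_def)
    qed
    have scale: "(xs ! i) x = of_real (sqrt (p i)) * \<psi> i $ x" if "x < 2 * q" for i x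
      using that nsq_eq_0D[of "2 * q" "xs ! i" x] p[of i] by (auto simp: \<psi>_def p_def)
    have "pure_decomposition (2 * q) \<sigma> (length xs) p \<psi>"
      unfolding pure_decomposition_def
    proof (intro conjI allI impI)
      show "0 \<le> p i" "pure_state (2 * q) (\<psi> i)" for i by fact+
      have "of_real (\<Sum>k\<leftarrow>xs. nsq (2 * q) k) = (1 :: complex)"
        using represents_sum_nsq[OF rep] tr by simp
      then have "(\<Sum>k\<leftarrow>xs. nsq (2 * q) k) = 1" by (metis of_real_1 of_real_eq_iff)
      then show "(\<Sum>i<length xs. p i) = 1" by (simp add: sum_list_nth p_def)
      show "\<sigma> = mat (2 * q) (2 * q) (\<lambda>xy. \<Sum>i<length xs. complex_of_real (p i) * ket_bra (\<psi> i) $$ xy)" (is "_ = ?M")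
      proof (rule eq_matI)
        fix x y assume "x < dim_row ?M" "y < dim_col ?M"
        then have xy: "x < 2 * q" "y < 2 * q" by auto
        have "\<sigma> $$ (x, y) = (\<Sum>i<length xs. (xs ! i) x * cnj ((xs ! i) y))"
          using rep xy by (simp add: represents_def sum_list_nth)
        also have "\<dots> = (\<Sum>i<length xs. of_real (p i) * ket_bra (\<psi> i) $$ (x, y))"
        proof (intro sum.cong refl)
          fix i
          have "(of_real (sqrt (p i)) * of_real (sqrt (p i)) :: complex) = of_real (p i)"
            unfolding of_real_mult[symmetric] using p by simp
          moreover have "dim_vec (\<psi> i) = 2 * q" by (simp add: \<psi>_def)
          ultimately show "(xs ! i) x * cnj ((xs ! i) y) = of_real (p i) * ket_bra (\<psi> i) $$ (x, y)"
            using xy by (simp add: scale ket_bra_def mult_ac)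
        qed
        finally show "\<sigma> $$ (x, y) = ?M $$ (x, y)" using xy by simp
      qed (use rep in \<open>auto simp: represents_def\<close>)
    qed
    moreover have "v = (\<Sum>i<length xs. p i * negativity 2 q (ket_bra (\<psi> i)))"
    proof -
      have "area_rows q (xs ! i) = p i * area_rows q (\<lambda>x. \<psi> i $ x)" for i
        using area_rows_cong[of q "xs ! i" "\<lambda>x. of_real (sqrt (p i)) * \<psi> i $ x"] scale p[of i]
        by (simp add: area_rows_scale)
      then show ?thesis
        unfolding v cost_def sum_list_nth by (simp add: negativity_pure_state[OF \<psi>] mult_ac)
    qed
    ultimately show "v \<in> ?A" by blast
  qed
  then show ?thesis by (simp add: cren_def)
qed

lemma cren_le_cost:
  assumes "0 < q" "mat_trace \<sigma> = 1" "represents (2 * q) \<sigma> xs"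
  shows "cren 2 q \<sigma> \<le> cost q xs"
  unfolding cren_eq_Inf_cost[OF assms(1,2)]
  using assms(3) cost_nonneg by (intro cInf_lower bdd_belowI[of _ 0]) blast+

text \<open>Ensembles approach the infimum as closely as desired, which makes attainment irrelevant;
  \<open>ys\<close> shows that the set is not empty.\<close>

lemma cren_less_obtains:
  assumes "0 < q" "mat_trace \<sigma> = 1" "represents (2 * q) \<sigma> ys" "cren 2 q \<sigma> < c"
  obtains xs where "represents (2 * q) \<sigma> xs" "cost q xs < c"
  using cInf_lessD[of "{cost q xs | xs. represents (2 * q) \<sigma> xs}" c] assms
  unfolding cren_eq_Inf_cost[OF assms(1,2)] by blast

lemma cren_nonneg:
  assumes "0 < q" "mat_trace \<sigma> = 1" "represents (2 * q) \<sigma> ys"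
  shows "0 \<le> cren 2 q \<sigma>"
  unfolding cren_eq_Inf_cost[OF assms(1,2)]
  using assms(3) cost_nonneg by (intro cInf_greatest) blast+

section \<open>Partial traces and ensembles\<close>

lemma partial_trace_index:
  "\<lbrakk>x < 2 * q; y < 2 * q\<rbrakk> \<Longrightarrow> partial_trace_2_4 p q r \<rho> $$ (x, y) = (\<Sum>u<p. \<Sum>v<r.
     \<rho> $$ ((((x div q) * p + u) * q + x mod q) * r + v, (((y div q) * p + u) * q + y mod q) * r + v))"
  by (simp add: partial_trace_2_4_def)

lemma partial_trace_carrier: "partial_trace_2_4 p q r \<rho> \<in> carrier_mat (2 * q) (2 * q)"
  by (simp add: partial_trace_2_4_def)

lemma mult_add_less: "a < m \<Longrightarrow> b < n \<Longrightarrow> a * n + b < m * (n :: nat)"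
proof -
  assume "a < m" "b < n"
  then have "a * n + b < Suc a * n" by simp
  also have "\<dots> \<le> m * n" using \<open>a < m\<close> by (intro mult_le_mono1) simp
  finally show ?thesis .
qed

lemma mat_trace_partial_trace:
  assumes "dim_row \<rho> = 2 * p * q * r"
  shows "mat_trace (partial_trace_2_4 p q r \<rho>) = mat_trace \<rho>"
proof -
  have "mat_trace (partial_trace_2_4 p q r \<rho>) = (\<Sum>a<2. \<Sum>b<q. \<Sum>u<p. \<Sum>v<r.
     \<rho> $$ ((((a * p + u) * q + b) * r + v), (((a * p + u) * q + b) * r + v)))"
    unfolding mat_trace_def using partial_trace_carrier[of p q r \<rho>]
    by (simp add: sum_split_div_mod partial_trace_index mult_add_less)
  also have "\<dots> = (\<Sum>a<2. \<Sum>u<p. \<Sum>b<q. \<Sum>v<r.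
     \<rho> $$ ((((a * p + u) * q + b) * r + v), (((a * p + u) * q + b) * r + v)))"
    by (intro sum.cong refl sum.swap)
  also have "\<dots> = mat_trace \<rho>"
    unfolding mat_trace_def assms by (simp add: sum_split_div_mod)
  finally show ?thesis .
qed

lemma sum_list_concat_map: "(\<Sum>k\<leftarrow>concat (map g xs). f k) = (\<Sum>x\<leftarrow>xs. \<Sum>k\<leftarrow>g x. (f k :: 'a::comm_monoid_add))"
  by (induction xs) simp_all

lemma partial_trace_bounds:
  assumes "x < 2 * q" "u < p" "v < r"
  shows "(((x div q) * p + u) * q + x mod q) * r + v < 2 * p * q * (r::nat)"
proof -
  have "0 < q" using assms by (cases q) auto
  then have "x div q < 2" "x mod q < q" using assms by (auto simp: less_mult_imp_div_less)
  then show ?thesis using assms by (intro mult_add_less)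
qed

text \<open>Tracing out a factor amounts to measuring it: every vector is split into its components
  along the traced basis states.\<close>

lemma represents_partial_trace:
  assumes "represents (2 * p * q * r) \<rho> xs"
  shows "\<exists>ys. represents (2 * q) (partial_trace_2_4 p q r \<rho>) ys"
proof -
  define ys where "ys = concat (map (\<lambda>k. concat (map (\<lambda>u. map (\<lambda>v x. k ((((x div q) * p + u) * q + x mod q) * r + v)) [0..<r]) [0..<p])) xs)"
  have "partial_trace_2_4 p q r \<rho> $$ (x, y) = (\<Sum>k\<leftarrow>ys. k x * cnj (k y))" if xy: "x < 2 * q" "y < 2 * q" for x y
  proof -
    have "partial_trace_2_4 p q r \<rho> $$ (x, y) = (\<Sum>u<p. \<Sum>v<r. \<Sum>k\<leftarrow>xs.
        k ((((x div q) * p + u) * q + x mod q) * r + v) * cnj (k ((((y div q) * p + u) * q + y mod q) * r + v)))"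
      unfolding partial_trace_index[OF xy]
      using assms xy by (intro sum.cong refl) (simp add: represents_def partial_trace_bounds)
    also have "\<dots> = (\<Sum>k\<leftarrow>xs. \<Sum>u<p. \<Sum>v<r.
        k ((((x div q) * p + u) * q + x mod q) * r + v) * cnj (k ((((y div q) * p + u) * q + y mod q) * r + v)))"
      by (simp only: sum_list_sum_swap)
    also have "\<dots> = (\<Sum>k\<leftarrow>ys. k x * cnj (k y))"
      by (simp add: ys_def sum_list_concat_map comp_def sum_list_upt)
    finally show ?thesis .
  qed
  then show ?thesis using partial_trace_carrier unfolding represents_def by blast
qed

section \<open>Monogamy\<close>

text \<open>One monogamy step starts from the state of \<open>A B C\<close>. This identity and the
  next one recognise its two reductions as reductions of the full state.\<close>

lemma partial_trace_AB:
  "partial_trace_2_4 1 2 q (partial_trace_2_4 p (2 * q) 1 \<rho>) = partial_trace_2_4 p 2 q \<rho>"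
proof (rule eq_matI)
  fix x y assume "x < dim_row (partial_trace_2_4 p 2 q \<rho>)" "y < dim_col (partial_trace_2_4 p 2 q \<rho>)"
  then have xy: "x < 2 * 2" "y < 2 * 2" by (simp_all add: partial_trace_2_4_def)
  have idx: "x' * q + v < 2 * (2 * q)" "(x' * q + v) div (2 * q) = x' div 2" "(x' * q + v) mod (2 * q) = x' mod 2 * q + v"
    if "x' < 2 * 2" "v < q" for x' v
  proof -
    show "x' * q + v < 2 * (2 * q)" using mult_add_less[OF that] by simp
    have lt: "x' mod 2 * q + v < 2 * q" using that by (intro mult_add_less) simp_all
    have "x' * q + v = (x' div 2 * 2 + x' mod 2) * q + v" by (simp only: div_mult_mod_eq)
    also have "\<dots> = x' div 2 * (2 * q) + (x' mod 2 * q + v)" by (simp only: distrib_right mult.assoc add.assoc)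
    finally have eq: "x' * q + v = x' div 2 * (2 * q) + (x' mod 2 * q + v)" .
    show "(x' * q + v) div (2 * q) = x' div 2" "(x' * q + v) mod (2 * q) = x' mod 2 * q + v"
      unfolding eq using lt by simp_all
  qed
  have "partial_trace_2_4 1 2 q (partial_trace_2_4 p (2 * q) 1 \<rho>) $$ (x, y)
    = (\<Sum>v<q. partial_trace_2_4 p (2 * q) 1 \<rho> $$ (x * q + v, y * q + v))"
    unfolding partial_trace_index[OF xy] by simp
  also have "\<dots> = (\<Sum>v<q. \<Sum>u<p. \<rho> $$ ((x div 2 * p + u) * (2 * q) + (x mod 2 * q + v), (y div 2 * p + u) * (2 * q) + (y mod 2 * q + v)))"
  proof (intro sum.cong refl)
    fix v assume "v \<in> {..<q}"
    then have v: "v < q" by simp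
    show "partial_trace_2_4 p (2 * q) 1 \<rho> $$ (x * q + v, y * q + v)
      = (\<Sum>u<p. \<rho> $$ ((x div 2 * p + u) * (2 * q) + (x mod 2 * q + v), (y div 2 * p + u) * (2 * q) + (y mod 2 * q + v)))"
      unfolding partial_trace_index[OF idx(1)[OF xy(1) v] idx(1)[OF xy(2) v]]
        idx(2)[OF xy(1) v] idx(2)[OF xy(2) v] idx(3)[OF xy(1) v] idx(3)[OF xy(2) v] by simp
  qed
  also have "\<dots> = (\<Sum>u<p. \<Sum>v<q. \<rho> $$ ((x div 2 * p + u) * (2 * q) + (x mod 2 * q + v), (y div 2 * p + u) * (2 * q) + (y mod 2 * q + v)))"
    by (rule sum.swap)
  also have "\<dots> = partial_trace_2_4 p 2 q \<rho> $$ (x, y)"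
    unfolding partial_trace_index[OF xy]
    by (intro sum.cong refl arg_cong[where f = "\<lambda>ij. \<rho> $$ ij"]) (simp add: algebra_simps)
  finally show "partial_trace_2_4 1 2 q (partial_trace_2_4 p (2 * q) 1 \<rho>) $$ (x, y) = partial_trace_2_4 p 2 q \<rho> $$ (x, y)" .
qed (simp_all add: partial_trace_2_4_def)

lemma partial_trace_AC:
  "partial_trace_2_4 2 q 1 (partial_trace_2_4 p (2 * q) 1 \<rho>) = partial_trace_2_4 (p * 2) q 1 \<rho>"
proof (rule eq_matI)
  fix x y assume "x < dim_row (partial_trace_2_4 (p * 2) q 1 \<rho>)" "y < dim_col (partial_trace_2_4 (p * 2) q 1 \<rho>)"
  then have xy: "x < 2 * q" "y < 2 * q" by (simp_all add: partial_trace_2_4_def)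
  have idx: "(x' div q * 2 + u) * q + x' mod q < 2 * (2 * q)"
      "((x' div q * 2 + u) * q + x' mod q) div (2 * q) = x' div q"
      "((x' div q * 2 + u) * q + x' mod q) mod (2 * q) = u * q + x' mod q"
    if "x' < 2 * q" "u < 2" for x' u
  proof -
    have "0 < q" using that by (cases q) auto
    then have xd: "x' div q < 2" "x' mod q < q" using that by (auto simp: less_mult_imp_div_less)
    have lt: "u * q + x' mod q < 2 * q" using that xd by (intro mult_add_less)
    have eq: "(x' div q * 2 + u) * q + x' mod q = x' div q * (2 * q) + (u * q + x' mod q)" by (simp add: algebra_simps)
    show "(x' div q * 2 + u) * q + x' mod q < 2 * (2 * q)"
      unfolding eq using xd(1) lt by (rule mult_add_less)
    show "((x' div q * 2 + u) * q + x' mod q) div (2 * q) = x' div q"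
      "((x' div q * 2 + u) * q + x' mod q) mod (2 * q) = u * q + x' mod q"
      unfolding eq using lt by simp_all
  qed
  have "partial_trace_2_4 2 q 1 (partial_trace_2_4 p (2 * q) 1 \<rho>) $$ (x, y)
    = (\<Sum>u<2. partial_trace_2_4 p (2 * q) 1 \<rho> $$ ((x div q * 2 + u) * q + x mod q, (y div q * 2 + u) * q + y mod q))"
    unfolding partial_trace_index[OF xy] by simp
  also have "\<dots> = (\<Sum>u<2. \<Sum>t<p. \<rho> $$ ((x div q * p + t) * (2 * q) + (u * q + x mod q), (y div q * p + t) * (2 * q) + (u * q + y mod q)))"
  proof (intro sum.cong refl)
    fix u :: nat assume "u \<in> {..<2}"
    then have u: "u < 2" by simp
    show "partial_trace_2_4 p (2 * q) 1 \<rho> $$ ((x div q * 2 + u) * q + x mod q, (y div q * 2 + u) * q + y mod q)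
      = (\<Sum>t<p. \<rho> $$ ((x div q * p + t) * (2 * q) + (u * q + x mod q), (y div q * p + t) * (2 * q) + (u * q + y mod q)))"
      unfolding partial_trace_index[OF idx(1)[OF xy(1) u] idx(1)[OF xy(2) u]]
        idx(2)[OF xy(1) u] idx(2)[OF xy(2) u] idx(3)[OF xy(1) u] idx(3)[OF xy(2) u] by simp
  qed
  also have "\<dots> = (\<Sum>t<p. \<Sum>u<2. \<rho> $$ ((x div q * p + t) * (2 * q) + (u * q + x mod q), (y div q * p + t) * (2 * q) + (u * q + y mod q)))"
    by (rule sum.swap)
  also have "\<dots> = partial_trace_2_4 (p * 2) q 1 \<rho> $$ (x, y)"
    unfolding partial_trace_index[OF xy] sum_split_div_mod
    by (intro sum.cong refl) (simp add: algebra_simps)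
  finally show "partial_trace_2_4 2 q 1 (partial_trace_2_4 p (2 * q) 1 \<rho>) $$ (x, y) = partial_trace_2_4 (p * 2) q 1 \<rho> $$ (x, y)" .
qed (simp_all add: partial_trace_2_4_def)

text \<open>Lagrange's identity for two vectors of length 2; it turns the total in
  \<open>pair_bound\<close> into a cost.\<close>

lemma area_rows_2: "area_rows 2 k = cmod (k 0 * k 3 - k 1 * k 2)"
proof -
  have "gram_det (nsq 2 k) (nsq 2 (\<lambda>w. k (2 + w))) (ip 2 k (\<lambda>w. k (2 + w))) = (cmod (k 0 * k 3 - k 1 * k 2))\<^sup>2"
    unfolding gram_det_def nsq_def ip_def sum_lessThan_2 cmod_power2
    by (simp add: numeral_3_eq_3 numeral_2_eq_2 power2_eq_square algebra_simps)
  then show ?thesis by (simp add: area_rows_def area_def)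
qed

definition slices :: "nat \<Rightarrow> (nat \<Rightarrow> complex) \<Rightarrow> nat \<Rightarrow> nat \<Rightarrow> complex" where
  "slices q k x w = k (x * q + w)"

lemma area_rows_det_A: "area_rows (2 * q) k = sqrt (det_A q (slices q k))"
proof -
  have n: "nsq (2 * q) f = nsq q f + nsq q (\<lambda>w. f (q + w))" for f
    unfolding mult_2 nsq_def sum_lessThan_add ..
  have i: "ip (2 * q) f g = ip q f g + ip q (\<lambda>w. f (q + w)) (\<lambda>w. g (q + w))" for f g
    unfolding mult_2 ip_def sum_lessThan_add ..
  show ?thesis
    unfolding area_rows_def area_def det_A_def n i
    by (simp add: slices_def[abs_def] numeral_3_eq_3 add.assoc)
qed

text \<open>\<open>as\<close> and \<open>bs\<close> are ensembles of the reductions of \<open>|k\<rangle>\<langle>k|\<close> to \<open>A B\<close> and to \<open>A C\<close>.\<close>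

definition splits :: "nat \<Rightarrow> (nat \<Rightarrow> complex) \<Rightarrow> (nat \<Rightarrow> complex) list \<Rightarrow> (nat \<Rightarrow> complex) list \<Rightarrow> bool" where
  "splits q k as bs \<longleftrightarrow>
    (\<forall>x<4. \<forall>y<4. (\<Sum>v<q. k (x * q + v) * cnj (k (y * q + v))) = (\<Sum>f\<leftarrow>as. f x * cnj (f y))) \<and>
    (\<forall>x<2 * q. \<forall>y<2 * q. (\<Sum>u<2. k ((x div q * 2 + u) * q + x mod q) * cnj (k ((y div q * 2 + u) * q + y mod q)))
        = (\<Sum>f\<leftarrow>bs. f x * cnj (f y))) \<and>
    (cost 2 as)\<^sup>2 + (cost q bs)\<^sup>2 \<le> (2 * area_rows (2 * q) k)\<^sup>2"

lemma pure_ensembles: "\<exists>as bs. splits q k as bs"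
proof -
  define V where "V = slices q k"
  obtain s t where st: "unit_pair s t" and le: "(area_B q (mix_B s t V))\<^sup>2 \<le> det_A q V"
    and pb: "pair_bound q V (sqrt (det_A q V - (area_B q (mix_B s t V))\<^sup>2))"
    using pure_state_monogamy by blast
  define W where "W = mix_B s t V"
  obtain as where as: "\<forall>x<4. \<forall>y<4. ip q (V x) (V y) = (\<Sum>f\<leftarrow>as. f x * cnj (f y))"
    and as_le: "(\<Sum>f\<leftarrow>as. cmod (f 0 * f 3 - f 1 * f (2::nat))) \<le> sqrt (det_A q V - (area_B q W)\<^sup>2)"
    using pb unfolding pair_bound_def W_def by blast
  \<comment> \<open>The two outcomes of measuring \<open>B\<close> in the basis \<open>s, t\<close>;
    row \<open>a\<close> of outcome \<open>b\<close> is \<open>W (2 * a + b)\<close>.\<close>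
  define bs where "bs = [\<lambda>x. W (x div q * 2) (x mod q), \<lambda>x. W (x div q * 2 + 1) (x mod q)]"
  have "(\<Sum>v<q. k (x * q + v) * cnj (k (y * q + v))) = (\<Sum>f\<leftarrow>as. f x * cnj (f y))" if "x < 4" "y < 4" for x y
    using as that by (simp add: ip_def V_def slices_def)
  moreover have "(\<Sum>u<2. k ((x div q * 2 + u) * q + x mod q) * cnj (k ((y div q * 2 + u) * q + y mod q)))
        = (\<Sum>f\<leftarrow>bs. f x * cnj (f y))" if "x < 2 * q" "y < 2 * q" for x y
  proof -
    have uni: "mix s t f g w * cnj (mix s t h l z) + mix (- cnj t) (cnj s) f g w * cnj (mix (- cnj t) (cnj s) h l z)
       = f w * cnj (h z) + g w * cnj (l z)" for f g h l :: "nat \<Rightarrow> complex" and w z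
    proof -
      have "mix s t f g w * cnj (mix s t h l z) + mix (- cnj t) (cnj s) f g w * cnj (mix (- cnj t) (cnj s) h l z)
       = (s * cnj s + t * cnj t) * (f w * cnj (h z) + g w * cnj (l z))"
        by (simp add: mix_def algebra_simps)
      then show ?thesis by (simp add: unit_pair_cnj[OF st])
    qed
    have "x div q < 2" "y div q < 2" using that by (auto simp: less_mult_imp_div_less)
    have num: "0 * 2 = (0::nat)" "0 + 1 = (1::nat)" "1 * 2 = (2::nat)" "2 + 1 = (3::nat)" by simp_all
    from \<open>x div q < 2\<close> \<open>y div q < 2\<close> have "x div q = 0 \<or> x div q = 1" "y div q = 0 \<or> y div q = 1" by auto
    then have "W (x div q * 2) w * cnj (W (y div q * 2) z) + W (x div q * 2 + 1) w * cnj (W (y div q * 2 + 1) z)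
      = V (x div q * 2) w * cnj (V (y div q * 2) z) + V (x div q * 2 + 1) w * cnj (V (y div q * 2 + 1) z)" for w z
      unfolding W_def by (elim disjE) (simp_all only: num mix_B_simps uni)
    then show ?thesis by (simp add: bs_def sum_lessThan_2 V_def slices_def)
  qed
  moreover have "(cost 2 as)\<^sup>2 + (cost q bs)\<^sup>2 \<le> (2 * area_rows (2 * q) k)\<^sup>2"
  proof -
    have "cost 2 as = 2 * (\<Sum>f\<leftarrow>as. cmod (f 0 * f 3 - f 1 * f (2::nat)))"
      by (simp add: cost_def area_rows_2 sum_list_const_mult)
    also have "\<dots> \<le> 2 * sqrt (det_A q V - (area_B q W)\<^sup>2)" using as_le by simp
    finally have "(cost 2 as)\<^sup>2 \<le> (2 * sqrt (det_A q V - (area_B q W)\<^sup>2))\<^sup>2"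
      using cost_nonneg by (intro power_mono)
    also have "\<dots> = 4 * (det_A q V - (area_B q W)\<^sup>2)"
      using le by (simp add: power_mult_distrib W_def)
    finally have a: "(cost 2 as)\<^sup>2 \<le> 4 * (det_A q V - (area_B q W)\<^sup>2)" .
    have "area_rows q (\<lambda>x. W (x div q * 2) (x mod q)) = area q (W 0) (W 2)"
      "area_rows q (\<lambda>x. W (x div q * 2 + 1) (x mod q)) = area q (W 1) (W 3)"
      unfolding area_rows_def by (rule area_cong; simp add: numeral_3_eq_3 numeral_2_eq_2)+
    then have b: "cost q bs = 2 * area_B q W"
      by (simp add: cost_def bs_def area_B_def)
    have "0 \<le> det_A q V" using le by (meson order_trans zero_le_power2)
    then have "(2 * area_rows (2 * q) k)\<^sup>2 = 4 * det_A q V"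
      by (simp add: area_rows_det_A power_mult_distrib V_def)
    then show ?thesis using a b by (simp add: power_mult_distrib)
  qed
  ultimately have "splits q k as bs" unfolding splits_def by blast
  then show ?thesis by blast
qed

text \<open>The triangle inequality in the plane, with the modulus of \<open>Complex\<close> as
  Euclidean norm.\<close>

lemma sum_list_minkowski:
  assumes "\<And>k. k \<in> set xs \<Longrightarrow> (f k)\<^sup>2 + (g k)\<^sup>2 \<le> (h k :: real)\<^sup>2 \<and> 0 \<le> h k"
  shows "cmod (Complex (\<Sum>k\<leftarrow>xs. f k) (\<Sum>k\<leftarrow>xs. g k)) \<le> (\<Sum>k\<leftarrow>xs. h k)"
  using assms
proof (induction xs)
  case (Cons a xs)
  have "Complex (\<Sum>k\<leftarrow>a # xs. f k) (\<Sum>k\<leftarrow>a # xs. g k)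
      = Complex (f a) (g a) + Complex (\<Sum>k\<leftarrow>xs. f k) (\<Sum>k\<leftarrow>xs. g k)" by (simp add: complex_eq_iff)
  then have "cmod (Complex (\<Sum>k\<leftarrow>a # xs. f k) (\<Sum>k\<leftarrow>a # xs. g k))
      \<le> cmod (Complex (f a) (g a)) + cmod (Complex (\<Sum>k\<leftarrow>xs. f k) (\<Sum>k\<leftarrow>xs. g k))"
    by (metis norm_triangle_ineq)
  also have "\<dots> \<le> h a + (\<Sum>k\<leftarrow>xs. h k)"
    using Cons by (intro add_mono) (auto simp: cmod_def intro: real_le_lsqrt)
  finally show ?case by simp
qed (simp add: cmod_def)

text \<open>Every vector of a nearly optimal ensemble of \<open>\<sigma>\<close> is split by
  \<open>pure_ensembles\<close>. The pieces concatenate to ensembles of both reductions, and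
  Minkowski's inequality adds up the inequalities for the single vectors.\<close>

lemma cren_monogamy:
  assumes q: "0 < q" and tr: "mat_trace \<sigma> = 1" and rep: "represents (2 * (2 * q)) \<sigma> ys"
  shows "(cren 2 2 (partial_trace_2_4 1 2 q \<sigma>))\<^sup>2 + (cren 2 q (partial_trace_2_4 2 q 1 \<sigma>))\<^sup>2 \<le> (cren 2 (2 * q) \<sigma>)\<^sup>2"
proof -
  define \<sigma>1 where "\<sigma>1 = partial_trace_2_4 1 2 q \<sigma>"
  define \<sigma>2 where "\<sigma>2 = partial_trace_2_4 2 q 1 \<sigma>"
  have dim: "dim_row \<sigma> = 2 * (2 * q)" using rep by (auto simp: represents_def)
  have tr1: "mat_trace \<sigma>1 = 1" "mat_trace \<sigma>2 = 1"
    unfolding \<sigma>1_def \<sigma>2_def using dim tr by (simp_all add: mat_trace_partial_trace)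
  have "cmod (Complex (cren 2 2 \<sigma>1) (cren 2 q \<sigma>2)) \<le> cren 2 (2 * q) \<sigma> + e" if e: "0 < e" for e
  proof -
    obtain xs where xs: "represents (2 * (2 * q)) \<sigma> xs" "cost (2 * q) xs < cren 2 (2 * q) \<sigma> + e"
      using cren_less_obtains[OF _ tr rep, of "cren 2 (2 * q) \<sigma> + e"] q e by auto
    have \<sigma>: "\<sigma> $$ (x, y) = (\<Sum>k\<leftarrow>xs. k x * cnj (k y))" if "x < 2 * (2 * q)" "y < 2 * (2 * q)" for x y
      using xs(1) that by (simp add: represents_def)
    obtain as bs where "splits q k (as k) (bs k)" for k using pure_ensembles[where q = q] by metis
    then have
      as: "\<And>k x y. \<lbrakk>x < 4; y < 4\<rbrakk> \<Longrightarrow> (\<Sum>v<q. k (x * q + v) * cnj (k (y * q + v))) = (\<Sum>f\<leftarrow>as k. f x * cnj (f y))"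
      and bs: "\<And>k x y. \<lbrakk>x < 2 * q; y < 2 * q\<rbrakk> \<Longrightarrow>
        (\<Sum>u<2. k ((x div q * 2 + u) * q + x mod q) * cnj (k ((y div q * 2 + u) * q + y mod q))) = (\<Sum>f\<leftarrow>bs k. f x * cnj (f y))"
      and le: "\<And>k. (cost 2 (as k))\<^sup>2 + (cost q (bs k))\<^sup>2 \<le> (2 * area_rows (2 * q) k)\<^sup>2"
      unfolding splits_def by blast+
    have "represents (2 * 2) \<sigma>1 (concat (map as xs))"
      unfolding represents_def
    proof (intro conjI allI impI)
      show "\<sigma>1 \<in> carrier_mat (2 * 2) (2 * 2)" unfolding \<sigma>1_def by (rule partial_trace_carrier)
      fix x y :: nat assume xy: "x < 2 * 2" "y < 2 * 2"
      have "\<sigma>1 $$ (x, y) = (\<Sum>v<q. \<sigma> $$ (x * q + v, y * q + v))"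
        unfolding \<sigma>1_def partial_trace_index[OF xy] by simp
      also have "\<dots> = (\<Sum>v<q. \<Sum>k\<leftarrow>xs. k (x * q + v) * cnj (k (y * q + v)))"
        using mult_add_less[OF xy(1)] mult_add_less[OF xy(2)] by (intro sum.cong refl \<sigma>) (auto simp: mult.assoc)
      also have "\<dots> = (\<Sum>k\<leftarrow>xs. \<Sum>f\<leftarrow>as k. f x * cnj (f y))"
        using xy by (simp add: sum_list_sum_swap[symmetric] as)
      finally show "\<sigma>1 $$ (x, y) = (\<Sum>f\<leftarrow>concat (map as xs). f x * cnj (f y))"
        by (simp add: sum_list_concat_map)
    qed
    from cren_le_cost[OF _ tr1(1) this]
    have c1: "cren 2 2 \<sigma>1 \<le> (\<Sum>k\<leftarrow>xs. cost 2 (as k))" by (simp add: cost_def sum_list_concat_map)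
    have "represents (2 * q) \<sigma>2 (concat (map bs xs))"
      unfolding represents_def
    proof (intro conjI allI impI)
      show "\<sigma>2 \<in> carrier_mat (2 * q) (2 * q)" unfolding \<sigma>2_def by (rule partial_trace_carrier)
      fix x y :: nat assume xy: "x < 2 * q" "y < 2 * q"
      have lt: "(x' div q * 2 + u) * q + x' mod q < 2 * (2 * q)" if "x' < 2 * q" "u < 2" for x' u
        using partial_trace_bounds[OF that, of 0 1] by simp
      have "\<sigma>2 $$ (x, y) = (\<Sum>u<2. \<sigma> $$ ((x div q * 2 + u) * q + x mod q, (y div q * 2 + u) * q + y mod q))"
        unfolding \<sigma>2_def partial_trace_index[OF xy] by simp
      also have "\<dots> = (\<Sum>u<2. \<Sum>k\<leftarrow>xs. k ((x div q * 2 + u) * q + x mod q) * cnj (k ((y div q * 2 + u) * q + y mod q)))"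
        using xy by (intro sum.cong refl \<sigma> lt) auto
      also have "\<dots> = (\<Sum>k\<leftarrow>xs. \<Sum>f\<leftarrow>bs k. f x * cnj (f y))"
        unfolding sum_list_sum_swap[symmetric] bs[OF xy] ..
      finally show "\<sigma>2 $$ (x, y) = (\<Sum>f\<leftarrow>concat (map bs xs). f x * cnj (f y))"
        by (simp add: sum_list_concat_map)
    qed
    from cren_le_cost[OF q tr1(2) this]
    have c2: "cren 2 q \<sigma>2 \<le> (\<Sum>k\<leftarrow>xs. cost q (bs k))" by (simp add: cost_def sum_list_concat_map)
    have nn: "0 \<le> cren 2 2 \<sigma>1" "0 \<le> cren 2 q \<sigma>2"
    proof -
      show "0 \<le> cren 2 2 \<sigma>1"
        using represents_partial_trace[of 1 2 q \<sigma> ys] rep tr1(1) cren_nonneg[of 2 \<sigma>1] by (auto simp: \<sigma>1_def mult.assoc)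
      show "0 \<le> cren 2 q \<sigma>2"
        using represents_partial_trace[of 2 q 1 \<sigma> ys] rep tr1(2) q cren_nonneg[of q \<sigma>2] by (auto simp: \<sigma>2_def mult.assoc)
    qed
    have "cmod (Complex (cren 2 2 \<sigma>1) (cren 2 q \<sigma>2)) \<le> cmod (Complex (\<Sum>k\<leftarrow>xs. cost 2 (as k)) (\<Sum>k\<leftarrow>xs. cost q (bs k)))"
      unfolding cmod_def using c1 c2 nn by (auto intro!: add_mono power_mono)
    also have "\<dots> \<le> (\<Sum>k\<leftarrow>xs. 2 * area_rows (2 * q) k)"
      by (rule sum_list_minkowski) (simp only: le area_rows_nonneg mult_nonneg_nonneg zero_le_numeral simp_thms)
    also have "\<dots> \<le> cren 2 (2 * q) \<sigma> + e" using xs(2) by (simp add: cost_def)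
    finally show ?thesis .
  qed
  then have le: "cmod (Complex (cren 2 2 \<sigma>1) (cren 2 q \<sigma>2)) \<le> cren 2 (2 * q) \<sigma>"
    by (rule field_le_epsilon)
  then have "(cmod (Complex (cren 2 2 \<sigma>1) (cren 2 q \<sigma>2)))\<^sup>2 \<le> (cren 2 (2 * q) \<sigma>)\<^sup>2"
    by (intro power_mono) auto
  then show ?thesis by (simp add: cmod_power2 \<sigma>1_def \<sigma>2_def)
qed

section \<open>Powers\<close>

text \<open>The derivative has the sign of \<open>1 + z powr (2 * t) - (1 + z) powr (t - 1)\<close>,
  and \<open>1 + z powr (2 * t) \<le> 1 + z \<le> (1 + z) powr (t - 1)\<close> for
  \<open>z \<le> 1\<close> and \<open>2 \<le> t\<close>.\<close>

lemma powr_quotient_antimono: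
  fixes t :: real
  assumes t: "2 \<le> t" and x: "0 < x" "x \<le> k" and k: "k \<le> 1"
  shows "((1 + k) powr t - 1) / k powr t + k powr t \<le> ((1 + x) powr t - 1) / x powr t + x powr t"
proof -
  define f where "f = (\<lambda>x. ((1 + x) powr t - 1) * x powr (- t) + x powr t)"
  have "f k \<le> f x"
  proof (rule DERIV_nonpos_imp_nonincreasing[OF x(2)])
    fix z assume z: "x \<le> z" "z \<le> k"
    then have z0: "0 < z" "z \<le> 1" using x k by auto
    define d where "d = t * (1 + z) powr (t - 1) * z powr (- t) + ((1 + z) powr t - 1) * (- t * z powr (- t - 1)) + t * z powr (t - 1)"
    have "(f has_real_derivative d) (at z)"
      unfolding f_def d_def using z0
      by (auto intro!: derivative_eq_intros simp: algebra_simps)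
    moreover have "d \<le> 0"
    proof -
      have e1: "z powr (- t) = z * z powr (- t - 1)" using z0 by (simp add: powr_mult_base)
      have e2: "z powr (t - 1) = z powr (2 * t) * z powr (- t - 1)" using z0 by (simp add: powr_add[symmetric])
      have e3: "(1 + z) powr t = (1 + z) * (1 + z) powr (t - 1)" using z0 by (simp add: powr_mult_base)
      have "d = t * z powr (- t - 1) * (1 - (1 + z) powr (t - 1) + z powr (2 * t))"
        unfolding d_def e1 e2 e3 by (simp add: algebra_simps)
      moreover have "1 + z powr (2 * t) \<le> (1 + z) powr (t - 1)"
      proof -
        have "z powr (2 * t) \<le> z powr 1" using z0 t by (intro powr_mono') auto
        moreover have "(1 + z) powr 1 \<le> (1 + z) powr (t - 1)" using z0 t by (intro powr_mono) auto
        ultimately show ?thesis using z0 by simp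
      qed
      ultimately show ?thesis using t by (simp add: mult_nonneg_nonpos)
    qed
    ultimately show "\<exists>d. (f has_real_derivative d) (at z) \<and> d \<le> 0" by blast
  qed
  then show ?thesis by (simp add: f_def powr_minus divide_inverse)
qed

text \<open>With \<open>x\<close> the ratio of the squares of \<open>b\<close> and \<open>a\<close>,
  \<open>M\<close> is at most the value at \<open>x\<close> of the decreasing function, which
  rearranges to a lower bound for \<open>(1 + x) powr (\<beta> / 2)\<close>. The first conclusion
  lets the inequalities be chained by multiplication.\<close>

lemma powr_monogamy_step:
  fixes a b c k \<beta> :: real
  assumes k: "0 < k" "k \<le> 1" and \<beta>: "4 \<le> \<beta>" and nn: "0 \<le> a" "0 \<le> b" "0 \<le> c"
    and mono: "a\<^sup>2 + b\<^sup>2 \<le> c\<^sup>2" and le: "b\<^sup>2 \<le> k * a\<^sup>2"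
  defines "M \<equiv> ((1 + k) powr (\<beta> / 2) - 1) / k powr (\<beta> / 2) + k powr (\<beta> / 2)"
  shows "0 \<le> M - b powr \<beta> / a powr \<beta>"
    and "a powr \<beta> + (M - b powr \<beta> / a powr \<beta>) * b powr \<beta> \<le> c powr \<beta>"
proof -
  have q: "0 \<le> ((1 + k) powr (\<beta> / 2) - 1) / k powr (\<beta> / 2)"
    using k \<beta> by (simp add: ge_one_powr_ge_zero)
  have sq: "(z\<^sup>2) powr (\<beta> / 2) = z powr \<beta>" if "0 \<le> z" for z :: real
    using that by (cases "z = 0") (simp_all add: powr_powr flip: powr_numeral)
  have "0 \<le> M - b powr \<beta> / a powr \<beta> \<and> a powr \<beta> + (M - b powr \<beta> / a powr \<beta>) * b powr \<beta> \<le> c powr \<beta>"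
  proof (cases "b = 0")
    \<comment> \<open>This covers \<open>a = 0\<close>, where \<open>le\<close> forces
      \<open>b = 0\<close>. The quotient of powers is 0 in either case.\<close>
    case True
    have "a powr \<beta> \<le> c powr \<beta>"
      using mono nn \<beta> True by (intro powr_mono2) (auto simp: power2_le_iff_abs_le)
    then show ?thesis using q True by (simp add: M_def)
  next
    case False
    then have b: "0 < b" using nn by simp
    then have "0 < k * a\<^sup>2" using le by (meson less_le_trans zero_less_power)
    then have a: "0 < a" using k nn by (cases "a = 0") auto
    define x where "x = b\<^sup>2 / a\<^sup>2"
    have x: "0 < x" "x \<le> k" using a b le by (auto simp: x_def divide_le_eq)
    have xt: "x powr (\<beta> / 2) = b powr \<beta> / a powr \<beta>"
      unfolding x_def using a b by (simp add: powr_divide sq)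
    have "x powr (\<beta> / 2) \<le> k powr (\<beta> / 2)" using x \<beta> by (intro powr_mono2) auto
    then have "0 \<le> M - b powr \<beta> / a powr \<beta>" using q unfolding M_def xt[symmetric] by simp
    moreover have "a powr \<beta> + (M - b powr \<beta> / a powr \<beta>) * b powr \<beta> \<le> c powr \<beta>"
    proof -
      have "M \<le> ((1 + x) powr (\<beta> / 2) - 1) / x powr (\<beta> / 2) + x powr (\<beta> / 2)"
        unfolding M_def using x k \<beta> by (intro powr_quotient_antimono) auto
      then have "(M - x powr (\<beta> / 2)) * x powr (\<beta> / 2) \<le> (1 + x) powr (\<beta> / 2) - 1"
        using x by (simp add: field_simps)
      then have "a powr \<beta> * (1 + (M - x powr (\<beta> / 2)) * x powr (\<beta> / 2)) \<le> a powr \<beta> * (1 + x) powr (\<beta> / 2)"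
        by (intro mult_left_mono) auto
      also have "\<dots> = (a\<^sup>2 * (1 + x)) powr (\<beta> / 2)"
        using a x by (simp add: powr_mult sq)
      also have "a\<^sup>2 * (1 + x) = a\<^sup>2 + b\<^sup>2" using a by (simp add: x_def field_simps)
      also have "(a\<^sup>2 + b\<^sup>2) powr (\<beta> / 2) \<le> (c\<^sup>2) powr (\<beta> / 2)"
        using mono \<beta> by (intro powr_mono2) auto
      also have "\<dots> = c powr \<beta>" using nn(3) by (rule sq)
      finally have "a powr \<beta> * (1 + (M - x powr (\<beta> / 2)) * x powr (\<beta> / 2)) \<le> c powr \<beta>" .
      then have "a powr \<beta> + (M - x powr (\<beta> / 2)) * (a powr \<beta> * x powr (\<beta> / 2)) \<le> c powr \<beta>"
        by (simp only: distrib_left mult_1_right mult_ac)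
      moreover have "a powr \<beta> * x powr (\<beta> / 2) = b powr \<beta>" unfolding xt using a by simp
      ultimately show ?thesis by (simp only: xt)
    qed
    ultimately show ?thesis by blast
  qed
  then show "0 \<le> M - b powr \<beta> / a powr \<beta>"
    and "a powr \<beta> + (M - b powr \<beta> / a powr \<beta>) * b powr \<beta> \<le> c powr \<beta>" by blast+
qed

text \<open>The term \<open>u 1\<close> that the recursion produces first is discarded.\<close>

lemma weighted_telescope:
  fixes u v P :: "nat \<Rightarrow> real"
  assumes step: "\<And>j. \<lbrakk>1 \<le> j; j \<le> n\<rbrakk> \<Longrightarrow> u j + P j * v (j + 1) \<le> v j"
    and P: "\<And>j. \<lbrakk>1 \<le> j; j \<le> n\<rbrakk> \<Longrightarrow> 0 \<le> P j"
    and last: "u (n + 1) \<le> v (n + 1)" and u: "0 \<le> u 1" and v: "0 \<le> v 1"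
  shows "(\<Sum>i = 1..n. (\<Prod>j = 1..i. P j) * u (i + 1)) \<le> v 1"
proof -
  \<comment> \<open>After \<open>m\<close> steps the last product still multiplies the tail
    \<open>v (m + 1)\<close>, not yet split; hence the sum stops before \<open>m\<close>.\<close>
  have main: "(\<Sum>i = 1..<m. (\<Prod>j = 1..i. P j) * u (i + 1)) + (\<Prod>j = 1..m. P j) * v (m + 1) \<le> v 1"
    if "m \<le> n" for m
    using that
  proof (induction m)
    case 0
    then show ?case by simp
  next
    case (Suc m)
    have Pm: "0 \<le> (\<Prod>j = 1..m. P j)" using P Suc.prems by (intro prod_nonneg) auto
    have "(\<Prod>j = 1..m. P j) * (u (m + 1) + P (m + 1) * v (m + 2)) \<le> (\<Prod>j = 1..m. P j) * v (m + 1)"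
      using step[of "m + 1"] Suc.prems by (intro mult_left_mono[OF _ Pm]) simp
    moreover have "(\<Sum>i = 1..<Suc m. (\<Prod>j = 1..i. P j) * u (i + 1))
      \<le> (\<Sum>i = 1..<m. (\<Prod>j = 1..i. P j) * u (i + 1)) + (\<Prod>j = 1..m. P j) * u (m + 1)"
      using u by (cases m) simp_all
    ultimately show ?case using Suc by (simp add: algebra_simps)
  qed
  show ?thesis
  proof (cases n)
    case 0
    then show ?thesis using v by simp
  next
    case (Suc m)
    have "(\<Prod>j = 1..n. P j) * u (n + 1) \<le> (\<Prod>j = 1..n. P j) * v (n + 1)"
      using P by (intro mult_left_mono[OF last] prod_nonneg) auto
    moreover have "(\<Sum>i = 1..n. (\<Prod>j = 1..i. P j) * u (i + 1))
      = (\<Sum>i = 1..<n. (\<Prod>j = 1..i. P j) * u (i + 1)) + (\<Prod>j = 1..n. P j) * u (n + 1)"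
      using Suc by (simp add: sum.last_plus[of 1 n] atLeastLessThanSuc_atLeastAtMost add.commute)
    ultimately show ?thesis using main[of n] by simp
  qed
qed

section \<open>From a single monogamy step to N qubits\<close>

theorem theorem4:
  fixes k \<beta> M :: real and N :: nat and \<rho> :: "complex mat"
    and N_pair N_tail P :: "nat \<Rightarrow> real"
  defines "N_pair \<equiv> \<lambda>i. cren_A_B N i i \<rho>"
    and "N_tail \<equiv> \<lambda>i. cren_A_B N i (N - 1) \<rho>"
    and "M \<equiv> ((1 + k) powr (\<beta> / 2) - 1) / k powr (\<beta> / 2) + k powr (\<beta> / 2)"
    and "P \<equiv> \<lambda>j. M - N_tail (j + 1) powr \<beta> / N_pair j powr \<beta>"
  assumes "0 < k" and "k \<le> 1"
    and "2 \<le> N" and "density_matrix (2 ^ N) \<rho>"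
    and "\<forall>i\<in>{1..N - 2}. k * (N_pair i)\<^sup>2 \<ge> (N_tail (i + 1))\<^sup>2"
    and "4 \<le> \<beta>"
  shows "N_tail 1 powr \<beta> \<ge> (\<Sum>i = 1..N - 2. (\<Prod>j = 1..i. P j) * N_pair (i + 1) powr \<beta>)"
proof -
  have tr: "mat_trace \<rho> = 1" and psd: "psd (2 ^ N) \<rho>"
    using \<open>density_matrix (2 ^ N) \<rho>\<close> by (auto simp: density_matrix_def)
  have dim: "dim_row \<rho> = 2 ^ N" using psd by (auto simp: psd_def)
  obtain xs where rep: "represents (2 ^ N) \<rho> xs" using psd_represents[OF psd] by blast
  have reduced: "mat_trace (partial_trace_2_4 p q r \<rho>) = 1"
    "\<exists>ys. represents (2 * q) (partial_trace_2_4 p q r \<rho>) ys" if "2 * p * q * r = 2 ^ N" for p q r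
    using that mat_trace_partial_trace[of \<rho> p q r] represents_partial_trace[of p q r \<rho> xs] tr dim rep by simp_all
  have nonneg: "0 \<le> cren_A_B N i l \<rho>" if il: "1 \<le> i" "i \<le> l" "l \<le> N - 1" for i l
  proof -
    have "2 * 2 ^ (i - 1) * 2 ^ (l + 1 - i) * 2 ^ (N - 1 - l) = (2::nat) ^ (1 + (i - 1) + (l + 1 - i) + (N - 1 - l))"
      by (simp add: power_add)
    also have "1 + (i - 1) + (l + 1 - i) + (N - 1 - l) = N" using il \<open>2 \<le> N\<close> by simp
    finally show ?thesis
      using reduced[of "2 ^ (i - 1)" "2 ^ (l + 1 - i)" "2 ^ (N - 1 - l)"] cren_nonneg[of "2 ^ (l + 1 - i)"]
      unfolding cren_A_B_def reduced_A_B_def by auto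
  qed
  have mono: "(N_pair j)\<^sup>2 + (N_tail (j + 1))\<^sup>2 \<le> (N_tail j)\<^sup>2" if j: "1 \<le> j" "j \<le> N - 2" for j
  proof -
    define p :: nat where "p = 2 ^ (j - 1)"
    define q :: nat where "q = 2 ^ (N - 1 - j)"
    \<comment> \<open>The state of \<open>A, B_j, ..., B_{N-1}\<close>, read as \<open>A\<close>,
      the qubit \<open>B = B_j\<close> and the remaining system \<open>C\<close> of dimension
      \<open>q\<close>.\<close>
    define \<sigma> where "\<sigma> = partial_trace_2_4 p (2 * q) 1 \<rho>"
    have pow: "2 ^ (N - 1 + 1 - j) = 2 * q" "2 ^ j = p * 2"
    proof -
      have "N - 1 + 1 - j = Suc (N - 1 - j)" using j by simp
      then show "2 ^ (N - 1 + 1 - j) = 2 * q" by (simp only: q_def power_Suc)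
      have "j = Suc (j - 1)" using j by simp
      then have "2 ^ j = (2::nat) ^ Suc (j - 1)" by simp
      then show "2 ^ j = p * 2" by (simp add: p_def)
    qed
    have "2 * p * (2 * q) * 1 = (2::nat) ^ (1 + (j - 1) + 1 + (N - 1 - j))"
      by (simp add: p_def q_def power_add)
    also have "1 + (j - 1) + 1 + (N - 1 - j) = N" using j by simp
    finally have d: "2 * p * (2 * q) * 1 = 2 ^ N" .
    obtain ys where ys: "represents (2 * (2 * q)) \<sigma> ys" using reduced(2)[OF d] by (auto simp: \<sigma>_def)
    have pair: "N_pair j = cren 2 2 (partial_trace_2_4 1 2 q \<sigma>)"
      unfolding N_pair_def cren_A_B_def reduced_A_B_def \<sigma>_def partial_trace_AB
      by (simp add: p_def q_def)
    have tail: "N_tail j = cren 2 (2 * q) \<sigma>"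
      unfolding N_tail_def cren_A_B_def reduced_A_B_def pow by (simp add: \<sigma>_def p_def)
    have "N - 1 + 1 - (j + 1) = N - 1 - j" by simp
    then have tail': "N_tail (j + 1) = cren 2 q (partial_trace_2_4 2 q 1 \<sigma>)"
      unfolding N_tail_def cren_A_B_def reduced_A_B_def \<sigma>_def partial_trace_AC
      by (simp add: pow q_def)
    show ?thesis
      unfolding pair tail tail' using reduced(1)[OF d] ys
      by (intro cren_monogamy) (auto simp: \<sigma>_def q_def)
  qed
  have step: "0 \<le> P j \<and> N_pair j powr \<beta> + P j * N_tail (j + 1) powr \<beta> \<le> N_tail j powr \<beta>"
    if j: "1 \<le> j" "j \<le> N - 2" for j
  proof -
    have nn: "0 \<le> N_pair j" "0 \<le> N_tail (j + 1)" "0 \<le> N_tail j"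
      unfolding N_pair_def N_tail_def using j by (auto intro!: nonneg)
    have "(N_tail (j + 1))\<^sup>2 \<le> k * (N_pair j)\<^sup>2" using assms(9) j by auto
    from powr_monogamy_step[OF \<open>0 < k\<close> \<open>k \<le> 1\<close> \<open>4 \<le> \<beta>\<close> nn mono[OF j] this]
    show ?thesis unfolding P_def M_def by blast
  qed
  show ?thesis
  proof (rule weighted_telescope[where u = "\<lambda>i. N_pair i powr \<beta>" and v = "\<lambda>i. N_tail i powr \<beta>"])
    \<comment> \<open>The last tail is a single qubit, so there pair and tail are the same reduced
      state.\<close>
    have "N - 2 + 1 = N - 1" using \<open>2 \<le> N\<close> by simp
    then show "N_pair (N - 2 + 1) powr \<beta> \<le> N_tail (N - 2 + 1) powr \<beta>"
      by (simp add: N_pair_def N_tail_def)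
  qed (use step in auto)
qed

end
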